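(* Let $\mathcal{N}$ be an exact category. The canonical map $K_0(\Omega_{[0,4]}\mathcal{N})\to K_0(\Omega\mathcal{N})$ is a surjection.
   Context: All chain complexes are bounded and $\mathbb{N}$-graded (concentrated in degrees $\ge 0$). A chain complex $(P_*,d)$ in $\mathcal{N}$ is acyclic if each differential factors as an admissible epimorphism followed by an admissible monomorphism $d_n\colon P_n\twoheadrightarrow J_{n-1}\rightarrowtail P_{n-1}$ such that $J_n\rightarrowtail P_n\twoheadrightarrow J_{n-1}$ is a short exact sequence for every $n$. A binary acyclic complex $(P_*,d,d')$ is a graded object $P_*$ over $\mathcal{N}$ with two degree $-1$ maps $d$ (top differential) and $d'$ (bottom differential) such that $(P_*,d)$ and $(P_*,d')$ are both acyclic chain complexes. Morphisms are degree $0$ maps that are chain maps for both top and both bottom differentials; the resulting category $B^q\mathcal{N}$ is exact with the degreewise exact structure. For an interval $J\subseteq\mathbb{Z}$, $B^q_J\mathcal{N}\subseteq B^q\mathcal{N}$ is the full exact subcategory of complexes supported on $J$ (zero in degrees outside $J$). $K_0(\Omega\mathcal{N})$ (respectively $K_0(\Omega_J\mathcal{N})$) is the Grothendieck group of $B^q\mathcal{N}$ (respectively $B^q_J\mathcal{N}$) modulo the subgroup generated by the classes of complexes whose top and bottom differentials coincide. The canonical map is induced by the inclusion $B^q_{[0,4]}\mathcal{N}\subseteq B^q\mathcal{N}$. *)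

theory Defs
  imports "HOL-Algebra.Free_Abelian_Groups" "HOL-Algebra.Generated_Groups"
begin

section \<open>Exact categories\<close>

(* The operations on morphisms do not take the objects as arguments, and Hom sets are not required
   to be disjoint.  This is no loss of generality: morphisms can always be tagged with their source
   and target.  Ses C A i B p D means that A >-> B ->> D (with maps i and p) is one of the
   distinguished short exact sequences. *)
record ('o, 'm) excat =
  Obj :: "'o set"
  Hom :: "'o \<Rightarrow> 'o \<Rightarrow> 'm set"
  Ident :: "'o \<Rightarrow> 'm"
  Comp :: "'m \<Rightarrow> 'm \<Rightarrow> 'm"  (infixl \<open>\<star>\<index>\<close> 70)
  Plus :: "'m \<Rightarrow> 'm \<Rightarrow> 'm"
  Zero :: "'o \<Rightarrow> 'o \<Rightarrow> 'm"
  Ses :: "'o \<Rightarrow> 'm \<Rightarrow> 'o \<Rightarrow> 'm \<Rightarrow> 'o \<Rightarrow> bool"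

locale category =
  fixes C :: "('o, 'm, 'z) excat_scheme" (structure)
  assumes Ident_in: "A \<in> Obj C \<Longrightarrow> Ident C A \<in> Hom C A A"
    and Comp_in: "\<lbrakk>A \<in> Obj C; B \<in> Obj C; D \<in> Obj C; f \<in> Hom C A B; g \<in> Hom C B D\<rbrakk>
      \<Longrightarrow> g \<star> f \<in> Hom C A D"
    and Ident_left: "\<lbrakk>A \<in> Obj C; B \<in> Obj C; f \<in> Hom C A B\<rbrakk> \<Longrightarrow> Ident C B \<star> f = f"
    and Ident_right: "\<lbrakk>A \<in> Obj C; B \<in> Obj C; f \<in> Hom C A B\<rbrakk> \<Longrightarrow> f \<star> Ident C A = f"
    and Comp_assoc: "\<lbrakk>A \<in> Obj C; B \<in> Obj C; D \<in> Obj C; E \<in> Obj C;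
        f \<in> Hom C A B; g \<in> Hom C B D; h \<in> Hom C D E\<rbrakk>
      \<Longrightarrow> (h \<star> g) \<star> f = h \<star> (g \<star> f)"

definition hom_group :: "('o, 'm, 'z) excat_scheme \<Rightarrow> 'o \<Rightarrow> 'o \<Rightarrow> 'm monoid" where
  "hom_group C A B = \<lparr>carrier = Hom C A B, monoid.mult = Plus C, one = Zero C A B\<rparr>"

definition zero_object :: "('o, 'm, 'z) excat_scheme \<Rightarrow> 'o \<Rightarrow> bool" where
  "zero_object C Z \<longleftrightarrow> Z \<in> Obj C \<and>
     (\<forall>A\<in>Obj C. (\<exists>!f. f \<in> Hom C A Z) \<and> (\<exists>!f. f \<in> Hom C Z A))"

definition biproduct ::
  "('o, 'm, 'z) excat_scheme \<Rightarrow> 'o \<Rightarrow> 'o \<Rightarrow> 'o \<Rightarrow> 'm \<Rightarrow> 'm \<Rightarrow> 'm \<Rightarrow> 'm \<Rightarrow> bool" where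
  "biproduct C A B S i j p q \<longleftrightarrow> S \<in> Obj C \<and>
     i \<in> Hom C A S \<and> j \<in> Hom C B S \<and> p \<in> Hom C S A \<and> q \<in> Hom C S B \<and>
     p \<star>\<^bsub>C\<^esub> i = Ident C A \<and> q \<star>\<^bsub>C\<^esub> j = Ident C B \<and>
     p \<star>\<^bsub>C\<^esub> j = Zero C B A \<and> q \<star>\<^bsub>C\<^esub> i = Zero C A B \<and>
     Plus C (i \<star>\<^bsub>C\<^esub> p) (j \<star>\<^bsub>C\<^esub> q) = Ident C S"

locale additive_category = category +
  assumes hom_comm_group: "\<lbrakk>A \<in> Obj C; B \<in> Obj C\<rbrakk> \<Longrightarrow> comm_group (hom_group C A B)"
    and Comp_Plus_left: "\<lbrakk>A \<in> Obj C; B \<in> Obj C; D \<in> Obj C;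
        f \<in> Hom C A B; g \<in> Hom C B D; g' \<in> Hom C B D\<rbrakk>
      \<Longrightarrow> Plus C g g' \<star> f = Plus C (g \<star> f) (g' \<star> f)"
    and Comp_Plus_right: "\<lbrakk>A \<in> Obj C; B \<in> Obj C; D \<in> Obj C;
        f \<in> Hom C A B; f' \<in> Hom C A B; g \<in> Hom C B D\<rbrakk>
      \<Longrightarrow> g \<star> Plus C f f' = Plus C (g \<star> f) (g \<star> f')"
    and ex_zero_object: "\<exists>Z. zero_object C Z"
    and ex_biproduct: "\<lbrakk>A \<in> Obj C; B \<in> Obj C\<rbrakk> \<Longrightarrow> \<exists>S i j p q. biproduct C A B S i j p q"

definition isomorphism :: "('o, 'm, 'z) excat_scheme \<Rightarrow> 'o \<Rightarrow> 'm \<Rightarrow> 'o \<Rightarrow> bool" where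
  "isomorphism C A f B \<longleftrightarrow> f \<in> Hom C A B \<and>
     (\<exists>g\<in>Hom C B A. g \<star>\<^bsub>C\<^esub> f = Ident C A \<and> f \<star>\<^bsub>C\<^esub> g = Ident C B)"

definition is_kernel :: "('o, 'm, 'z) excat_scheme \<Rightarrow> 'o \<Rightarrow> 'm \<Rightarrow> 'o \<Rightarrow> 'm \<Rightarrow> 'o \<Rightarrow> bool" where
  "is_kernel C A i B p D \<longleftrightarrow>
     i \<in> Hom C A B \<and> p \<in> Hom C B D \<and> p \<star>\<^bsub>C\<^esub> i = Zero C A D \<and>
     (\<forall>T\<in>Obj C. \<forall>f\<in>Hom C T B. p \<star>\<^bsub>C\<^esub> f = Zero C T D \<longrightarrow>
        (\<exists>!u. u \<in> Hom C T A \<and> i \<star>\<^bsub>C\<^esub> u = f))"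

definition is_cokernel :: "('o, 'm, 'z) excat_scheme \<Rightarrow> 'o \<Rightarrow> 'm \<Rightarrow> 'o \<Rightarrow> 'm \<Rightarrow> 'o \<Rightarrow> bool" where
  "is_cokernel C A i B p D \<longleftrightarrow>
     i \<in> Hom C A B \<and> p \<in> Hom C B D \<and> p \<star>\<^bsub>C\<^esub> i = Zero C A D \<and>
     (\<forall>T\<in>Obj C. \<forall>f\<in>Hom C B T. f \<star>\<^bsub>C\<^esub> i = Zero C A T \<longrightarrow>
        (\<exists>!u. u \<in> Hom C D T \<and> u \<star>\<^bsub>C\<^esub> p = f))"

(* pushout C A i B f A' i' B' f' : the square with top i : A \<rightarrow> B, left f : A \<rightarrow> A',
   bottom i' : A' \<rightarrow> B' and right f' : B \<rightarrow> B' is a pushout of i along f. *)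
definition pushout :: "('o, 'm, 'z) excat_scheme \<Rightarrow>
    'o \<Rightarrow> 'm \<Rightarrow> 'o \<Rightarrow> 'm \<Rightarrow> 'o \<Rightarrow> 'm \<Rightarrow> 'o \<Rightarrow> 'm \<Rightarrow> bool" where
  "pushout C A i B f A' i' B' f' \<longleftrightarrow> B' \<in> Obj C \<and>
     i \<in> Hom C A B \<and> f \<in> Hom C A A' \<and> i' \<in> Hom C A' B' \<and> f' \<in> Hom C B B' \<and>
     f' \<star>\<^bsub>C\<^esub> i = i' \<star>\<^bsub>C\<^esub> f \<and>
     (\<forall>T\<in>Obj C. \<forall>g\<in>Hom C B T. \<forall>h\<in>Hom C A' T. g \<star>\<^bsub>C\<^esub> i = h \<star>\<^bsub>C\<^esub> f \<longrightarrow>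
        (\<exists>!u. u \<in> Hom C B' T \<and> u \<star>\<^bsub>C\<^esub> f' = g \<and> u \<star>\<^bsub>C\<^esub> i' = h))"

(* pullback C B p D f D' p' B' f' : the square with bottom p : B \<rightarrow> D, right f : D' \<rightarrow> D,
   top p' : B' \<rightarrow> D' and left f' : B' \<rightarrow> B is a pullback of p along f. *)
definition pullback :: "('o, 'm, 'z) excat_scheme \<Rightarrow>
    'o \<Rightarrow> 'm \<Rightarrow> 'o \<Rightarrow> 'm \<Rightarrow> 'o \<Rightarrow> 'm \<Rightarrow> 'o \<Rightarrow> 'm \<Rightarrow> bool" where
  "pullback C B p D f D' p' B' f' \<longleftrightarrow> B' \<in> Obj C \<and>
     p \<in> Hom C B D \<and> f \<in> Hom C D' D \<and> p' \<in> Hom C B' D' \<and> f' \<in> Hom C B' B \<and>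
     p \<star>\<^bsub>C\<^esub> f' = f \<star>\<^bsub>C\<^esub> p' \<and>
     (\<forall>T\<in>Obj C. \<forall>g\<in>Hom C T B. \<forall>h\<in>Hom C T D'. p \<star>\<^bsub>C\<^esub> g = f \<star>\<^bsub>C\<^esub> h \<longrightarrow>
        (\<exists>!u. u \<in> Hom C T B' \<and> f' \<star>\<^bsub>C\<^esub> u = g \<and> p' \<star>\<^bsub>C\<^esub> u = h))"

definition adm_mono :: "('o, 'm, 'z) excat_scheme \<Rightarrow> 'o \<Rightarrow> 'm \<Rightarrow> 'o \<Rightarrow> bool" where
  "adm_mono C A i B \<longleftrightarrow> (\<exists>p D. Ses C A i B p D)"

definition adm_epi :: "('o, 'm, 'z) excat_scheme \<Rightarrow> 'o \<Rightarrow> 'm \<Rightarrow> 'o \<Rightarrow> bool" where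
  "adm_epi C B p D \<longleftrightarrow> (\<exists>A i. Ses C A i B p D)"

(* Quillen's notion of exact category, in the self-dual axiomatisation of Keller and Buehler. *)
locale exact_category = additive_category +
  assumes Ses_Obj: "Ses C A i B p D \<Longrightarrow> A \<in> Obj C \<and> B \<in> Obj C \<and> D \<in> Obj C"
    and Ses_kernel: "Ses C A i B p D \<Longrightarrow> is_kernel C A i B p D"
    and Ses_cokernel: "Ses C A i B p D \<Longrightarrow> is_cokernel C A i B p D"
    and Ses_iso: "\<lbrakk>Ses C A i B p D; A' \<in> Obj C; B' \<in> Obj C; D' \<in> Obj C;
        i' \<in> Hom C A' B'; p' \<in> Hom C B' D';
        isomorphism C A a A'; isomorphism C B b B'; isomorphism C D c D';
        b \<star> i = i' \<star> a; c \<star> p = p' \<star> b\<rbrakk> \<Longrightarrow> Ses C A' i' B' p' D'"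
    and Ident_adm_mono: "A \<in> Obj C \<Longrightarrow> adm_mono C A (Ident C A) A"
    and Ident_adm_epi: "A \<in> Obj C \<Longrightarrow> adm_epi C A (Ident C A) A"
    and Comp_adm_mono: "\<lbrakk>adm_mono C A i B; adm_mono C B j D\<rbrakk> \<Longrightarrow> adm_mono C A (j \<star> i) D"
    and Comp_adm_epi: "\<lbrakk>adm_epi C A p B; adm_epi C B q D\<rbrakk> \<Longrightarrow> adm_epi C A (q \<star> p) D"
    and pushout_adm_mono: "\<lbrakk>adm_mono C A i B; A' \<in> Obj C; f \<in> Hom C A A'\<rbrakk>
      \<Longrightarrow> \<exists>i' B' f'. pushout C A i B f A' i' B' f' \<and> adm_mono C A' i' B'"
    and pullback_adm_epi: "\<lbrakk>adm_epi C B p D; D' \<in> Obj C; f \<in> Hom C D' D\<rbrakk>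
      \<Longrightarrow> \<exists>p' B' f'. pullback C B p D f D' p' B' f' \<and> adm_epi C B' p' D'"

definition full_subcategory :: "('o, 'm) excat \<Rightarrow> 'o set \<Rightarrow> ('o, 'm) excat" where
  "full_subcategory C S = C\<lparr>Obj := Obj C \<inter> S,
     Ses := (\<lambda>A i B p D. A \<in> S \<and> B \<in> S \<and> D \<in> S \<and> Ses C A i B p D)\<rparr>"


section \<open>Binary acyclic complexes\<close>

(* Graded objects are indexed by all integers; "\<nat>-graded" and "bounded" are conditions on the
   support.  The differential d n goes from degree n to degree n - 1. *)

definition supported_on :: "('o, 'm, 'z) excat_scheme \<Rightarrow> (int \<Rightarrow> 'o) \<Rightarrow> int set \<Rightarrow> bool" where
  "supported_on N P J \<longleftrightarrow> (\<forall>n. n \<notin> J \<longrightarrow> zero_object N (P n))"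

definition chain_complex :: "('o, 'm, 'z) excat_scheme \<Rightarrow> (int \<Rightarrow> 'o) \<Rightarrow> (int \<Rightarrow> 'm) \<Rightarrow> bool" where
  "chain_complex N P d \<longleftrightarrow>
     (\<forall>n. P n \<in> Obj N \<and> d n \<in> Hom N (P n) (P (n - 1)) \<and>
        d (n - 1) \<star>\<^bsub>N\<^esub> d n = Zero N (P n) (P (n - 2))) \<and>
     supported_on N P {0..} \<and> (\<exists>b. supported_on N P {..b})"

definition acyclic_complex :: "('o, 'm, 'z) excat_scheme \<Rightarrow> (int \<Rightarrow> 'o) \<Rightarrow> (int \<Rightarrow> 'm) \<Rightarrow> bool" where
  "acyclic_complex N P d \<longleftrightarrow> chain_complex N P d \<and>
     (\<exists>J p i. \<forall>n. adm_epi N (P n) (p n) (J (n - 1)) \<and> adm_mono N (J n) (i n) (P n) \<and>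
        d n = i (n - 1) \<star>\<^bsub>N\<^esub> p n \<and>
        Ses N (J n) (i n) (P n) (p n) (J (n - 1)))"

record ('o, 'm) bicomplex =
  gr :: "int \<Rightarrow> 'o"
  dtop :: "int \<Rightarrow> 'm"
  dbot :: "int \<Rightarrow> 'm"

definition binary_acyclic :: "('o, 'm, 'z) excat_scheme \<Rightarrow> ('o, 'm) bicomplex \<Rightarrow> bool" where
  "binary_acyclic N X \<longleftrightarrow>
     acyclic_complex N (gr X) (dtop X) \<and> acyclic_complex N (gr X) (dbot X)"

definition binary_chain_maps ::
  "('o, 'm, 'z) excat_scheme \<Rightarrow> ('o, 'm) bicomplex \<Rightarrow> ('o, 'm) bicomplex \<Rightarrow> (int \<Rightarrow> 'm) set" where
  "binary_chain_maps N X Y = {f. \<forall>n. f n \<in> Hom N (gr X n) (gr Y n) \<and>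
     f (n - 1) \<star>\<^bsub>N\<^esub> dtop X n = dtop Y n \<star>\<^bsub>N\<^esub> f n \<and>
     f (n - 1) \<star>\<^bsub>N\<^esub> dbot X n = dbot Y n \<star>\<^bsub>N\<^esub> f n}"

definition Bq :: "('o, 'm, 'z) excat_scheme \<Rightarrow> (('o, 'm) bicomplex, int \<Rightarrow> 'm) excat" where
  "Bq N = \<lparr>Obj = {X. binary_acyclic N X},
     Hom = binary_chain_maps N,
     Ident = (\<lambda>X n. Ident N (gr X n)),
     Comp = (\<lambda>g f n. g n \<star>\<^bsub>N\<^esub> f n),
     Plus = (\<lambda>f g n. Plus N (f n) (g n)),
     Zero = (\<lambda>X Y n. Zero N (gr X n) (gr Y n)),
     Ses = (\<lambda>X i Y p Z. binary_acyclic N X \<and> binary_acyclic N Y \<and> binary_acyclic N Z \<and>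
        i \<in> binary_chain_maps N X Y \<and> p \<in> binary_chain_maps N Y Z \<and>
        (\<forall>n. Ses N (gr X n) (i n) (gr Y n) (p n) (gr Z n)))\<rparr>"

definition Bq_on :: "int set \<Rightarrow> ('o, 'm, 'z) excat_scheme \<Rightarrow> (('o, 'm) bicomplex, int \<Rightarrow> 'm) excat" where
  "Bq_on J N = full_subcategory (Bq N) {X. supported_on N (gr X) J}"


section \<open>Grothendieck groups\<close>

definition ses_relations :: "('o, 'm, 'z) excat_scheme \<Rightarrow> ('o \<Rightarrow>\<^sub>0 int) set" where
  "ses_relations C = generate (free_Abelian_group (Obj C))
     {frag_of B - frag_of A - frag_of D | A i B p D. Ses C A i B p D}"

definition K0 :: "('o, 'm, 'z) excat_scheme \<Rightarrow> ('o \<Rightarrow>\<^sub>0 int) set monoid" where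
  "K0 C = free_Abelian_group (Obj C) Mod ses_relations C"

definition K0_class :: "('o, 'm, 'z) excat_scheme \<Rightarrow> 'o \<Rightarrow> ('o \<Rightarrow>\<^sub>0 int) set" where
  "K0_class C A = ses_relations C #>\<^bsub>free_Abelian_group (Obj C)\<^esub> frag_of A"

definition diagonal_subgroup ::
  "(('o, 'm) bicomplex, 'n, 'z) excat_scheme \<Rightarrow> (('o, 'm) bicomplex \<Rightarrow>\<^sub>0 int) set set" where
  "diagonal_subgroup E = generate (K0 E) (K0_class E ` {X \<in> Obj E. dtop X = dbot X})"

(* For E = Bq N this is K_0(\<Omega>N), and for E = Bq_on J N it is K_0(\<Omega>_J N). *)
definition K0_Omega ::
  "(('o, 'm) bicomplex, 'n, 'z) excat_scheme \<Rightarrow> (('o, 'm) bicomplex \<Rightarrow>\<^sub>0 int) set set monoid" where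
  "K0_Omega E = K0 E Mod diagonal_subgroup E"

definition K0_Omega_class :: "(('o, 'm) bicomplex, 'n, 'z) excat_scheme \<Rightarrow>
    ('o, 'm) bicomplex \<Rightarrow> (('o, 'm) bicomplex \<Rightarrow>\<^sub>0 int) set set" where
  "K0_Omega_class E X = diagonal_subgroup E #>\<^bsub>K0 E\<^esub> K0_class E X"

(* The maps induced by an inclusion of a full exact subcategory C in D.  The product of the
   subgroup defining the target with a coset of the smaller subgroup defining the source is the
   coset in the target of any representative; see K0_incl_coset and K0_Omega_incl_class. *)
definition K0_incl :: "('o, 'm, 'z) excat_scheme \<Rightarrow> ('o \<Rightarrow>\<^sub>0 int) set \<Rightarrow> ('o \<Rightarrow>\<^sub>0 int) set" where
  "K0_incl D c = ses_relations D <#>\<^bsub>free_Abelian_group (Obj D)\<^esub> c"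

definition K0_Omega_incl :: "(('o, 'm) bicomplex, 'n, 'z) excat_scheme \<Rightarrow>
    (('o, 'm) bicomplex \<Rightarrow>\<^sub>0 int) set set \<Rightarrow> (('o, 'm) bicomplex \<Rightarrow>\<^sub>0 int) set set" where
  "K0_Omega_incl D c = diagonal_subgroup D <#>\<^bsub>K0 D\<^esub> (K0_incl D ` c)"

lemma coset_map:
  assumes "group_hom G G' f" "H \<lhd> G" "H' \<lhd> G'" "f ` H \<subseteq> H'"
  shows coset_map_coset: "\<And>x. x \<in> carrier G \<Longrightarrow> H' <#>\<^bsub>G'\<^esub> (f ` (H #>\<^bsub>G\<^esub> x)) = H' #>\<^bsub>G'\<^esub> f x"
    and coset_map_hom: "(\<lambda>c. H' <#>\<^bsub>G'\<^esub> (f ` c)) \<in> hom (G Mod H) (G' Mod H')"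
proof -
  interpret group_hom G G' f by fact
  interpret N: normal H G by fact
  interpret N': normal H' G' by fact
  show cos: "H' <#>\<^bsub>G'\<^esub> (f ` (H #>\<^bsub>G\<^esub> x)) = H' #>\<^bsub>G'\<^esub> f x" if x: "x \<in> carrier G" for x
  proof (intro equalityI subsetI)
    fix y assume "y \<in> H' <#>\<^bsub>G'\<^esub> (f ` (H #>\<^bsub>G\<^esub> x))"
    then obtain h' h where h: "h' \<in> H'" "h \<in> H" "y = h' \<otimes>\<^bsub>G'\<^esub> f (h \<otimes>\<^bsub>G\<^esub> x)"
      unfolding set_mult_def r_coset_def by blast
    have fh: "f h \<in> H'" using h(2) assms(4) by blast
    have "y = (h' \<otimes>\<^bsub>G'\<^esub> f h) \<otimes>\<^bsub>G'\<^esub> f x"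
      using h x fh by (simp add: H.m_assoc)
    then show "y \<in> H' #>\<^bsub>G'\<^esub> f x"
      unfolding r_coset_def using N'.m_closed[OF h(1) fh] by blast
  next
    fix y assume "y \<in> H' #>\<^bsub>G'\<^esub> f x"
    then obtain h' where h: "h' \<in> H'" "y = h' \<otimes>\<^bsub>G'\<^esub> f x"
      unfolding r_coset_def by blast
    have "x \<in> H #>\<^bsub>G\<^esub> x"
      using x by (simp add: N.is_subgroup G.rcos_self)
    then show "y \<in> H' <#>\<^bsub>G'\<^esub> (f ` (H #>\<^bsub>G\<^esub> x))"
      unfolding set_mult_def using h by blast
  qed
  show "(\<lambda>c. H' <#>\<^bsub>G'\<^esub> (f ` c)) \<in> hom (G Mod H) (G' Mod H')"
  proof (rule homI)
    fix c assume "c \<in> carrier (G Mod H)"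
    then obtain x where "x \<in> carrier G" "c = H #>\<^bsub>G\<^esub> x"
      by (auto simp: carrier_FactGroup)
    then show "H' <#>\<^bsub>G'\<^esub> (f ` c) \<in> carrier (G' Mod H')"
      using cos by (auto simp: carrier_FactGroup)
  next
    fix c d assume "c \<in> carrier (G Mod H)" "d \<in> carrier (G Mod H)"
    then obtain x y where xy: "x \<in> carrier G" "c = H #>\<^bsub>G\<^esub> x" "y \<in> carrier G" "d = H #>\<^bsub>G\<^esub> y"
      by (auto simp: carrier_FactGroup)
    then show "H' <#>\<^bsub>G'\<^esub> (f ` (c \<otimes>\<^bsub>G Mod H\<^esub> d)) =
        (H' <#>\<^bsub>G'\<^esub> (f ` c)) \<otimes>\<^bsub>G' Mod H'\<^esub> (H' <#>\<^bsub>G'\<^esub> (f ` d))"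
      by (simp add: N.rcos_sum N'.rcos_sum cos)
  qed
qed

context
  fixes D :: "('o, 'm) excat"
  assumes Ses_Obj: "\<And>A i B p E. Ses D A i B p E \<Longrightarrow> A \<in> Obj D \<and> B \<in> Obj D \<and> E \<in> Obj D"
begin

lemma ses_relations_normal: "ses_relations D \<lhd> free_Abelian_group (Obj D)"
proof -
  interpret F: comm_group "free_Abelian_group (Obj D)"
    by (rule abelian_free_Abelian_group)
  have "{frag_of B - frag_of A - frag_of E | A i B p E. Ses D A i B p E}
      \<subseteq> carrier (free_Abelian_group (Obj D))"
    using Ses_Obj by (force dest!: subsetD[OF keys_diff])
  then show ?thesis
    unfolding ses_relations_def
    by (intro F.subgroup_imp_normal F.generate_is_subgroup)
qed

lemma comm_group_K0: "comm_group (K0 D)"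
proof -
  interpret F: comm_group "free_Abelian_group (Obj D)"
    by (rule abelian_free_Abelian_group)
  show ?thesis
    unfolding K0_def using ses_relations_normal
    by (intro F.abelian_FactGroup) (simp add: normal_imp_subgroup)
qed

lemma K0_class_in: "A \<in> Obj D \<Longrightarrow> K0_class D A \<in> carrier (K0 D)"
  by (auto simp: K0_class_def K0_def carrier_FactGroup)

end

context
  fixes D :: "('o, 'm) excat" and S :: "'o set"
  assumes Ses_Obj: "\<And>A i B p E. Ses D A i B p E \<Longrightarrow> A \<in> Obj D \<and> B \<in> Obj D \<and> E \<in> Obj D"
begin

lemma Ses_Obj_full_subcategory:
  "Ses (full_subcategory D S) A i B p E \<Longrightarrow> A \<in> Obj (full_subcategory D S) \<and>
     B \<in> Obj (full_subcategory D S) \<and> E \<in> Obj (full_subcategory D S)"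
  using Ses_Obj by (auto simp: full_subcategory_def)

lemma group_hom_free_incl: "group_hom (free_Abelian_group (Obj (full_subcategory D S)))
    (free_Abelian_group (Obj D)) (\<lambda>x. x)"
  by (intro group_hom.intro group_hom_axioms.intro homI)
     (auto simp: full_subcategory_def)

lemma ses_relations_full_subcategory: "ses_relations (full_subcategory D S) \<subseteq> ses_relations D"
proof
  let ?C = "full_subcategory D S"
  let ?R = "{frag_of B - frag_of A - frag_of E | A i B p E. Ses ?C A i B p E}"
  interpret group_hom "free_Abelian_group (Obj ?C)" "free_Abelian_group (Obj D)" "\<lambda>x. x"
    by (rule group_hom_free_incl)
  interpret normal "ses_relations D" "free_Abelian_group (Obj D)"
    using Ses_Obj by (rule ses_relations_normal)
  have R: "?R \<subseteq> carrier (free_Abelian_group (Obj ?C))"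
    using Ses_Obj_full_subcategory by (force dest!: subsetD[OF keys_diff])
  have gen: "h \<in> ses_relations D" if "h \<in> ?R" for h
  proof -
    have "h \<in> {frag_of B - frag_of A - frag_of E | A i B p E. Ses D A i B p E}"
      using that by (force simp: full_subcategory_def)
    then show ?thesis unfolding ses_relations_def by (rule generate.incl)
  qed
  fix x assume "x \<in> ses_relations ?C"
  then show "x \<in> ses_relations D"
    unfolding ses_relations_def[of ?C]
  proof (induction rule: generate.induct)
    case one
    then show ?case using one_closed by simp
  next
    case (incl h)
    then show ?case by (rule gen)
  next
    case (inv h)
    then have "inv\<^bsub>free_Abelian_group (Obj D)\<^esub> h = inv\<^bsub>free_Abelian_group (Obj ?C)\<^esub> h"
      using R hom_inv[of h] by (simp only: subset_iff)
    then show ?case using m_inv_closed[OF gen[OF inv]] by simp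
  next
    case (eng h1 h2)
    then show ?case using m_closed by simp
  qed
qed

lemma K0_incl_coset:
  assumes "x \<in> carrier (free_Abelian_group (Obj (full_subcategory D S)))"
  shows "K0_incl D (ses_relations (full_subcategory D S)
      #>\<^bsub>free_Abelian_group (Obj (full_subcategory D S))\<^esub> x)
    = ses_relations D #>\<^bsub>free_Abelian_group (Obj D)\<^esub> x"
  using coset_map_coset[OF group_hom_free_incl
      ses_relations_normal[OF Ses_Obj_full_subcategory] ses_relations_normal[OF Ses_Obj] _ assms]
    ses_relations_full_subcategory
  by (simp add: K0_incl_def)

lemma K0_incl_class: "A \<in> Obj (full_subcategory D S) \<Longrightarrow>
    K0_incl D (K0_class (full_subcategory D S) A) = K0_class D A"
  unfolding K0_class_def by (rule K0_incl_coset) auto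

lemma K0_incl_hom: "K0_incl D \<in> hom (K0 (full_subcategory D S)) (K0 D)"
proof -
  have "(\<lambda>c. ses_relations D <#>\<^bsub>free_Abelian_group (Obj D)\<^esub> ((\<lambda>x. x) ` c))
      \<in> hom (K0 (full_subcategory D S)) (K0 D)"
    unfolding K0_def
    using ses_relations_full_subcategory
    by (intro coset_map_hom group_hom_free_incl ses_relations_normal[OF Ses_Obj]
        ses_relations_normal[OF Ses_Obj_full_subcategory]) auto
  then show ?thesis by (simp add: K0_incl_def[abs_def])
qed

end

lemma diagonal_subgroup_normal:
  fixes D :: "(('o, 'm) bicomplex, 'n) excat"
  assumes "\<And>A i B p E. Ses D A i B p E \<Longrightarrow> A \<in> Obj D \<and> B \<in> Obj D \<and> E \<in> Obj D"
  shows "diagonal_subgroup D \<lhd> K0 D"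
proof -
  interpret comm_group "K0 D" by (rule comm_group_K0) (rule assms)
  show ?thesis
    unfolding diagonal_subgroup_def
    by (intro subgroup_imp_normal generate_is_subgroup) (auto intro!: K0_class_in assms)
qed

lemma Ses_Obj_Bq: "Ses (Bq N) A i B p E \<Longrightarrow> A \<in> Obj (Bq N) \<and> B \<in> Obj (Bq N) \<and> E \<in> Obj (Bq N)"
  by (auto simp: Bq_def)

lemma Ses_Obj_Bq_on:
  "Ses (Bq_on J N) A i B p E \<Longrightarrow> A \<in> Obj (Bq_on J N) \<and> B \<in> Obj (Bq_on J N) \<and> E \<in> Obj (Bq_on J N)"
  unfolding Bq_on_def by (rule Ses_Obj_full_subcategory[OF Ses_Obj_Bq])

lemma group_hom_K0_incl: "group_hom (K0 (Bq_on J N)) (K0 (Bq N)) (K0_incl (Bq N))"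
proof (intro group_hom.intro group_hom_axioms.intro)
  show "group (K0 (Bq_on J N))"
    by (rule comm_group.axioms(2), rule comm_group_K0, rule Ses_Obj_Bq_on)
  show "group (K0 (Bq N))"
    by (rule comm_group.axioms(2), rule comm_group_K0, rule Ses_Obj_Bq)
  show "K0_incl (Bq N) \<in> hom (K0 (Bq_on J N)) (K0 (Bq N))"
    unfolding Bq_on_def by (rule K0_incl_hom) (rule Ses_Obj_Bq)
qed

lemma K0_incl_class_Bq: "X \<in> Obj (Bq_on J N) \<Longrightarrow>
    K0_incl (Bq N) (K0_class (Bq_on J N) X) = K0_class (Bq N) X"
  unfolding Bq_on_def by (rule K0_incl_class) (rule Ses_Obj_Bq)

lemma K0_incl_diagonal:
  "K0_incl (Bq N) ` diagonal_subgroup (Bq_on J N) \<subseteq> diagonal_subgroup (Bq N)"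
proof -
  interpret group_hom "K0 (Bq_on J N)" "K0 (Bq N)" "K0_incl (Bq N)"
    by (rule group_hom_K0_incl)
  let ?X = "K0_class (Bq_on J N) ` {X \<in> Obj (Bq_on J N). dtop X = dbot X}"
  have sub: "?X \<subseteq> carrier (K0 (Bq_on J N))"
    using K0_class_in[OF Ses_Obj_Bq_on] by auto
  have "K0_incl (Bq N) ` ?X \<subseteq> K0_class (Bq N) ` {X \<in> Obj (Bq N). dtop X = dbot X}"
  proof (intro image_subsetI, elim imageE, safe)
    fix X assume X: "X \<in> Obj (Bq_on J N)" "dtop X = dbot X"
    then have "X \<in> Obj (Bq N)" by (simp add: Bq_on_def full_subcategory_def)
    then show "K0_incl (Bq N) (K0_class (Bq_on J N) X)
        \<in> K0_class (Bq N) ` {X \<in> Obj (Bq N). dtop X = dbot X}"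
      using X(2) unfolding K0_incl_class_Bq[OF X(1)] by blast
  qed
  then show ?thesis
    unfolding diagonal_subgroup_def generate_img[OF sub, symmetric] by (rule H.mono_generate)
qed

lemma K0_Omega_incl_class:
  assumes "X \<in> Obj (Bq_on J N)"
  shows "K0_Omega_incl (Bq N) (K0_Omega_class (Bq_on J N) X) = K0_Omega_class (Bq N) X"
proof -
  have "K0_incl (Bq N) (K0_class (Bq_on J N) X) = K0_class (Bq N) X"
    using assms by (rule K0_incl_class_Bq)
  then show ?thesis
    unfolding K0_Omega_incl_def K0_Omega_class_def
    using coset_map_coset[OF group_hom_K0_incl diagonal_subgroup_normal[OF Ses_Obj_Bq_on]
        diagonal_subgroup_normal[OF Ses_Obj_Bq] K0_incl_diagonal K0_class_in[OF Ses_Obj_Bq_on assms]]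
    by simp
qed

lemma K0_Omega_incl_hom: "K0_Omega_incl (Bq N) \<in> hom (K0_Omega (Bq_on J N)) (K0_Omega (Bq N))"
  unfolding K0_Omega_incl_def[abs_def] K0_Omega_def
  by (intro coset_map_hom group_hom_K0_incl diagonal_subgroup_normal Ses_Obj_Bq Ses_Obj_Bq_on
      K0_incl_diagonal)

end

theory Submission
  imports Defs
begin

text \<open>
  Call a binary acyclic complex \<^emph>\<open>short\<close> if its class lies in the image of the map.  The cone of a
  pair of graded isomorphisms (one for the top, one for the bottom differentials) is filtered by its
  brutal truncations, whose quotients live in two adjacent degrees.  It follows that shifting
  preserves shortness, and that shortness only depends on the isomorphism classes of the top and of
  the bottom complex.  So it is a relation between single acyclic complexes A and B with degreewise
  isomorphic graded objects, compatible with direct sums (and cancellation) and with extensions.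

  Let now P have length n + 1, with J the image of the top differential in degree 1, and K that of
  the bottom one.  The top complex splits into the upper part U, ending with J in degree 1, and the
  short exact sequence a from J over P 1 to P 0; the bottom complex splits likewise into V and b.
  If G is the pullback of the two maps from P 1 to P 0, then there are short exact sequences \<gamma> from J
  over G to P 1 and \<delta> from K over G to P 1.  Placed in degrees 3, 2, 1, they repair the mismatch
  between J and K: up to contractible summands, U + \<delta> and V + \<gamma> have the same graded object,
  starting in degree 1, and so have a + \<gamma> and b + \<delta>, of length 3.
\<close>

section \<open>Direct sums in additive categories\<close>

text \<open>Top and bottom share the object P but not the images J and K, so cutting both at degree
  1 leaves complexes with different graded objects, about which the relation says nothing. Adding a
  contractible complex X = X in adjacent degrees to one side trades a missing X in one degree for a
  surplus X in the next. Hence a surplus of J over K in degree 1 can only be balanced by a surplus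
  of K over J in a degree of the same parity. The sequences over G serve this purpose: their middle
  and last terms agree, so they differ only in their kernels, which sit in degree 3. This explains
  the crossed pairing: \<delta>, with kernel K, goes with U, while \<gamma>, with kernel J, goes
  with a, whose J sits in degree 2.

  Invariance under shifts comes from the cone on the identity, whose pieces have equal
  differentials. Unrelated isomorphisms of top and bottom are treated afterwards, as their cone has
  pieces that are short only up to a shift.

  The relation is never composed. The two truncations and the two comparisons are added, one of them
  reversed, and what both sides have in common is cancelled.\<close>

text \<open>
  Direct sums of objects and of complexes are commutative and associative only up to isomorphism.
  Choosing representatives makes them so on the nose, and simplification can permute summands.
\<close>

locale weak_comm_semigroup =
  fixes S :: "'a set" and R :: "'a \<Rightarrow> 'a \<Rightarrow> bool" and opn :: "'a \<Rightarrow> 'a \<Rightarrow> 'a"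
  assumes R_in: "R x y \<Longrightarrow> x \<in> S \<and> y \<in> S"
    and R_refl: "x \<in> S \<Longrightarrow> R x x"
    and R_sym: "R x y \<Longrightarrow> R y x"
    and R_trans: "R x y \<Longrightarrow> R y z \<Longrightarrow> R x z"
    and R_cong: "R x x' \<Longrightarrow> R y y' \<Longrightarrow> R (opn x y) (opn x' y')"
    and R_comm: "x \<in> S \<Longrightarrow> y \<in> S \<Longrightarrow> R (opn x y) (opn y x)"
    and R_assoc: "x \<in> S \<Longrightarrow> y \<in> S \<Longrightarrow> z \<in> S \<Longrightarrow> R (opn (opn x y) z) (opn x (opn y z))"
begin

definition nf :: "'a \<Rightarrow> 'a" where "nf x = (SOME y. R x y)"

definition add :: "'a \<Rightarrow> 'a \<Rightarrow> 'a" where "add x y = nf (opn x y)"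

text \<open>\<open>R\<close> is an equivalence on \<open>S\<close>, so related elements have the
  same predicate \<open>R x\<close>, and \<open>SOME\<close> returns the same element for
  both.\<close>

lemma nf_eqI: "R x y \<Longrightarrow> nf x = nf y"
proof -
  assume "R x y"
  then have "R x = R y" using R_sym R_trans by blast
  then show ?thesis by (simp add: nf_def)
qed

lemma R_nf: "x \<in> S \<Longrightarrow> R x (nf x)"
  unfolding nf_def by (rule someI[of "R x" x]) (rule R_refl)

lemma nf_in: "x \<in> S \<Longrightarrow> nf x \<in> S"
  using R_nf R_in by blast

lemma opn_in: "x \<in> S \<Longrightarrow> y \<in> S \<Longrightarrow> opn x y \<in> S"
  using R_comm R_in by blast

lemma add_in [simp]: "x \<in> S \<Longrightarrow> y \<in> S \<Longrightarrow> add x y \<in> S"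
  by (simp add: add_def nf_in opn_in)

lemma nf_opn: "x \<in> S \<Longrightarrow> y \<in> S \<Longrightarrow> nf (opn x y) = add (nf x) (nf y)"
  unfolding add_def by (intro nf_eqI R_cong R_nf)

lemma R_add: "x \<in> S \<Longrightarrow> y \<in> S \<Longrightarrow> R (opn x y) (add x y)"
  by (simp add: add_def R_nf opn_in)

lemma add_commute: "x \<in> S \<Longrightarrow> y \<in> S \<Longrightarrow> add x y = add y x"
  unfolding add_def by (intro nf_eqI R_comm)

lemma add_assoc:
  assumes "x \<in> S" "y \<in> S" "z \<in> S"
  shows "add (add x y) z = add x (add y z)"
proof -
  have "add (add x y) z = nf (opn (opn x y) z)"
    unfolding add_def using assms by (intro nf_eqI R_cong R_sym[OF R_nf] R_refl opn_in)
  also have "\<dots> = nf (opn x (opn y z))"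
    using assms by (intro nf_eqI R_assoc)
  also have "\<dots> = add x (add y z)"
    unfolding add_def using assms by (intro nf_eqI R_cong R_nf R_refl opn_in)
  finally show ?thesis .
qed

lemma add_left_commute:
  assumes "x \<in> S" "y \<in> S" "z \<in> S"
  shows "add x (add y z) = add y (add x z)"
  using assms by (metis add_assoc add_commute)

lemmas add_ac = add_assoc add_commute add_left_commute

end

section \<open>Inverses and isomorphisms\<close>

context category
begin

text \<open>\<open>Hom\<close> does not record that its ends are objects. With the memberships
  bundled in, the side conditions of the rules follow from the typing of the morphisms.\<close>

definition mor :: "'o \<Rightarrow> 'o \<Rightarrow> 'm set" where
  "mor A B = {f. A \<in> Obj C \<and> B \<in> Obj C \<and> f \<in> Hom C A B}"

lemma morD: "f \<in> mor A B \<Longrightarrow> f \<in> Hom C A B" "f \<in> mor A B \<Longrightarrow> A \<in> Obj C"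
    "f \<in> mor A B \<Longrightarrow> B \<in> Obj C"
  by (simp_all add: mor_def)

lemma id_mor [simp, intro]: "A \<in> Obj C \<Longrightarrow> Ident C A \<in> mor A A"
  by (simp add: mor_def Ident_in)

lemma comp_mor [intro]: "g \<in> mor B D \<Longrightarrow> f \<in> mor A B \<Longrightarrow> g \<star> f \<in> mor A D"
  by (auto simp: mor_def intro: Comp_in)

lemma id_left [simp]: "f \<in> mor A B \<Longrightarrow> Ident C B \<star> f = f"
  and id_right [simp]: "f \<in> mor A B \<Longrightarrow> f \<star> Ident C A = f"
  by (auto simp: mor_def Ident_left Ident_right)

lemma assoc: "h \<in> mor D E \<Longrightarrow> g \<in> mor B D \<Longrightarrow> f \<in> mor A B \<Longrightarrow> (h \<star> g) \<star> f = h \<star> (g \<star> f)"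
  by (auto simp: mor_def Comp_assoc)

text \<open>Naming the inverse, which \<open>isomorphism\<close> hides behind a quantifier, lets
  families of isomorphisms be composed and transported degreewise.\<close>

definition inverses :: "'o \<Rightarrow> 'm \<Rightarrow> 'o \<Rightarrow> 'm \<Rightarrow> bool" where
  "inverses A f B g \<longleftrightarrow> f \<in> mor A B \<and> g \<in> mor B A \<and> g \<star> f = Ident C A \<and> f \<star> g = Ident C B"

lemma inverses_sym: "inverses A f B g \<Longrightarrow> inverses B g A f"
  by (auto simp: inverses_def)

lemma isomorphismI: "inverses A f B g \<Longrightarrow> isomorphism C A f B"
  by (auto simp: inverses_def isomorphism_def mor_def)

lemma inverses_id: "A \<in> Obj C \<Longrightarrow> inverses A (Ident C A) A (Ident C A)"
  using id_left[OF id_mor] by (auto simp: inverses_def)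

lemma cancel_inv_left: "inverses A f B g \<Longrightarrow> x \<in> mor T A \<Longrightarrow> g \<star> (f \<star> x) = x"
  unfolding inverses_def using assoc[of g B A f A x T] by simp

lemma cancel_inv_right: "inverses A f B g \<Longrightarrow> x \<in> mor B T \<Longrightarrow> (x \<star> f) \<star> g = x"
  unfolding inverses_def using assoc[of x B T f A g B] by simp

lemma inverses_comp:
  assumes "inverses A f B g" "inverses B h D k"
  shows "inverses A (h \<star> f) D (g \<star> k)"
proof -
  have m: "f \<in> mor A B" "g \<in> mor B A" "h \<in> mor B D" "k \<in> mor D B"
    using assms by (auto simp: inverses_def)
  have "(g \<star> k) \<star> (h \<star> f) = g \<star> (k \<star> (h \<star> f))"
    using m by (intro assoc) auto
  also have "\<dots> = Ident C A"
    using cancel_inv_left[OF assms(2) m(1)] assms(1) by (simp add: inverses_def)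
  finally have 1: "(g \<star> k) \<star> (h \<star> f) = Ident C A" .
  have "(h \<star> f) \<star> (g \<star> k) = h \<star> (f \<star> (g \<star> k))"
    using m by (intro assoc) auto
  also have "\<dots> = Ident C D"
    using cancel_inv_left[OF inverses_sym[OF assms(1)] m(4)] assms(2) by (simp add: inverses_def)
  finally show ?thesis using 1 m by (auto simp: inverses_def)
qed

definition iso :: "'o \<Rightarrow> 'o \<Rightarrow> bool" where
  "iso A B \<longleftrightarrow> (\<exists>f g. inverses A f B g)"

lemma iso_refl: "A \<in> Obj C \<Longrightarrow> iso A A"
  using inverses_id iso_def by blast

lemma iso_sym: "iso A B \<Longrightarrow> iso B A"
  using inverses_sym iso_def by blast

lemma iso_trans: "iso A B \<Longrightarrow> iso B D \<Longrightarrow> iso A D"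
  unfolding iso_def using inverses_comp by blast

lemma iso_Obj: "iso A B \<Longrightarrow> A \<in> Obj C \<and> B \<in> Obj C"
  by (auto simp: iso_def inverses_def mor_def)

end

section \<open>Hom groups and zero objects\<close>

context additive_category
begin

abbreviation plus (infixl "\<oplus>\<^sub>m" 65) where "f \<oplus>\<^sub>m g \<equiv> Plus C f g"

abbreviation zer :: "'a \<Rightarrow> 'a \<Rightarrow> 'b" where "zer A B \<equiv> Zero C A B"

definition neg :: "'a \<Rightarrow> 'a \<Rightarrow> 'b \<Rightarrow> 'b" where "neg A B f = inv\<^bsub>hom_group C A B\<^esub> f"

lemma zer_mor [simp, intro]: "A \<in> Obj C \<Longrightarrow> B \<in> Obj C \<Longrightarrow> zer A B \<in> mor A B"
proof -
  assume a: "A \<in> Obj C" "B \<in> Obj C"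
  interpret comm_group "hom_group C A B" by (rule hom_comm_group[OF a])
  show ?thesis using one_closed a by (simp add: hom_group_def mor_def)
qed

lemma plus_mor [simp, intro]: "f \<in> mor A B \<Longrightarrow> g \<in> mor A B \<Longrightarrow> f \<oplus>\<^sub>m g \<in> mor A B"
proof -
  assume a: "f \<in> mor A B" "g \<in> mor A B"
  interpret comm_group "hom_group C A B" by (rule hom_comm_group[OF morD(2,3)[OF a(1)]])
  show ?thesis using m_closed[of f g] a by (simp add: hom_group_def mor_def)
qed

lemma neg_mor [simp, intro]: "f \<in> mor A B \<Longrightarrow> neg A B f \<in> mor A B"
proof -
  assume a: "f \<in> mor A B"
  interpret comm_group "hom_group C A B" by (rule hom_comm_group[OF morD(2,3)[OF a(1)]])
  show ?thesis using inv_closed[of f] a by (simp add: hom_group_def mor_def neg_def)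
qed

lemma plus_zer [simp]: "f \<in> mor A B \<Longrightarrow> f \<oplus>\<^sub>m zer A B = f"
  and zer_plus [simp]: "f \<in> mor A B \<Longrightarrow> zer A B \<oplus>\<^sub>m f = f"
  and plus_neg: "f \<in> mor A B \<Longrightarrow> f \<oplus>\<^sub>m neg A B f = zer A B"
  and neg_plus: "f \<in> mor A B \<Longrightarrow> neg A B f \<oplus>\<^sub>m f = zer A B"
proof -
  assume a: "f \<in> mor A B"
  interpret comm_group "hom_group C A B" by (rule hom_comm_group[OF morD(2,3)[OF a(1)]])
  show "f \<oplus>\<^sub>m zer A B = f" using r_one[of f] a by (simp add: hom_group_def mor_def)
  show "zer A B \<oplus>\<^sub>m f = f" using l_one[of f] a by (simp add: hom_group_def mor_def)
  show "f \<oplus>\<^sub>m neg A B f = zer A B" using r_inv[of f] a by (simp add: hom_group_def mor_def neg_def)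
  show "neg A B f \<oplus>\<^sub>m f = zer A B" using l_inv[of f] a by (simp add: hom_group_def mor_def neg_def)
qed

lemma plus_assoc: "f \<in> mor A B \<Longrightarrow> g \<in> mor A B \<Longrightarrow> h \<in> mor A B \<Longrightarrow> (f \<oplus>\<^sub>m g) \<oplus>\<^sub>m h = f \<oplus>\<^sub>m (g \<oplus>\<^sub>m h)"
proof -
  assume a: "f \<in> mor A B" "g \<in> mor A B" "h \<in> mor A B"
  interpret comm_group "hom_group C A B" by (rule hom_comm_group[OF morD(2,3)[OF a(1)]])
  show ?thesis using m_assoc[of f g h] a by (simp add: hom_group_def mor_def)
qed

lemma plus_eq_zer:
  assumes "f \<in> mor A B" "g \<in> mor A B" "f \<oplus>\<^sub>m g = zer A B"
  shows "g = neg A B f"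
proof -
  have "g = (neg A B f \<oplus>\<^sub>m f) \<oplus>\<^sub>m g"
    using assms by (simp add: neg_plus)
  also have "\<dots> = neg A B f \<oplus>\<^sub>m zer A B"
    using assms plus_assoc[of "neg A B f" A B f g] by auto
  finally show ?thesis using assms by auto
qed

lemma plus_eq_self: "f \<in> mor A B \<Longrightarrow> f \<oplus>\<^sub>m f = f \<Longrightarrow> f = zer A B"
  using plus_assoc[of f A B f "neg A B f"] by (auto simp: plus_neg)

lemma distl: "h \<in> mor B D \<Longrightarrow> f \<in> mor A B \<Longrightarrow> g \<in> mor A B \<Longrightarrow> h \<star> (f \<oplus>\<^sub>m g) = h \<star> f \<oplus>\<^sub>m h \<star> g"
  and distr: "f' \<in> mor B D \<Longrightarrow> g' \<in> mor B D \<Longrightarrow> k \<in> mor A B \<Longrightarrow> (f' \<oplus>\<^sub>m g') \<star> k = f' \<star> k \<oplus>\<^sub>m g' \<star> k"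
  by (auto simp: mor_def Comp_Plus_right Comp_Plus_left)

lemma comp_zer [simp]:
  assumes "A \<in> Obj C" "g \<in> mor B D"
  shows "g \<star> zer A B = zer A D"
proof (rule plus_eq_self)
  have B: "B \<in> Obj C" using assms(2) by (rule morD)
  show "g \<star> zer A B \<in> mor A D" using comp_mor[OF assms(2) zer_mor[OF assms(1) B]] .
  show "g \<star> zer A B \<oplus>\<^sub>m g \<star> zer A B = g \<star> zer A B"
    using distl[OF assms(2) zer_mor[OF assms(1) B] zer_mor[OF assms(1) B]] assms B
    by simp
qed

lemma zer_comp [simp]:
  assumes "D \<in> Obj C" "f \<in> mor A B"
  shows "zer B D \<star> f = zer A D"
proof (rule plus_eq_self)
  have B: "B \<in> Obj C" using assms(2) by (rule morD)
  show "zer B D \<star> f \<in> mor A D" using comp_mor[OF zer_mor[OF B assms(1)] assms(2)] .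
  show "zer B D \<star> f \<oplus>\<^sub>m zer B D \<star> f = zer B D \<star> f"
    using distr[OF zer_mor[OF B assms(1)] zer_mor[OF B assms(1)] assms(2)] assms B
    by simp
qed

lemma zer_zer [simp]: "A \<in> Obj C \<Longrightarrow> B \<in> Obj C \<Longrightarrow> D \<in> Obj C \<Longrightarrow> zer B D \<star> zer A B = zer A D"
  by (rule comp_zer) auto

lemma id_zer [simp]: "A \<in> Obj C \<Longrightarrow> B \<in> Obj C \<Longrightarrow> Ident C B \<star> zer A B = zer A B"
  and zer_id [simp]: "A \<in> Obj C \<Longrightarrow> B \<in> Obj C \<Longrightarrow> zer A B \<star> Ident C A = zer A B"
  and id_id [simp]: "A \<in> Obj C \<Longrightarrow> Ident C A \<star> Ident C A = Ident C A"
  by (auto intro: id_left id_right)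

lemma zer_plus_zer [simp]: "A \<in> Obj C \<Longrightarrow> B \<in> Obj C \<Longrightarrow> zer A B \<oplus>\<^sub>m zer A B = zer A B"
  by simp

lemma neg_comp_left:
  assumes "g \<in> mor B D" "f \<in> mor A B"
  shows "neg B D g \<star> f = neg A D (g \<star> f)"
proof (rule plus_eq_zer)
  show "g \<star> f \<oplus>\<^sub>m neg B D g \<star> f = zer A D"
    using assms distr[of g B D "neg B D g" f A] morD[OF assms(1)] by (auto simp: plus_neg)
qed (use assms in auto)

lemma neg_comp_right:
  assumes "g \<in> mor B D" "f \<in> mor A B"
  shows "g \<star> neg A B f = neg A D (g \<star> f)"
proof (rule plus_eq_zer)
  show "g \<star> f \<oplus>\<^sub>m g \<star> neg A B f = zer A D"
    using assms distl[of g B D f A "neg A B f"] morD[OF assms(2)] by (auto simp: plus_neg)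
qed (use assms in auto)

lemma neg_neg: "f \<in> mor A B \<Longrightarrow> neg A B (neg A B f) = f"
  using plus_eq_zer[OF neg_mor _ neg_plus] by simp

text \<open>Every morphism into or out of \<open>Z\<close> factors through \<open>Ident C Z\<close>,
  so it vanishes once the identity does.\<close>

lemma zero_object_iff: "zero_object C Z \<longleftrightarrow> Z \<in> Obj C \<and> Ident C Z = zer Z Z"
proof
  assume z: "zero_object C Z"
  then have Z: "Z \<in> Obj C" by (simp add: zero_object_def)
  then have "\<exists>!f. f \<in> Hom C Z Z" using z by (auto simp: zero_object_def)
  moreover have "Ident C Z \<in> Hom C Z Z" "zer Z Z \<in> Hom C Z Z"
    using Z by (auto intro: morD(1)[OF id_mor] morD(1)[OF zer_mor])
  ultimately show "Z \<in> Obj C \<and> Ident C Z = zer Z Z" using Z by blast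
next
  assume z: "Z \<in> Obj C \<and> Ident C Z = zer Z Z"
  then have Z: "Z \<in> Obj C" and I: "Ident C Z = zer Z Z" by auto
  show "zero_object C Z"
    unfolding zero_object_def
  proof (intro conjI ballI Z ex1I)
    fix A assume A: "A \<in> Obj C"
    show "zer A Z \<in> Hom C A Z" "zer Z A \<in> Hom C Z A"
      using A Z by (auto intro: morD(1)[OF zer_mor])
    show "f = zer A Z" if "f \<in> Hom C A Z" for f
      using that A Z I id_left[of f A Z] zer_comp[of Z f A Z] by (simp add: mor_def)
    show "f = zer Z A" if "f \<in> Hom C Z A" for f
      using that A Z I id_right[of f Z A] comp_zer[of Z f Z A] by (simp add: mor_def)
  qed
qed

lemma zero_objectD:
  assumes "zero_object C Z"
  shows "Z \<in> Obj C" "f \<in> mor A Z \<Longrightarrow> f = zer A Z" "f \<in> mor Z A \<Longrightarrow> f = zer Z A"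
proof -
  show Z: "Z \<in> Obj C" using assms by (simp add: zero_object_def)
  have I: "Ident C Z = zer Z Z" using assms by (simp add: zero_object_iff)
  show "f \<in> mor A Z \<Longrightarrow> f = zer A Z" using id_left[of f A Z] zer_comp[of Z f A Z] I Z by simp
  show "f \<in> mor Z A \<Longrightarrow> f = zer Z A" using id_right[of f Z A] comp_zer[of Z f Z A] I Z by simp
qed

lemma zero_object_inverses:
  assumes "zero_object C Z" "zero_object C Z'"
  shows "inverses Z (zer Z Z') Z' (zer Z' Z)"
proof -
  have "Z \<in> Obj C" "Z' \<in> Obj C" "Ident C Z = zer Z Z" "Ident C Z' = zer Z' Z'"
    using assms by (auto simp: zero_object_iff)
  then show ?thesis by (simp add: inverses_def comp_zer[OF _ zer_mor])
qed

lemma zero_object_inverses':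
  assumes "zero_object C Z" "inverses A f Z g"
  shows "zero_object C A"
proof -
  have m: "f \<in> mor A Z" "g \<in> mor Z A" "g \<star> f = Ident C A" using assms by (auto simp: inverses_def)
  have "g = zer Z A" using zero_objectD(3)[OF assms(1) m(2)] .
  then have "Ident C A = zer A A" using m zer_comp[OF morD(2)[OF m(1)] m(1)] by simp
  then show ?thesis using morD(2)[OF m(1)] by (simp add: zero_object_iff)
qed

lemma zero_object_iso: "zero_object C Z \<Longrightarrow> iso A Z \<Longrightarrow> zero_object C A"
  unfolding iso_def using zero_object_inverses' by blast

text \<open>A fixed zero object, used as filling wherever a complex is cut off.\<close>

definition Zob :: 'a where "Zob = (SOME Z. zero_object C Z)"

lemma Zob: "zero_object C Zob"
  unfolding Zob_def using ex_zero_object by (rule someI_ex)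

lemma Zob_Obj [simp]: "Zob \<in> Obj C"
  using Zob by (simp add: zero_object_iff)

lemma Ident_Zob: "Ident C Zob = zer Zob Zob"
  using Zob by (simp add: zero_object_iff)

lemma into_Zob: "f \<in> mor A Zob \<Longrightarrow> f = zer A Zob"
  using zero_objectD[OF Zob] by auto


section \<open>Biproducts and matrices\<close>

definition bip :: "'a \<Rightarrow> 'a \<Rightarrow> 'a \<times> 'b \<times> 'b \<times> 'b \<times> 'b" where
  "bip A B = (SOME (S, i, j, p, q). biproduct C A B S i j p q)"

definition prd :: "'a \<Rightarrow> 'a \<Rightarrow> 'a" (infixr "\<boxplus>" 65) where "A \<boxplus> B = fst (bip A B)"
definition inl :: "'a \<Rightarrow> 'a \<Rightarrow> 'b" where "inl A B = fst (snd (bip A B))"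
definition inr :: "'a \<Rightarrow> 'a \<Rightarrow> 'b" where "inr A B = fst (snd (snd (bip A B)))"
definition pr1 :: "'a \<Rightarrow> 'a \<Rightarrow> 'b" where "pr1 A B = fst (snd (snd (snd (bip A B))))"
definition pr2 :: "'a \<Rightarrow> 'a \<Rightarrow> 'b" where "pr2 A B = snd (snd (snd (snd (bip A B))))"

text \<open>A single choice in \<open>bip\<close> delivers all five data, so the injections and
  projections belong to the same biproduct.\<close>

lemma biproduct_prd:
  assumes "A \<in> Obj C" "B \<in> Obj C"
  shows "biproduct C A B (A \<boxplus> B) (inl A B) (inr A B) (pr1 A B) (pr2 A B)"
proof -
  obtain S i j p q where "biproduct C A B S i j p q" using ex_biproduct[OF assms] by blast
  then have "(\<lambda>(S, i, j, p, q). biproduct C A B S i j p q) (S, i, j, p, q)" by simp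
  then have "(\<lambda>(S, i, j, p, q). biproduct C A B S i j p q) (bip A B)"
    unfolding bip_def by (rule someI)
  then show ?thesis
    by (simp add: prd_def inl_def inr_def pr1_def pr2_def case_prod_unfold)
qed

context
  fixes A B assumes A: "A \<in> Obj C" and B: "B \<in> Obj C"
begin

lemma prd_Obj [simp]: "A \<boxplus> B \<in> Obj C"
  and inl_mor [simp, intro]: "inl A B \<in> mor A (A \<boxplus> B)"
  and inr_mor [simp, intro]: "inr A B \<in> mor B (A \<boxplus> B)"
  and pr1_mor [simp, intro]: "pr1 A B \<in> mor (A \<boxplus> B) A"
  and pr2_mor [simp, intro]: "pr2 A B \<in> mor (A \<boxplus> B) B"
  and pr1_inl [simp]: "pr1 A B \<star> inl A B = Ident C A"
  and pr2_inr [simp]: "pr2 A B \<star> inr A B = Ident C B"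
  and pr1_inr [simp]: "pr1 A B \<star> inr A B = zer B A"
  and pr2_inl [simp]: "pr2 A B \<star> inl A B = zer A B"
  and inl_pr1_inr_pr2: "inl A B \<star> pr1 A B \<oplus>\<^sub>m inr A B \<star> pr2 A B = Ident C (A \<boxplus> B)"
  using biproduct_prd[OF A B] A B by (auto simp: biproduct_def mor_def)

lemma ext_into:
  assumes x: "x \<in> mor T (A \<boxplus> B)" and y: "y \<in> mor T (A \<boxplus> B)"
    and "pr1 A B \<star> x = pr1 A B \<star> y" "pr2 A B \<star> x = pr2 A B \<star> y"
  shows "x = y"
proof -
  have *: "z = inl A B \<star> (pr1 A B \<star> z) \<oplus>\<^sub>m inr A B \<star> (pr2 A B \<star> z)" if z: "z \<in> mor T (A \<boxplus> B)" for z
  proof -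
    have "z = (inl A B \<star> pr1 A B \<oplus>\<^sub>m inr A B \<star> pr2 A B) \<star> z"
      unfolding inl_pr1_inr_pr2 using z by simp
    also have "\<dots> = inl A B \<star> pr1 A B \<star> z \<oplus>\<^sub>m inr A B \<star> pr2 A B \<star> z"
      by (rule distr[OF comp_mor[OF inl_mor pr1_mor] comp_mor[OF inr_mor pr2_mor] z])
    finally show ?thesis
      using assoc[OF inl_mor pr1_mor z] assoc[OF inr_mor pr2_mor z] by simp
  qed
  show ?thesis using *[OF x] *[OF y] assms(3,4) by simp
qed

lemma ext_out:
  assumes x: "x \<in> mor (A \<boxplus> B) T" and y: "y \<in> mor (A \<boxplus> B) T"
    and "x \<star> inl A B = y \<star> inl A B" "x \<star> inr A B = y \<star> inr A B"
  shows "x = y"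
proof -
  have *: "z = (z \<star> inl A B) \<star> pr1 A B \<oplus>\<^sub>m (z \<star> inr A B) \<star> pr2 A B" if z: "z \<in> mor (A \<boxplus> B) T" for z
  proof -
    have "z = z \<star> (inl A B \<star> pr1 A B \<oplus>\<^sub>m inr A B \<star> pr2 A B)"
      unfolding inl_pr1_inr_pr2 using z by simp
    also have "\<dots> = z \<star> (inl A B \<star> pr1 A B) \<oplus>\<^sub>m z \<star> (inr A B \<star> pr2 A B)"
      by (rule distl[OF z comp_mor[OF inl_mor pr1_mor] comp_mor[OF inr_mor pr2_mor]])
    finally show ?thesis
      using assoc[OF z inl_mor pr1_mor] assoc[OF z inr_mor pr2_mor] by simp
  qed
  show ?thesis using *[OF x] *[OF y] assms(3,4) by simp
qed

end

definition col :: "'a \<Rightarrow> 'a \<Rightarrow> 'b \<Rightarrow> 'b \<Rightarrow> 'b" where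
  "col A B f g = inl A B \<star> f \<oplus>\<^sub>m inr A B \<star> g"

definition row :: "'a \<Rightarrow> 'a \<Rightarrow> 'b \<Rightarrow> 'b \<Rightarrow> 'b" where
  "row A B f g = f \<star> pr1 A B \<oplus>\<^sub>m g \<star> pr2 A B"

context
  fixes T A B f g assumes f: "f \<in> mor T A" and g: "g \<in> mor T B"
begin

lemma col_mor [simp, intro]: "col A B f g \<in> mor T (A \<boxplus> B)"
  unfolding col_def using f g morD(3)[OF f] morD(3)[OF g]
  by (intro plus_mor comp_mor[OF _ f] comp_mor[OF _ g]) auto

lemma pr1_col [simp]: "pr1 A B \<star> col A B f g = f"
  and pr2_col [simp]: "pr2 A B \<star> col A B f g = g"
proof -
  have o: "A \<in> Obj C" "B \<in> Obj C" "T \<in> Obj C" using f g by (simp_all add: mor_def)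
  note i = inl_mor[OF o(1,2)] inr_mor[OF o(1,2)] pr1_mor[OF o(1,2)] pr2_mor[OF o(1,2)]
  have "pr1 A B \<star> col A B f g = pr1 A B \<star> inl A B \<star> f \<oplus>\<^sub>m pr1 A B \<star> inr A B \<star> g"
    unfolding col_def
    by (simp only: distl[OF i(3) comp_mor[OF i(1) f] comp_mor[OF i(2) g]]
        assoc[OF i(3) i(1) f] assoc[OF i(3) i(2) g])
  then show "pr1 A B \<star> col A B f g = f" using o f g by simp
  have "pr2 A B \<star> col A B f g = pr2 A B \<star> inl A B \<star> f \<oplus>\<^sub>m pr2 A B \<star> inr A B \<star> g"
    unfolding col_def
    by (simp only: distl[OF i(4) comp_mor[OF i(1) f] comp_mor[OF i(2) g]]
        assoc[OF i(4) i(1) f] assoc[OF i(4) i(2) g])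
  then show "pr2 A B \<star> col A B f g = g" using o f g by simp
qed

lemma col_comp:
  assumes x: "x \<in> mor S T" shows "col A B f g \<star> x = col A B (f \<star> x) (g \<star> x)"
proof -
  have o: "A \<in> Obj C" "B \<in> Obj C" using f g by (simp_all add: mor_def)
  note i = inl_mor[OF o(1,2)] inr_mor[OF o(1,2)]
  show ?thesis
    unfolding col_def
    by (simp only: distr[OF comp_mor[OF i(1) f] comp_mor[OF i(2) g] x]
        assoc[OF i(1) f x] assoc[OF i(2) g x])
qed

end

context
  fixes T A B f g assumes f: "f \<in> mor A T" and g: "g \<in> mor B T"
begin

lemma row_mor [simp, intro]: "row A B f g \<in> mor (A \<boxplus> B) T"
  unfolding row_def using f g morD(2)[OF f] morD(2)[OF g]
  by (intro plus_mor comp_mor[OF f] comp_mor[OF g]) auto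

lemma row_inl [simp]: "row A B f g \<star> inl A B = f"
  and row_inr [simp]: "row A B f g \<star> inr A B = g"
proof -
  have o: "A \<in> Obj C" "B \<in> Obj C" "T \<in> Obj C" using f g by (simp_all add: mor_def)
  note i = inl_mor[OF o(1,2)] inr_mor[OF o(1,2)] pr1_mor[OF o(1,2)] pr2_mor[OF o(1,2)]
  have "row A B f g \<star> inl A B = f \<star> (pr1 A B \<star> inl A B) \<oplus>\<^sub>m g \<star> (pr2 A B \<star> inl A B)"
    unfolding row_def
    by (simp only: distr[OF comp_mor[OF f i(3)] comp_mor[OF g i(4)] i(1)]
        assoc[OF f i(3) i(1)] assoc[OF g i(4) i(1)])
  then show "row A B f g \<star> inl A B = f" using o f g by simp
  have "row A B f g \<star> inr A B = f \<star> (pr1 A B \<star> inr A B) \<oplus>\<^sub>m g \<star> (pr2 A B \<star> inr A B)"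
    unfolding row_def
    by (simp only: distr[OF comp_mor[OF f i(3)] comp_mor[OF g i(4)] i(2)]
        assoc[OF f i(3) i(2)] assoc[OF g i(4) i(2)])
  then show "row A B f g \<star> inr A B = g" using o f g by simp
qed

lemma comp_row:
  assumes x: "x \<in> mor T S" shows "x \<star> row A B f g = row A B (x \<star> f) (x \<star> g)"
proof -
  have o: "A \<in> Obj C" "B \<in> Obj C" using f g by (simp_all add: mor_def)
  note i = pr1_mor[OF o(1,2)] pr2_mor[OF o(1,2)]
  show ?thesis
    unfolding row_def
    by (simp only: distl[OF x comp_mor[OF f i(1)] comp_mor[OF g i(2)]]
        assoc[OF x f i(1)] assoc[OF x g i(2)])
qed

lemma row_col:
  assumes x: "x \<in> mor S A" and y: "y \<in> mor S B"
  shows "row A B f g \<star> col A B x y = f \<star> x \<oplus>\<^sub>m g \<star> y"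
proof -
  have o: "A \<in> Obj C" "B \<in> Obj C" using f g by (simp_all add: mor_def)
  note i = pr1_mor[OF o(1,2)] pr2_mor[OF o(1,2)]
  have "row A B f g \<star> col A B x y = f \<star> (pr1 A B \<star> col A B x y) \<oplus>\<^sub>m g \<star> (pr2 A B \<star> col A B x y)"
    unfolding row_def
    by (simp only: distr[OF comp_mor[OF f i(1)] comp_mor[OF g i(2)] col_mor[OF x y]]
        assoc[OF f i(1) col_mor[OF x y]] assoc[OF g i(2) col_mor[OF x y]])
  then show ?thesis using x y by simp
qed

end

lemma col_pr:
  assumes "x \<in> mor T (A \<boxplus> B)" "A \<in> Obj C" "B \<in> Obj C"
  shows "col A B (pr1 A B \<star> x) (pr2 A B \<star> x) = x"
proof -
  note m = comp_mor[OF pr1_mor[OF assms(2,3)] assms(1)] comp_mor[OF pr2_mor[OF assms(2,3)] assms(1)]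
  show ?thesis
    by (rule ext_into[OF assms(2,3)]) (use m assms in simp_all)
qed

lemma row_in:
  assumes "x \<in> mor (A \<boxplus> B) T" "A \<in> Obj C" "B \<in> Obj C"
  shows "row A B (x \<star> inl A B) (x \<star> inr A B) = x"
proof -
  note m = comp_mor[OF assms(1) inl_mor[OF assms(2,3)]] comp_mor[OF assms(1) inr_mor[OF assms(2,3)]]
  show ?thesis
    by (rule ext_out[OF assms(2,3)]) (use m assms in simp_all)
qed

text \<open>Matrix with rows \<open>(f, g)\<close> and \<open>(h, k)\<close>: \<open>f\<close> and
  \<open>g\<close> land in \<open>A'\<close>, \<open>h\<close> and \<open>k\<close> in
  \<open>B'\<close>.\<close>

definition mat :: "'a \<Rightarrow> 'a \<Rightarrow> 'a \<Rightarrow> 'a \<Rightarrow> 'b \<Rightarrow> 'b \<Rightarrow> 'b \<Rightarrow> 'b \<Rightarrow> 'b" where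
  "mat A B A' B' f g h k = row A B (col A' B' f h) (col A' B' g k)"

context
  fixes A B A' B' f g h k
  assumes m: "f \<in> mor A A'" "g \<in> mor B A'" "h \<in> mor A B'" "k \<in> mor B B'"
begin

lemma mat_mor [simp, intro]: "mat A B A' B' f g h k \<in> mor (A \<boxplus> B) (A' \<boxplus> B')"
  unfolding mat_def using m by simp

lemma pr1_mat [simp]: "pr1 A' B' \<star> mat A B A' B' f g h k = row A B f g"
  and pr2_mat [simp]: "pr2 A' B' \<star> mat A B A' B' f g h k = row A B h k"
proof -
  have o: "A' \<in> Obj C" "B' \<in> Obj C" using m by (simp_all add: mor_def)
  show "pr1 A' B' \<star> mat A B A' B' f g h k = row A B f g"
    "pr2 A' B' \<star> mat A B A' B' f g h k = row A B h k"
    unfolding mat_def using m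
      comp_row[OF col_mor[OF m(1,3)] col_mor[OF m(2,4)] pr1_mor[OF o]]
      comp_row[OF col_mor[OF m(1,3)] col_mor[OF m(2,4)] pr2_mor[OF o]] by simp_all
qed

lemma mat_inl [simp]: "mat A B A' B' f g h k \<star> inl A B = col A' B' f h"
  and mat_inr [simp]: "mat A B A' B' f g h k \<star> inr A B = col A' B' g k"
  unfolding mat_def
  by (rule row_inl[OF col_mor[OF m(1,3)] col_mor[OF m(2,4)]], rule row_inr[OF col_mor[OF m(1,3)] col_mor[OF m(2,4)]])

lemma mat_col:
  assumes x: "x \<in> mor S A" "y \<in> mor S B"
  shows "mat A B A' B' f g h k \<star> col A B x y = col A' B' (f \<star> x \<oplus>\<^sub>m g \<star> y) (h \<star> x \<oplus>\<^sub>m k \<star> y)"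
proof (rule ext_into[of A' B'])
  show o: "A' \<in> Obj C" "B' \<in> Obj C" using m by (simp_all add: mor_def)
  note c = col_mor[OF x] mat_mor
  show "mat A B A' B' f g h k \<star> col A B x y \<in> mor S (A' \<boxplus> B')"
    using comp_mor[OF mat_mor col_mor[OF x]] .
  have t: "f \<star> x \<oplus>\<^sub>m g \<star> y \<in> mor S A'" "h \<star> x \<oplus>\<^sub>m k \<star> y \<in> mor S B'"
    using comp_mor[OF m(1) x(1)] comp_mor[OF m(2) x(2)] comp_mor[OF m(3) x(1)] comp_mor[OF m(4) x(2)]
    by auto
  then show "col A' B' (f \<star> x \<oplus>\<^sub>m g \<star> y) (h \<star> x \<oplus>\<^sub>m k \<star> y) \<in> mor S (A' \<boxplus> B')" by simp
  show "pr1 A' B' \<star> (mat A B A' B' f g h k \<star> col A B x y) =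
      pr1 A' B' \<star> col A' B' (f \<star> x \<oplus>\<^sub>m g \<star> y) (h \<star> x \<oplus>\<^sub>m k \<star> y)"
    using t assoc[OF pr1_mor[OF o] mat_mor col_mor[OF x], symmetric] row_col[OF m(1,2) x] by simp
  show "pr2 A' B' \<star> (mat A B A' B' f g h k \<star> col A B x y) =
      pr2 A' B' \<star> col A' B' (f \<star> x \<oplus>\<^sub>m g \<star> y) (h \<star> x \<oplus>\<^sub>m k \<star> y)"
    using t assoc[OF pr2_mor[OF o] mat_mor col_mor[OF x], symmetric] row_col[OF m(3,4) x] by simp
qed

lemma row_mat:
  assumes x: "x \<in> mor A' S" "y \<in> mor B' S"
  shows "row A' B' x y \<star> mat A B A' B' f g h k = row A B (x \<star> f \<oplus>\<^sub>m y \<star> h) (x \<star> g \<oplus>\<^sub>m y \<star> k)"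
  unfolding mat_def
  using comp_row[OF col_mor[OF m(1,3)] col_mor[OF m(2,4)] row_mor[OF x]]
    row_col[OF x m(1,3)] row_col[OF x m(2,4)] by simp

lemma mat_mat:
  assumes x: "f' \<in> mor A' A''" "g' \<in> mor B' A''" "h' \<in> mor A' B''" "k' \<in> mor B' B''"
  shows "mat A' B' A'' B'' f' g' h' k' \<star> mat A B A' B' f g h k =
    mat A B A'' B'' (f' \<star> f \<oplus>\<^sub>m g' \<star> h) (f' \<star> g \<oplus>\<^sub>m g' \<star> k) (h' \<star> f \<oplus>\<^sub>m k' \<star> h) (h' \<star> g \<oplus>\<^sub>m k' \<star> k)"
proof (rule ext_into[of A'' B''])
  show o: "A'' \<in> Obj C" "B'' \<in> Obj C" using x by (simp_all add: mor_def)
  let ?M = "mat A B A' B' f g h k" and ?M' = "mat A' B' A'' B'' f' g' h' k'"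
  have M': "?M' \<in> mor (A' \<boxplus> B') (A'' \<boxplus> B'')" unfolding mat_def using x by simp
  show "?M' \<star> ?M \<in> mor (A \<boxplus> B) (A'' \<boxplus> B'')" using comp_mor[OF M' mat_mor] .
  let ?N = "mat A B A'' B'' (f' \<star> f \<oplus>\<^sub>m g' \<star> h) (f' \<star> g \<oplus>\<^sub>m g' \<star> k) (h' \<star> f \<oplus>\<^sub>m k' \<star> h) (h' \<star> g \<oplus>\<^sub>m k' \<star> k)"
  have e: "f' \<star> f \<oplus>\<^sub>m g' \<star> h \<in> mor A A''" "f' \<star> g \<oplus>\<^sub>m g' \<star> k \<in> mor B A''"
     "h' \<star> f \<oplus>\<^sub>m k' \<star> h \<in> mor A B''" "h' \<star> g \<oplus>\<^sub>m k' \<star> k \<in> mor B B''"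
    using m x by (auto intro!: plus_mor intro: comp_mor)
  then show "?N \<in> mor (A \<boxplus> B) (A'' \<boxplus> B'')" unfolding mat_def by simp
  have p: "pr1 A'' B'' \<star> ?M' = row A' B' f' g'" "pr2 A'' B'' \<star> ?M' = row A' B' h' k'"
    unfolding mat_def using x
      comp_row[OF col_mor[OF x(1,3)] col_mor[OF x(2,4)] pr1_mor[OF o]]
      comp_row[OF col_mor[OF x(1,3)] col_mor[OF x(2,4)] pr2_mor[OF o]] by simp_all
  have q: "pr1 A'' B'' \<star> ?N = row A B (f' \<star> f \<oplus>\<^sub>m g' \<star> h) (f' \<star> g \<oplus>\<^sub>m g' \<star> k)"
     "pr2 A'' B'' \<star> ?N = row A B (h' \<star> f \<oplus>\<^sub>m k' \<star> h) (h' \<star> g \<oplus>\<^sub>m k' \<star> k)"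
    unfolding mat_def using e
      comp_row[OF col_mor[OF e(1,3)] col_mor[OF e(2,4)] pr1_mor[OF o]]
      comp_row[OF col_mor[OF e(1,3)] col_mor[OF e(2,4)] pr2_mor[OF o]] by simp_all
  show "pr1 A'' B'' \<star> (?M' \<star> ?M) = pr1 A'' B'' \<star> ?N"
    unfolding assoc[OF pr1_mor[OF o] M' mat_mor, symmetric] p q using row_mat[OF x(1,2)] .
  show "pr2 A'' B'' \<star> (?M' \<star> ?M) = pr2 A'' B'' \<star> ?N"
    unfolding assoc[OF pr2_mor[OF o] M' mat_mor, symmetric] p q using row_mat[OF x(3,4)] .
qed

end

context
  fixes A B assumes A: "A \<in> Obj C" and B: "B \<in> Obj C"
begin

lemma row_id_zer: "row A B (Ident C A) (zer B A) = pr1 A B"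
  and row_zer_id: "row A B (zer A B) (Ident C B) = pr2 A B"
  and col_id_zer: "col A B (Ident C A) (zer A B) = inl A B"
  and col_zer_id: "col A B (zer B A) (Ident C B) = inr A B"
  using row_in[OF pr1_mor[OF A B] A B] row_in[OF pr2_mor[OF A B] A B]
    col_pr[OF inl_mor[OF A B] A B] col_pr[OF inr_mor[OF A B] A B] A B by simp_all

lemma mat_id: "mat A B A B (Ident C A) (zer B A) (zer A B) (Ident C B) = Ident C (A \<boxplus> B)"
  unfolding mat_def col_id_zer col_zer_id
  using row_in[OF id_mor[OF prd_Obj[OF A B]] A B] A B id_left[OF inl_mor[OF A B]]
    id_left[OF inr_mor[OF A B]] by simp

end

definition dsum :: "'a \<Rightarrow> 'a \<Rightarrow> 'a \<Rightarrow> 'a \<Rightarrow> 'b \<Rightarrow> 'b \<Rightarrow> 'b" where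
  "dsum A B A' B' f g = mat A B A' B' f (zer B A') (zer A B') g"

lemma mat_zer_upper:
  assumes "f \<in> mor A A'" "h \<in> mor A B'" "k \<in> mor B B'"
  shows "mat A B A' B' f (zer B A') h k \<star> inr A B = inr A' B' \<star> k"
proof -
  have o: "A \<in> Obj C" "B \<in> Obj C" "A' \<in> Obj C" "B' \<in> Obj C" using assms by (simp_all add: mor_def)
  have "inr A' B' \<star> k = col A' B' (zer B' A') (Ident C B') \<star> k" using o by (simp add: col_zer_id)
  also have "\<dots> = col A' B' (zer B A') k"
    using assms o by (simp add: col_comp[OF zer_mor id_mor assms(3)])
  finally show ?thesis using assms o by simp
qed

lemma mat_zer_lower:
  assumes "f \<in> mor A A'" "g \<in> mor B A'" "k \<in> mor B B'"
  shows "mat A B A' B' f g (zer A B') k \<star> inl A B = inl A' B' \<star> f"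
    and "pr2 A' B' \<star> mat A B A' B' f g (zer A B') k = k \<star> pr2 A B"
proof -
  have o: "A \<in> Obj C" "B \<in> Obj C" "A' \<in> Obj C" "B' \<in> Obj C" using assms by (simp_all add: mor_def)
  have "inl A' B' \<star> f = col A' B' (Ident C A') (zer A' B') \<star> f" using o by (simp add: col_id_zer)
  also have "\<dots> = col A' B' f (zer A B')"
    using assms o by (simp add: col_comp[OF id_mor zer_mor assms(1)])
  finally show "mat A B A' B' f g (zer A B') k \<star> inl A B = inl A' B' \<star> f" using assms o by simp
  have "k \<star> pr2 A B = k \<star> row A B (zer A B) (Ident C B)" using o by (simp add: row_zer_id)
  also have "\<dots> = row A B (zer A B') k"
    using assms o by (simp add: comp_row[OF zer_mor id_mor assms(3)])
  finally show "pr2 A' B' \<star> mat A B A' B' f g (zer A B') k = k \<star> pr2 A B" using assms o by simp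
qed

lemma pr1_mat_zer:
  assumes "f \<in> mor A A'" "h \<in> mor A B'" "k \<in> mor B B'"
  shows "pr1 A' B' \<star> mat A B A' B' f (zer B A') h k = f \<star> pr1 A B"
proof -
  have o: "A \<in> Obj C" "B \<in> Obj C" "A' \<in> Obj C" "B' \<in> Obj C" using assms by (simp_all add: mor_def)
  have "f \<star> pr1 A B = f \<star> row A B (Ident C A) (zer B A)" using o by (simp add: row_id_zer)
  also have "\<dots> = row A B f (zer B A')"
    using assms o by (simp add: comp_row[OF id_mor zer_mor assms(1)])
  finally show ?thesis using assms o by simp
qed

context
  fixes A B A' B' f g
  assumes f: "f \<in> mor A A'" and g: "g \<in> mor B B'"
begin

private lemma o: "A \<in> Obj C" "B \<in> Obj C" "A' \<in> Obj C" "B' \<in> Obj C"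
  using f g by (simp_all add: mor_def)

lemma dsum_mor [simp, intro]: "dsum A B A' B' f g \<in> mor (A \<boxplus> B) (A' \<boxplus> B')"
  unfolding dsum_def using f g o by simp

lemma dsum_inl: "dsum A B A' B' f g \<star> inl A B = inl A' B' \<star> f"
  and dsum_inr: "dsum A B A' B' f g \<star> inr A B = inr A' B' \<star> g"
  and pr1_dsum: "pr1 A' B' \<star> dsum A B A' B' f g = f \<star> pr1 A B"
  and pr2_dsum: "pr2 A' B' \<star> dsum A B A' B' f g = g \<star> pr2 A B"
  unfolding dsum_def
  using mat_zer_lower[OF f zer_mor g] mat_zer_upper[OF f zer_mor g] pr1_mat_zer[OF f zer_mor g] o
  by simp_all

lemma dsum_col:
  assumes x: "x \<in> mor S A" "y \<in> mor S B"
  shows "dsum A B A' B' f g \<star> col A B x y = col A' B' (f \<star> x) (g \<star> y)"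
  unfolding dsum_def using mat_col[OF f zer_mor zer_mor g x] o x comp_mor[OF f x(1)] comp_mor[OF g x(2)]
  by simp

lemma row_dsum:
  assumes x: "x \<in> mor A' S" "y \<in> mor B' S"
  shows "row A' B' x y \<star> dsum A B A' B' f g = row A B (x \<star> f) (y \<star> g)"
  unfolding dsum_def using row_mat[OF f zer_mor zer_mor g x] o x comp_mor[OF x(1) f] comp_mor[OF x(2) g]
  by simp

lemma mat_dsum:
  assumes x: "f' \<in> mor A' A''" "g' \<in> mor B' A''" "h' \<in> mor A' B''" "k' \<in> mor B' B''"
  shows "mat A' B' A'' B'' f' g' h' k' \<star> dsum A B A' B' f g =
    mat A B A'' B'' (f' \<star> f) (g' \<star> g) (h' \<star> f) (k' \<star> g)"
  unfolding dsum_def using mat_mat[OF f zer_mor zer_mor g x] o x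
    comp_mor[OF x(1) f] comp_mor[OF x(2) g] comp_mor[OF x(3) f] comp_mor[OF x(4) g]
  by simp

lemma dsum_mat:
  assumes x: "f' \<in> mor D A" "g' \<in> mor E A" "h' \<in> mor D B" "k' \<in> mor E B"
  shows "dsum A B A' B' f g \<star> mat D E A B f' g' h' k' =
    mat D E A' B' (f \<star> f') (f \<star> g') (g \<star> h') (g \<star> k')"
  unfolding dsum_def using mat_mat[OF x f zer_mor zer_mor g] o x
    comp_mor[OF f x(1)] comp_mor[OF f x(2)] comp_mor[OF g x(3)] comp_mor[OF g x(4)]
  by simp

lemma dsum_dsum:
  assumes x: "f' \<in> mor A' A''" "g' \<in> mor B' B''"
  shows "dsum A' B' A'' B'' f' g' \<star> dsum A B A' B' f g = dsum A B A'' B'' (f' \<star> f) (g' \<star> g)"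
  using mat_dsum[OF x(1) zer_mor zer_mor x(2)] o x f g morD(3)[OF x(1)] morD(3)[OF x(2)]
  unfolding dsum_def by simp

end

lemma dsum_id: "A \<in> Obj C \<Longrightarrow> B \<in> Obj C \<Longrightarrow> dsum A B A B (Ident C A) (Ident C B) = Ident C (A \<boxplus> B)"
  unfolding dsum_def by (rule mat_id)

lemma dsum_zer:
  assumes "A \<in> Obj C" "B \<in> Obj C" "A' \<in> Obj C" "B' \<in> Obj C"
  shows "dsum A B A' B' (zer A A') (zer B B') = zer (A \<boxplus> B) (A' \<boxplus> B')"
proof (rule ext_out[OF assms(1,2)])
  show "dsum A B A' B' (zer A A') (zer B B') \<in> mor (A \<boxplus> B) (A' \<boxplus> B')"
    "zer (A \<boxplus> B) (A' \<boxplus> B') \<in> mor (A \<boxplus> B) (A' \<boxplus> B')" using assms by simp_all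
  show "dsum A B A' B' (zer A A') (zer B B') \<star> inl A B = zer (A \<boxplus> B) (A' \<boxplus> B') \<star> inl A B"
    "dsum A B A' B' (zer A A') (zer B B') \<star> inr A B = zer (A \<boxplus> B) (A' \<boxplus> B') \<star> inr A B"
    using assms by (simp_all add: dsum_inl dsum_inr comp_zer[OF _ inl_mor] comp_zer[OF _ inr_mor]
      zer_comp[OF _ inl_mor] zer_comp[OF _ inr_mor])
qed

lemma inverses_dsum:
  assumes "inverses A f A' f'" "inverses B g B' g'"
  shows "inverses (A \<boxplus> B) (dsum A B A' B' f g) (A' \<boxplus> B') (dsum A' B' A B f' g')"
proof -
  have m: "f \<in> mor A A'" "f' \<in> mor A' A" "g \<in> mor B B'" "g' \<in> mor B' B"
    using assms by (auto simp: inverses_def)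
  have o: "A \<in> Obj C" "B \<in> Obj C" "A' \<in> Obj C" "B' \<in> Obj C" using m by (simp_all add: mor_def)
  show ?thesis
    using assms m o dsum_dsum[OF m(1,3) m(2,4)] dsum_dsum[OF m(2,4) m(1,3)]
    by (simp add: inverses_def dsum_id)
qed

section \<open>Symmetry and associativity of the direct sum\<close>

definition swap :: "'a \<Rightarrow> 'a \<Rightarrow> 'b" where
  "swap A B = mat A B B A (zer A B) (Ident C B) (Ident C A) (zer B A)"

lemma swap_mor [simp, intro]: "A \<in> Obj C \<Longrightarrow> B \<in> Obj C \<Longrightarrow> swap A B \<in> mor (A \<boxplus> B) (B \<boxplus> A)"
  unfolding swap_def by simp

lemma swap_swap:
  assumes "A \<in> Obj C" "B \<in> Obj C" shows "swap B A \<star> swap A B = Ident C (A \<boxplus> B)"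
proof -
  note m = zer_mor[OF assms] id_mor[OF assms(2)] id_mor[OF assms(1)] zer_mor[OF assms(2,1)]
  show ?thesis
    unfolding swap_def mat_mat[OF m m(4,3,2,1)]
    using assms by (simp add: comp_zer[OF _ m(2)] comp_zer[OF _ m(3)] zer_comp[OF _ m(1)] zer_comp[OF _ m(4)]
      id_left[OF id_mor] zer_comp[OF _ m(2)] zer_comp[OF _ m(3)] zer_plus[OF m(2)] plus_zer[OF m(3)]
      mat_id)
qed

lemma inverses_swap: "A \<in> Obj C \<Longrightarrow> B \<in> Obj C \<Longrightarrow> inverses (A \<boxplus> B) (swap A B) (B \<boxplus> A) (swap B A)"
  by (simp add: inverses_def swap_swap)

lemma swap_natural:
  assumes "f \<in> mor A A'" "g \<in> mor B B'"
  shows "swap A' B' \<star> dsum A B A' B' f g = dsum B A B' A' g f \<star> swap A B"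
proof -
  have o: "A \<in> Obj C" "B \<in> Obj C" "A' \<in> Obj C" "B' \<in> Obj C" using assms by (simp_all add: mor_def)
  show ?thesis
    unfolding swap_def
    using mat_dsum[OF assms, of "zer A' B'" B' "Ident C B'" "Ident C A'" A' "zer B' A'"]
      dsum_mat[OF assms(2,1), of "zer A B" A "Ident C B" B "Ident C A" "zer B A"] o assms by simp
qed

definition asc :: "'a \<Rightarrow> 'a \<Rightarrow> 'a \<Rightarrow> 'b" where
  "asc A B D = row (A \<boxplus> B) D (row A B (inl A (B \<boxplus> D)) (inr A (B \<boxplus> D) \<star> inl B D)) (inr A (B \<boxplus> D) \<star> inr B D)"

definition asc' :: "'a \<Rightarrow> 'a \<Rightarrow> 'a \<Rightarrow> 'b" where
  "asc' A B D = row A (B \<boxplus> D) (inl (A \<boxplus> B) D \<star> inl A B) (row B D (inl (A \<boxplus> B) D \<star> inr A B) (inr (A \<boxplus> B) D))"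

lemma row_inl_inr: "A \<in> Obj C \<Longrightarrow> B \<in> Obj C \<Longrightarrow> row A B (inl A B) (inr A B) = Ident C (A \<boxplus> B)"
  using row_in[of "Ident C (A \<boxplus> B)" A B "A \<boxplus> B"] id_left[OF inl_mor] id_left[OF inr_mor] by simp

context
  fixes A B D assumes o: "A \<in> Obj C" "B \<in> Obj C" "D \<in> Obj C"
begin

private lemma oo: "A \<boxplus> B \<in> Obj C" "B \<boxplus> D \<in> Obj C" using o by simp_all

private lemma m:
  "inl A B \<in> mor A (A \<boxplus> B)" "inr A B \<in> mor B (A \<boxplus> B)"
  "inl (A \<boxplus> B) D \<in> mor (A \<boxplus> B) ((A \<boxplus> B) \<boxplus> D)" "inr (A \<boxplus> B) D \<in> mor D ((A \<boxplus> B) \<boxplus> D)"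
  "inl B D \<in> mor B (B \<boxplus> D)" "inr B D \<in> mor D (B \<boxplus> D)"
  "inl A (B \<boxplus> D) \<in> mor A (A \<boxplus> (B \<boxplus> D))" "inr A (B \<boxplus> D) \<in> mor (B \<boxplus> D) (A \<boxplus> (B \<boxplus> D))"
  using o oo by simp_all

private lemma mm:
  "inl (A \<boxplus> B) D \<star> inl A B \<in> mor A ((A \<boxplus> B) \<boxplus> D)"
  "inl (A \<boxplus> B) D \<star> inr A B \<in> mor B ((A \<boxplus> B) \<boxplus> D)"
  "inr A (B \<boxplus> D) \<star> inl B D \<in> mor B (A \<boxplus> (B \<boxplus> D))"
  "inr A (B \<boxplus> D) \<star> inr B D \<in> mor D (A \<boxplus> (B \<boxplus> D))"
  using comp_mor[OF m(3) m(1)] comp_mor[OF m(3) m(2)] comp_mor[OF m(8) m(5)] comp_mor[OF m(8) m(6)] .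

private lemma mr:
  "row A B (inl A (B \<boxplus> D)) (inr A (B \<boxplus> D) \<star> inl B D) \<in> mor (A \<boxplus> B) (A \<boxplus> (B \<boxplus> D))"
  "row B D (inl (A \<boxplus> B) D \<star> inr A B) (inr (A \<boxplus> B) D) \<in> mor (B \<boxplus> D) ((A \<boxplus> B) \<boxplus> D)"
  using m mm by simp_all

lemma asc_mor [simp, intro]: "asc A B D \<in> mor ((A \<boxplus> B) \<boxplus> D) (A \<boxplus> (B \<boxplus> D))"
  and asc'_mor [simp, intro]: "asc' A B D \<in> mor (A \<boxplus> (B \<boxplus> D)) ((A \<boxplus> B) \<boxplus> D)"
  unfolding asc_def asc'_def using mm mr by simp_all

private lemma asc'_asc: "asc' A B D \<star> asc A B D = Ident C ((A \<boxplus> B) \<boxplus> D)"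
proof -
  have 1: "asc' A B D \<star> inl A (B \<boxplus> D) = inl (A \<boxplus> B) D \<star> inl A B"
    "asc' A B D \<star> inr A (B \<boxplus> D) = row B D (inl (A \<boxplus> B) D \<star> inr A B) (inr (A \<boxplus> B) D)"
    unfolding asc'_def using row_inl[OF mm(1) mr(2)] row_inr[OF mm(1) mr(2)] by simp_all
  have 2: "asc' A B D \<star> (inr A (B \<boxplus> D) \<star> inl B D) = inl (A \<boxplus> B) D \<star> inr A B"
    "asc' A B D \<star> (inr A (B \<boxplus> D) \<star> inr B D) = inr (A \<boxplus> B) D"
    using assoc[OF asc'_mor m(8) m(5)] assoc[OF asc'_mor m(8) m(6)] 1 row_inl[OF mm(2) m(4)]
      row_inr[OF mm(2) m(4)] by simp_all
  have "asc' A B D \<star> asc A B D = row (A \<boxplus> B) D (row A B (inl (A \<boxplus> B) D \<star> inl A B) (inl (A \<boxplus> B) D \<star> inr A B)) (inr (A \<boxplus> B) D)"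
    unfolding asc_def comp_row[OF mr(1) mm(4) asc'_mor] comp_row[OF m(7) mm(3) asc'_mor] 1 2 ..
  also have "\<dots> = Ident C ((A \<boxplus> B) \<boxplus> D)"
    using comp_row[OF m(1,2) m(3), symmetric] o oo id_right[OF m(3)] by (simp add: row_inl_inr)
  finally show ?thesis .
qed

private lemma asc_asc': "asc A B D \<star> asc' A B D = Ident C (A \<boxplus> (B \<boxplus> D))"
proof -
  have 1: "asc A B D \<star> inl (A \<boxplus> B) D = row A B (inl A (B \<boxplus> D)) (inr A (B \<boxplus> D) \<star> inl B D)"
    "asc A B D \<star> inr (A \<boxplus> B) D = inr A (B \<boxplus> D) \<star> inr B D"
    unfolding asc_def using row_inl[OF mr(1) mm(4)] row_inr[OF mr(1) mm(4)] by simp_all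
  have 2: "asc A B D \<star> (inl (A \<boxplus> B) D \<star> inl A B) = inl A (B \<boxplus> D)"
    "asc A B D \<star> (inl (A \<boxplus> B) D \<star> inr A B) = inr A (B \<boxplus> D) \<star> inl B D"
    using assoc[OF asc_mor m(3) m(1)] assoc[OF asc_mor m(3) m(2)] 1 row_inl[OF m(7) mm(3)]
      row_inr[OF m(7) mm(3)] by simp_all
  have "asc A B D \<star> asc' A B D = row A (B \<boxplus> D) (inl A (B \<boxplus> D)) (row B D (inr A (B \<boxplus> D) \<star> inl B D) (inr A (B \<boxplus> D) \<star> inr B D))"
    unfolding asc'_def comp_row[OF mm(1) mr(2) asc_mor] comp_row[OF mm(2) m(4) asc_mor] 1 2 ..
  also have "\<dots> = Ident C (A \<boxplus> (B \<boxplus> D))"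
    using comp_row[OF m(5,6) m(8), symmetric] o oo id_right[OF m(8)] by (simp add: row_inl_inr)
  finally show ?thesis .
qed

lemma inverses_asc: "inverses ((A \<boxplus> B) \<boxplus> D) (asc A B D) (A \<boxplus> (B \<boxplus> D)) (asc' A B D)"
  unfolding inverses_def using asc_asc' asc'_asc by simp

end

lemma asc_natural:
  assumes f: "f \<in> mor A A'" and g: "g \<in> mor B B'" and h: "h \<in> mor D D'"
  shows "asc A' B' D' \<star> dsum (A \<boxplus> B) D (A' \<boxplus> B') D' (dsum A B A' B' f g) h =
    dsum A (B \<boxplus> D) A' (B' \<boxplus> D') f (dsum B D B' D' g h) \<star> asc A B D"
    (is "_ \<star> ?L = ?R \<star> _")
proof -
  have o: "A \<in> Obj C" "B \<in> Obj C" "D \<in> Obj C" and o': "A' \<in> Obj C" "B' \<in> Obj C" "D' \<in> Obj C"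
    using assms by (simp_all add: mor_def)
  have oo: "B \<boxplus> D \<in> Obj C" "B' \<boxplus> D' \<in> Obj C" using o o' by simp_all
  note fg = dsum_mor[OF f g] and gh = dsum_mor[OF g h]
  note R = dsum_mor[OF f gh]
  note m = inl_mor[OF o(1) oo(1)] inr_mor[OF o(1) oo(1)] inl_mor[OF o(2,3)] inr_mor[OF o(2,3)]
  note m' = inl_mor[OF o'(1) oo(2)] inr_mor[OF o'(1) oo(2)] inl_mor[OF o'(2,3)] inr_mor[OF o'(2,3)]
  note mm = comp_mor[OF m(2) m(3)] comp_mor[OF m(2) m(4)]
  note mm' = comp_mor[OF m'(2) m'(3)] comp_mor[OF m'(2) m'(4)]
  have "asc A' B' D' \<star> ?L = row (A \<boxplus> B) D
     (row A B (inl A' (B' \<boxplus> D') \<star> f) (inr A' (B' \<boxplus> D') \<star> inl B' D' \<star> g)) (inr A' (B' \<boxplus> D') \<star> inr B' D' \<star> h)"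
    unfolding asc_def row_dsum[OF fg h row_mor[OF m'(1) mm'(1)] mm'(2)] row_dsum[OF f g m'(1) mm'(1)] ..
  moreover have "?R \<star> asc A B D = row (A \<boxplus> B) D
     (row A B (?R \<star> inl A (B \<boxplus> D)) (?R \<star> (inr A (B \<boxplus> D) \<star> inl B D))) (?R \<star> (inr A (B \<boxplus> D) \<star> inr B D))"
    unfolding asc_def comp_row[OF row_mor[OF m(1) mm(1)] mm(2) R] comp_row[OF m(1) mm(1) R] ..
  moreover have "?R \<star> inl A (B \<boxplus> D) = inl A' (B' \<boxplus> D') \<star> f" by (rule dsum_inl[OF f gh])
  moreover have "?R \<star> (inr A (B \<boxplus> D) \<star> inl B D) = inr A' (B' \<boxplus> D') \<star> inl B' D' \<star> g"
    unfolding assoc[OF R m(2) m(3), symmetric] dsum_inr[OF f gh] assoc[OF m'(2) gh m(3)]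
      dsum_inl[OF g h] assoc[OF m'(2) m'(3) g] ..
  moreover have "?R \<star> (inr A (B \<boxplus> D) \<star> inr B D) = inr A' (B' \<boxplus> D') \<star> inr B' D' \<star> h"
    unfolding assoc[OF R m(2) m(4), symmetric] dsum_inr[OF f gh] assoc[OF m'(2) gh m(4)]
      dsum_inr[OF g h] assoc[OF m'(2) m'(4) h] ..
  ultimately show ?thesis by simp
qed

lemma iso_prd: "iso A A' \<Longrightarrow> iso B B' \<Longrightarrow> iso (A \<boxplus> B) (A' \<boxplus> B')"
  unfolding iso_def using inverses_dsum by blast

lemma zero_object_prd:
  assumes "zero_object C Z" "zero_object C Z'"
  shows "zero_object C (Z \<boxplus> Z')"
  using assms dsum_id[of Z Z'] dsum_zer[of Z Z' Z Z'] by (auto simp: zero_object_iff)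

end

context exact_category
begin

section \<open>Short exact sequences in exact categories\<close>

lemma SesD:
  assumes "Ses C A i B p D"
  shows "i \<in> mor A B" "p \<in> mor B D" "p \<star> i = zer A D" "A \<in> Obj C" "B \<in> Obj C" "D \<in> Obj C"
  using Ses_Obj[OF assms] Ses_kernel[OF assms] by (auto simp: is_kernel_def mor_def)

lemma Ses_lift:
  assumes "Ses C A i B p D" "f \<in> mor T B" "p \<star> f = zer T D"
  obtains u where "u \<in> mor T A" "i \<star> u = f"
  using Ses_kernel[OF assms(1)] assms(2,3) Ses_Obj[OF assms(1)]
  unfolding is_kernel_def mor_def by blast

lemma Ses_monic:
  assumes s: "Ses C A i B p D" and u: "u \<in> mor T A" and v: "v \<in> mor T A" and e: "i \<star> u = i \<star> v"
  shows "u = v"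
proof -
  have T: "T \<in> Obj C" using u by (rule morD)
  have "p \<star> (i \<star> v) = zer T D"
    unfolding assoc[OF SesD(2)[OF s] SesD(1)[OF s] v, symmetric] SesD(3)[OF s]
    by (rule zer_comp[OF SesD(6)[OF s] v])
  moreover have "i \<star> v \<in> mor T B" using comp_mor[OF SesD(1)[OF s] v] .
  ultimately have "\<exists>!w. w \<in> Hom C T A \<and> i \<star> w = i \<star> v"
    using Ses_kernel[OF s] T unfolding is_kernel_def mor_def by blast
  then show ?thesis using u v e by (auto simp: mor_def)
qed

lemma Ses_extend:
  assumes "Ses C A i B p D" "f \<in> mor B T" "f \<star> i = zer A T"
  obtains u where "u \<in> mor D T" "u \<star> p = f"
  using Ses_cokernel[OF assms(1)] assms(2,3) Ses_Obj[OF assms(1)]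
  unfolding is_cokernel_def mor_def by blast

lemma Ses_epic:
  assumes s: "Ses C A i B p D" and u: "u \<in> mor D T" and v: "v \<in> mor D T" and e: "u \<star> p = v \<star> p"
  shows "u = v"
proof -
  have T: "T \<in> Obj C" using u by (rule morD)
  have "(v \<star> p) \<star> i = zer A T"
    unfolding assoc[OF v SesD(2)[OF s] SesD(1)[OF s]] SesD(3)[OF s]
    by (rule comp_zer[OF SesD(4)[OF s] v])
  moreover have "v \<star> p \<in> mor B T" using comp_mor[OF v SesD(2)[OF s]] .
  ultimately have "\<exists>!w. w \<in> Hom C D T \<and> w \<star> p = v \<star> p"
    using Ses_cokernel[OF s] T unfolding is_cokernel_def mor_def by blast
  then show ?thesis using u v e by (auto simp: mor_def)
qed

lemma Ses_transport:
  assumes "Ses C A i B p D" "inverses A a A' a'" "inverses B b B' b'" "inverses D c D' c'"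
    "i' \<in> mor A' B'" "p' \<in> mor B' D'" "b \<star> i = i' \<star> a" "c \<star> p = p' \<star> b"
  shows "Ses C A' i' B' p' D'"
  using assms(5,6) by (intro Ses_iso[OF assms(1) _ _ _ _ _ isomorphismI[OF assms(2)]
        isomorphismI[OF assms(3)] isomorphismI[OF assms(4)] assms(7,8)]) (simp_all add: mor_def)

text \<open>Kernels are unique up to isomorphism, and \<open>Ses_iso\<close> carries a distinguished
  sequence along such an isomorphism. Short exact sequences can thus be recognised by one admissible
  map and a universal property.\<close>

lemma epi_kernel_Ses:
  assumes epi: "adm_epi C B p D" and i: "i \<in> mor A B" "p \<star> i = zer A D"
    and lift: "\<And>T f. f \<in> mor T B \<Longrightarrow> p \<star> f = zer T D \<Longrightarrow> \<exists>u\<in>mor T A. i \<star> u = f"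
    and monic: "\<And>T u v. u \<in> mor T A \<Longrightarrow> v \<in> mor T A \<Longrightarrow> i \<star> u = i \<star> v \<Longrightarrow> u = v"
  shows "Ses C A i B p D"
proof -
  obtain K k where s: "Ses C K k B p D" using epi by (auto simp: adm_epi_def)
  note k = SesD[OF s]
  obtain u where u: "u \<in> mor K A" "i \<star> u = k" using lift[OF k(1,3)] by blast
  obtain v where v: "v \<in> mor A K" "k \<star> v = i" using Ses_lift[OF s i] by blast
  have A: "A \<in> Obj C" using i by (simp add: mor_def)
  have "u \<star> v = Ident C A"
    using assoc[OF i(1) u(1) v(1)] u(2) v(2) id_right[OF i(1)]
    by (intro monic[OF comp_mor[OF u(1) v(1)] id_mor[OF A]]) simp
  moreover have "v \<star> u = Ident C K"
    using assoc[OF k(1) v(1) u(1)] u(2) v(2) id_right[OF k(1)]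
    by (intro Ses_monic[OF s comp_mor[OF v(1) u(1)] id_mor[OF k(4)]]) simp
  ultimately have inv: "inverses K u A v" using u v by (simp add: inverses_def)
  show ?thesis
    using u(2) id_left[OF k(1)] id_left[OF k(2)] id_right[OF k(2)]
    by (intro Ses_transport[OF s inv inverses_id[OF k(5)] inverses_id[OF k(6)] i(1) k(2)]) simp_all
qed

text \<open>The dual argument, with uniqueness of cokernels.\<close>

lemma mono_cokernel_Ses:
  assumes mono: "adm_mono C A i B" and p: "p \<in> mor B D" "p \<star> i = zer A D"
    and extend: "\<And>T f. f \<in> mor B T \<Longrightarrow> f \<star> i = zer A T \<Longrightarrow> \<exists>u\<in>mor D T. u \<star> p = f"
    and epic: "\<And>T u v. u \<in> mor D T \<Longrightarrow> v \<in> mor D T \<Longrightarrow> u \<star> p = v \<star> p \<Longrightarrow> u = v"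
  shows "Ses C A i B p D"
proof -
  obtain K k where s: "Ses C A i B k K" using mono by (auto simp: adm_mono_def)
  note k = SesD[OF s]
  obtain u where u: "u \<in> mor D K" "u \<star> p = k" using extend[OF k(2,3)] by blast
  obtain v where v: "v \<in> mor K D" "v \<star> k = p" using Ses_extend[OF s p] by blast
  have D: "D \<in> Obj C" using p by (simp add: mor_def)
  have "v \<star> u = Ident C D"
    using assoc[OF v(1) u(1) p(1)] u(2) v(2) id_left[OF p(1)]
    by (intro epic[OF comp_mor[OF v(1) u(1)] id_mor[OF D]]) simp
  moreover have "u \<star> v = Ident C K"
    using assoc[OF u(1) v(1) k(2)] u(2) v(2) id_left[OF k(2)]
    by (intro Ses_epic[OF s comp_mor[OF u(1) v(1)] id_mor[OF k(6)]]) simp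
  ultimately have inv: "inverses K v D u" using u v by (simp add: inverses_def)
  show ?thesis
    using v(2) id_left[OF k(1)] id_right[OF k(1)] id_right[OF p(1)]
    by (intro Ses_transport[OF s inverses_id[OF k(4)] inverses_id[OF k(5)] inv k(1) p(1)]) simp_all
qed

text \<open>The identity is an admissible epimorphism by axiom, and \<open>Z\<close> has the
  universal property of its kernel.\<close>

lemma Ses_zer_id:
  assumes Z: "zero_object C Z" and A: "A \<in> Obj C"
  shows "Ses C Z (zer Z A) A (Ident C A) A"
proof (rule epi_kernel_Ses[OF Ident_adm_epi[OF A]])
  have Z': "Z \<in> Obj C" using Z by (simp add: zero_object_iff)
  then show "zer Z A \<in> mor Z A" "Ident C A \<star> zer Z A = zer Z A" using A by simp_all
  show "\<exists>u\<in>mor T Z. zer Z A \<star> u = f" if "f \<in> mor T A" "Ident C A \<star> f = zer T A" for T f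
    using that A Z' morD(2)[OF that(1)] zer_comp[OF A zer_mor[of T Z]] by (intro bexI[of _ "zer T Z"]) simp_all
  show "u = v" if "u \<in> mor T Z" "v \<in> mor T Z" for T u v
    using that zero_objectD(2)[OF Z] by metis
qed

lemma Ses_id_zer:
  assumes Z: "zero_object C Z" and A: "A \<in> Obj C"
  shows "Ses C A (Ident C A) A (zer A Z) Z"
proof (rule mono_cokernel_Ses[OF Ident_adm_mono[OF A]])
  have Z': "Z \<in> Obj C" using Z by (simp add: zero_object_iff)
  then show "zer A Z \<in> mor A Z" "zer A Z \<star> Ident C A = zer A Z" using A by simp_all
  show "\<exists>u\<in>mor Z T. u \<star> zer A Z = f" if "f \<in> mor A T" "f \<star> Ident C A = zer A T" for T f
    using that A Z' morD(3)[OF that(1)] comp_zer[OF A zer_mor[of Z T]] by (intro bexI[of _ "zer Z T"]) simp_all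
  show "u = v" if "u \<in> mor Z T" "v \<in> mor Z T" for T u v
    using that zero_objectD(3)[OF Z] by metis
qed

text \<open>That split sequences are admissible is not among the axioms. The projection is the
  pullback of the map from \<open>B\<close> to \<open>Zob\<close> along the map from
  \<open>A\<close> to \<open>Zob\<close>, and pullbacks of admissible epimorphisms are
  admissible.\<close>

lemma Ses_inr_pr1:
  assumes A: "A \<in> Obj C" and B: "B \<in> Obj C"
  shows "Ses C B (inr A B) (A \<boxplus> B) (pr1 A B) A"
proof (rule epi_kernel_Ses)
  note m = inl_mor[OF A B] inr_mor[OF A B] pr1_mor[OF A B] pr2_mor[OF A B]
  have "adm_epi C B (zer B Zob) Zob"
    using Ses_id_zer[OF Zob B] by (auto simp: adm_epi_def)
  from pullback_adm_epi[OF this A morD(1)[OF zer_mor[OF A Zob_Obj]]]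
  obtain p' B' f' where pb: "pullback C B (zer B Zob) Zob (zer A Zob) A p' B' f'"
    and epi: "adm_epi C B' p' A" by blast
  have p': "p' \<in> mor B' A" and f': "f' \<in> mor B' B" and B': "B' \<in> Obj C"
    using pb A B by (auto simp: pullback_def mor_def)
  have ex: "\<exists>!u. u \<in> Hom C T B' \<and> f' \<star> u = g \<and> p' \<star> u = h"
    if g: "g \<in> mor T B" and h: "h \<in> mor T A" for T g h
    using pb zer_comp[OF Zob_Obj g] zer_comp[OF Zob_Obj h] g h
    by (simp add: pullback_def mor_def)
  \<comment> \<open>The pullback over a zero object is another product of \<open>A\<close> and
    \<open>B\<close>; \<open>w\<close> compares it with the chosen biproduct.\<close>
  obtain w where w: "w \<in> mor (A \<boxplus> B) B'" "f' \<star> w = pr2 A B" "p' \<star> w = pr1 A B"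
    using ex[OF m(4,3)] A B B' by (auto simp: mor_def)
  have c: "col A B p' f' \<in> mor B' (A \<boxplus> B)" using p' f' by simp
  have 1: "w \<star> col A B p' f' = Ident C B'"
  proof -
    have "w \<star> col A B p' f' \<in> mor B' B'" using comp_mor[OF w(1) c] .
    moreover have "f' \<star> (w \<star> col A B p' f') = f'" "p' \<star> (w \<star> col A B p' f') = p'"
      using assoc[OF f' w(1) c] assoc[OF p' w(1) c] w p' f' by simp_all
    moreover have "Ident C B' \<in> mor B' B'" "f' \<star> Ident C B' = f'" "p' \<star> Ident C B' = p'"
      using f' p' B' by simp_all
    ultimately show ?thesis using ex[OF f' p'] unfolding mor_def by blast
  qed
  have 2: "col A B p' f' \<star> w = Ident C (A \<boxplus> B)"
    using w col_comp[OF p' f' w(1)] col_pr[OF id_mor[OF prd_Obj[OF A B]] A B] id_right[OF m(3)]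
      id_right[OF m(4)] A B by simp
  have inv: "inverses B' (col A B p' f') (A \<boxplus> B) w"
    using 1 2 w c by (simp add: inverses_def)
  obtain K k where s: "Ses C K k B' p' A" using epi by (auto simp: adm_epi_def)
  have "Ses C K (col A B p' f' \<star> k) (A \<boxplus> B) (pr1 A B) A"
    using id_right[OF comp_mor[OF c SesD(1)[OF s]]] id_left[OF p'] p' f' A
    by (intro Ses_transport[OF s inverses_id[OF SesD(4)[OF s]] inv inverses_id[OF A]
         comp_mor[OF c SesD(1)[OF s]] m(3)]) simp_all
  then show "adm_epi C (A \<boxplus> B) (pr1 A B) A" by (auto simp: adm_epi_def)
  show "inr A B \<in> mor B (A \<boxplus> B)" "pr1 A B \<star> inr A B = zer B A" using A B by simp_all
  show "\<exists>u\<in>mor T B. inr A B \<star> u = f" if f: "f \<in> mor T (A \<boxplus> B)" "pr1 A B \<star> f = zer T A" for T f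
  proof (rule bexI)
    show u: "pr2 A B \<star> f \<in> mor T B" using comp_mor[OF m(4) f(1)] .
    have T: "T \<in> Obj C" using f(1) by (rule morD)
    show "inr A B \<star> (pr2 A B \<star> f) = f"
    proof (rule ext_into[OF A B comp_mor[OF m(2) u] f(1)])
      show "pr1 A B \<star> (inr A B \<star> (pr2 A B \<star> f)) = pr1 A B \<star> f"
        using assoc[OF m(3,2) u] zer_comp[OF A u] A B f(2) by simp
      show "pr2 A B \<star> (inr A B \<star> (pr2 A B \<star> f)) = pr2 A B \<star> f"
        using assoc[OF m(4,2) u] id_left[OF u] A B by simp
    qed
  qed
  show "u = v" if u: "u \<in> mor T B" and v: "v \<in> mor T B" and e: "inr A B \<star> u = inr A B \<star> v" for T u v
    using assoc[OF m(4,2) u] assoc[OF m(4,2) v] e id_left[OF u] id_left[OF v] A B by simp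
qed

lemma Ses_inl_pr2:
  assumes A: "A \<in> Obj C" and B: "B \<in> Obj C"
  shows "Ses C A (inl A B) (A \<boxplus> B) (pr2 A B) B"
proof (rule Ses_transport[OF Ses_inr_pr1[OF B A] inverses_id[OF A] inverses_swap[OF B A] inverses_id[OF B]])
  have "swap B A \<star> inr B A = inl A B" "pr2 A B \<star> swap B A = pr1 B A"
    unfolding swap_def using A B by (simp_all add: col_id_zer row_id_zer)
  then show "swap B A \<star> inr B A = inl A B \<star> Ident C A" "Ident C B \<star> pr1 B A = pr2 A B \<star> swap B A"
    using id_right[OF inl_mor[OF A B]] id_left[OF pr1_mor[OF B A]] by simp_all
qed (use A B in simp_all)

lemma adm_monoI: "Ses C A i B p D \<Longrightarrow> adm_mono C A i B"
  and adm_epiI: "Ses C A i B p D \<Longrightarrow> adm_epi C B p D"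
  by (auto simp: adm_mono_def adm_epi_def)

text \<open>The epimorphism is a composite of two admissible ones, a projection and
  \<open>p\<close>, and its kernel is found componentwise.\<close>

lemma Ses_add_right:
  assumes s: "Ses C A i B p D" and X: "X \<in> Obj C"
  shows "Ses C (A \<boxplus> X) (dsum A X B X i (Ident C X)) (B \<boxplus> X) (p \<star> pr1 B X) D"
proof (rule epi_kernel_Ses)
  note m = SesD[OF s] and idX = id_mor[OF X]
  note i = dsum_mor[OF m(1) idX] and q = inl_mor[OF m(5) X] inr_mor[OF m(5) X] pr1_mor[OF m(5) X] pr2_mor[OF m(5) X]
  note r = inl_mor[OF m(4) X] inr_mor[OF m(4) X] pr1_mor[OF m(4) X] pr2_mor[OF m(4) X]
  show "adm_epi C (B \<boxplus> X) (p \<star> pr1 B X) D"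
    by (rule Comp_adm_epi[OF adm_epiI[OF Ses_inr_pr1[OF m(5) X]] adm_epiI[OF s]])
  show "dsum A X B X i (Ident C X) \<in> mor (A \<boxplus> X) (B \<boxplus> X)" by (rule i)
  show "p \<star> pr1 B X \<star> dsum A X B X i (Ident C X) = zer (A \<boxplus> X) D"
    unfolding assoc[OF m(2) q(3) i] pr1_dsum[OF m(1) idX] assoc[OF m(2,1) r(3), symmetric] m(3)
    by (rule zer_comp[OF m(6) r(3)])
  show "\<exists>u\<in>mor T (A \<boxplus> X). dsum A X B X i (Ident C X) \<star> u = f"
    if f: "f \<in> mor T (B \<boxplus> X)" "p \<star> pr1 B X \<star> f = zer T D" for T f
  proof -
    have "p \<star> (pr1 B X \<star> f) = zer T D" using f assoc[OF m(2) q(3) f(1)] by simp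
    then obtain u where u: "u \<in> mor T A" "i \<star> u = pr1 B X \<star> f"
      by (rule Ses_lift[OF s comp_mor[OF q(3) f(1)]])
    note x = comp_mor[OF q(4) f(1)]
    show ?thesis
      using dsum_col[OF m(1) idX u(1) x] u(2) id_left[OF x] col_pr[OF f(1) m(5) X] col_mor[OF u(1) x]
      by (intro bexI[of _ "col A X u (pr2 B X \<star> f)"]) simp_all
  qed
  show "u = v" if u: "u \<in> mor T (A \<boxplus> X)" and v: "v \<in> mor T (A \<boxplus> X)"
    and e: "dsum A X B X i (Ident C X) \<star> u = dsum A X B X i (Ident C X) \<star> v" for T u v
  proof (rule ext_into[OF m(4) X u v])
    have "i \<star> (pr1 A X \<star> w) = pr1 B X \<star> (dsum A X B X i (Ident C X) \<star> w)"
      "pr2 A X \<star> w = pr2 B X \<star> (dsum A X B X i (Ident C X) \<star> w)" if w: "w \<in> mor T (A \<boxplus> X)" for w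
      unfolding assoc[OF q(3) i w, symmetric] assoc[OF q(4) i w, symmetric]
        pr1_dsum[OF m(1) idX] pr2_dsum[OF m(1) idX]
      using assoc[OF m(1) r(3) w] id_left[OF r(4)] by simp_all
    note * = this[OF u] this[OF v]
    show "pr2 A X \<star> u = pr2 A X \<star> v" using * e by simp
    show "pr1 A X \<star> u = pr1 A X \<star> v"
      using * e by (intro Ses_monic[OF s comp_mor[OF r(3) u] comp_mor[OF r(3) v]]) simp
  qed
qed

text \<open>The monomorphism is \<open>i\<close> on the first summand followed by \<open>i'\<close>
  on the second, a composite of two admissible ones. Its cokernel is then tested on the two
  summands.\<close>

lemma Ses_dsum:
  assumes s: "Ses C A i B p D" and s': "Ses C A' i' B' p' D'"
  shows "Ses C (A \<boxplus> A') (dsum A A' B B' i i') (B \<boxplus> B') (dsum B B' D D' p p') (D \<boxplus> D')"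
proof (rule mono_cokernel_Ses)
  note m = SesD[OF s] and m' = SesD[OF s']
  note i = dsum_mor[OF m(1) m'(1)] and p = dsum_mor[OF m(2) m'(2)]
  note q = inl_mor[OF m(5) m'(5)] inr_mor[OF m(5) m'(5)]
  note r = inl_mor[OF m(6) m'(6)] inr_mor[OF m(6) m'(6)]
  note t = inl_mor[OF m(4) m'(4)] inr_mor[OF m(4) m'(4)]
  have 1: "adm_mono C (A \<boxplus> A') (dsum A A' B A' i (Ident C A')) (B \<boxplus> A')"
    by (rule adm_monoI[OF Ses_add_right[OF s m'(4)]])
  have 2: "adm_mono C (B \<boxplus> A') (dsum B A' B B' (Ident C B) i') (B \<boxplus> B')"
  proof -
    have "Ses C (B \<boxplus> A') (dsum B A' B B' (Ident C B) i') (B \<boxplus> B') (p' \<star> pr1 B' B \<star> swap B B') D'"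
    proof (rule Ses_transport[OF Ses_add_right[OF s' m(5)] inverses_swap[OF m'(4) m(5)]
          inverses_swap[OF m'(5) m(5)] inverses_id[OF m'(6)]])
      note pp = comp_mor[OF m'(2) pr1_mor[OF m'(5) m(5)]]
      show "dsum B A' B B' (Ident C B) i' \<in> mor (B \<boxplus> A') (B \<boxplus> B')"
        by (rule dsum_mor[OF id_mor[OF m(5)] m'(1)])
      show "p' \<star> pr1 B' B \<star> swap B B' \<in> mor (B \<boxplus> B') D'"
        by (rule comp_mor[OF pp swap_mor[OF m(5) m'(5)]])
      show "swap B' B \<star> dsum A' B B' B i' (Ident C B) = dsum B A' B B' (Ident C B) i' \<star> swap A' B"
        by (rule swap_natural[OF m'(1) id_mor[OF m(5)]])
      show "Ident C D' \<star> (p' \<star> pr1 B' B) = p' \<star> pr1 B' B \<star> swap B B' \<star> swap B' B"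
        using assoc[OF pp swap_mor[OF m(5) m'(5)] swap_mor[OF m'(5) m(5)]]
          swap_swap[OF m'(5) m(5)] id_left[OF pp] id_right[OF pp] by simp
    qed
    then show ?thesis by (rule adm_monoI)
  qed
  have "dsum B A' B B' (Ident C B) i' \<star> dsum A A' B A' i (Ident C A') = dsum A A' B B' i i'"
    using dsum_dsum[OF m(1) id_mor[OF m'(4)] id_mor[OF m(5)] m'(1)] id_left[OF m(1)] id_right[OF m'(1)] by simp
  then show "adm_mono C (A \<boxplus> A') (dsum A A' B B' i i') (B \<boxplus> B')"
    using Comp_adm_mono[OF 1 2] by simp
  show "dsum B B' D D' p p' \<in> mor (B \<boxplus> B') (D \<boxplus> D')" by (rule p)
  show "dsum B B' D D' p p' \<star> dsum A A' B B' i i' = zer (A \<boxplus> A') (D \<boxplus> D')"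
    using dsum_dsum[OF m(1) m'(1) m(2) m'(2)] m(3) m'(3) dsum_zer[OF m(4) m'(4) m(6) m'(6)] by simp
  show "\<exists>u\<in>mor (D \<boxplus> D') T. u \<star> dsum B B' D D' p p' = f"
    if f: "f \<in> mor (B \<boxplus> B') T" "f \<star> dsum A A' B B' i i' = zer (A \<boxplus> A') T" for T f
  proof -
    have T: "T \<in> Obj C" using f(1) by (rule morD)
    have "(f \<star> inl B B') \<star> i = zer A T"
      unfolding assoc[OF f(1) q(1) m(1)] dsum_inl[OF m(1) m'(1), symmetric]
        assoc[OF f(1) i t(1), symmetric] f(2) by (rule zer_comp[OF T t(1)])
    then obtain u where u: "u \<in> mor D T" "u \<star> p = f \<star> inl B B'"
      by (rule Ses_extend[OF s comp_mor[OF f(1) q(1)]])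
    have "(f \<star> inr B B') \<star> i' = zer A' T"
      unfolding assoc[OF f(1) q(2) m'(1)] dsum_inr[OF m(1) m'(1), symmetric]
        assoc[OF f(1) i t(2), symmetric] f(2) by (rule zer_comp[OF T t(2)])
    then obtain u' where u': "u' \<in> mor D' T" "u' \<star> p' = f \<star> inr B B'"
      by (rule Ses_extend[OF s' comp_mor[OF f(1) q(2)]])
    show ?thesis
      using row_dsum[OF m(2) m'(2) u(1) u'(1)] u(2) u'(2) row_in[OF f(1) m(5) m'(5)] row_mor[OF u(1) u'(1)]
      by (intro bexI[of _ "row D D' u u'"]) simp_all
  qed
  show "u = v" if u: "u \<in> mor (D \<boxplus> D') T" and v: "v \<in> mor (D \<boxplus> D') T"
    and e: "u \<star> dsum B B' D D' p p' = v \<star> dsum B B' D D' p p'" for T u v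
  proof (rule ext_out[OF m(6) m'(6) u v])
    have "(w \<star> inl D D') \<star> p = (w \<star> dsum B B' D D' p p') \<star> inl B B'"
      "(w \<star> inr D D') \<star> p' = (w \<star> dsum B B' D D' p p') \<star> inr B B'" if w: "w \<in> mor (D \<boxplus> D') T" for w
      unfolding assoc[OF w p q(1)] assoc[OF w p q(2)] dsum_inl[OF m(2) m'(2)] dsum_inr[OF m(2) m'(2)]
        assoc[OF w r(1) m(2)] assoc[OF w r(2) m'(2)] by simp_all
    note * = this[OF u] this[OF v]
    show "u \<star> inl D D' = v \<star> inl D D'"
      using * e by (intro Ses_epic[OF s comp_mor[OF u r(1)] comp_mor[OF v r(1)]]) simp
    show "u \<star> inr D D' = v \<star> inr D D'"
      using * e by (intro Ses_epic[OF s' comp_mor[OF u r(2)] comp_mor[OF v r(2)]]) simp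
  qed
qed

text \<open>Pulling back does not change the kernel: the pair of \<open>i\<close> and the zero map
  induces a map from \<open>A\<close> to the pullback, and lifting along \<open>i\<close> gives
  lifting along it.\<close>

lemma pullback_Ses:
  assumes s: "Ses C A i B p D" and f: "f \<in> mor D' D"
  obtains p' B' f' i' where "pullback C B p D f D' p' B' f'" "Ses C A i' B' p' D'"
proof -
  note m = SesD[OF s]
  have D': "D' \<in> Obj C" using f by (rule morD)
  obtain p' B' f' where pb: "pullback C B p D f D' p' B' f'" and epi: "adm_epi C B' p' D'"
    using pullback_adm_epi[OF adm_epiI[OF s] D' morD(1)[OF f]] by blast
  have p': "p' \<in> mor B' D'" and f': "f' \<in> mor B' B" and c: "p \<star> f' = f \<star> p'"
    using pb m D' by (auto simp: pullback_def mor_def)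
  have ex: "\<exists>!u. u \<in> Hom C T B' \<and> f' \<star> u = g \<and> p' \<star> u = h"
    if g: "g \<in> mor T B" and h: "h \<in> mor T D'" and "p \<star> g = f \<star> h" for T g h
    using pb that by (simp add: pullback_def mor_def)
  have "p \<star> i = f \<star> zer A D'" using comp_zer[OF m(4) f] m(3) by simp
  from ex[OF m(1) zer_mor[OF m(4) D'] this]
  obtain k where k: "k \<in> mor A B'" "f' \<star> k = i" "p' \<star> k = zer A D'"
    using p' m(4) by (auto simp: mor_def)
  have "Ses C A k B' p' D'"
  proof (rule epi_kernel_Ses[OF epi k(1,3)])
    fix T g assume g: "g \<in> mor T B'" "p' \<star> g = zer T D'"
    have T: "T \<in> Obj C" using g(1) by (rule morD)
    have "p \<star> (f' \<star> g) = zer T D"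
      unfolding assoc[OF m(2) f' g(1), symmetric] c assoc[OF f p' g(1)] g(2) by (rule comp_zer[OF T f])
    then obtain v where v: "v \<in> mor T A" "i \<star> v = f' \<star> g"
      by (rule Ses_lift[OF s comp_mor[OF f' g(1)]])
    have "f' \<star> (k \<star> v) = f' \<star> g" using assoc[OF f' k(1) v(1)] k(2) v(2) by simp
    moreover have "p' \<star> (k \<star> v) = p' \<star> g"
      using assoc[OF p' k(1) v(1)] k(3) g(2) zer_comp[OF D' v(1)] by simp
    moreover have "p \<star> (f' \<star> g) = f \<star> (p' \<star> g)"
      using assoc[OF m(2) f' g(1)] assoc[OF f p' g(1)] c by simp
    ultimately have "k \<star> v = g"
      using ex[OF comp_mor[OF f' g(1)] comp_mor[OF p' g(1)]] comp_mor[OF k(1) v(1)] g(1)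
      unfolding mor_def by blast
    then show "\<exists>u\<in>mor T A. k \<star> u = g" using v(1) by blast
  next
    fix T u v assume u: "u \<in> mor T A" and v: "v \<in> mor T A" and e: "k \<star> u = k \<star> v"
    show "u = v"
      using e assoc[OF f' k(1) u] assoc[OF f' k(1) v] k(2) by (intro Ses_monic[OF s u v]) simp
  qed
  then show thesis using pb that by blast
qed

lemma Ses_common_pullback:
  assumes s: "Ses C A i B p D" and s': "Ses C A' i' B' p' D"
  obtains G a b a' b' where "Ses C A a G b B'" "Ses C A' a' G b' B"
proof -
  note m = SesD[OF s] and m' = SesD[OF s']
  \<comment> \<open>The axiom makes only one projection of a pullback admissible. The square is
    therefore formed twice, with the roles exchanged, and \<open>w\<close> and \<open>v\<close>
    identify the two corners.\<close>
  obtain q G f j where pb: "pullback C B p D p' B' q G f" and s1: "Ses C A j G q B'"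
    by (rule pullback_Ses[OF s m'(2)])
  obtain q' G' f' j' where pb': "pullback C B' p' D p B q' G' f'" and s2: "Ses C A' j' G' q' B"
    by (rule pullback_Ses[OF s' m(2)])
  have q: "q \<in> mor G B'" "f \<in> mor G B" "p \<star> f = p' \<star> q" "G \<in> Obj C"
    using pb m m' by (auto simp: pullback_def mor_def)
  have q': "q' \<in> mor G' B" "f' \<in> mor G' B'" "p' \<star> f' = p \<star> q'" "G' \<in> Obj C"
    using pb' m m' by (auto simp: pullback_def mor_def)
  have ex: "\<exists>!u. u \<in> Hom C T G \<and> f \<star> u = g \<and> q \<star> u = h"
    if "g \<in> mor T B" "h \<in> mor T B'" "p \<star> g = p' \<star> h" for T g h
    using pb that by (simp add: pullback_def mor_def)
  have ex': "\<exists>!u. u \<in> Hom C T G' \<and> f' \<star> u = h \<and> q' \<star> u = g"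
    if "g \<in> mor T B" "h \<in> mor T B'" "p \<star> g = p' \<star> h" for T g h
    using pb' that by (simp add: pullback_def mor_def)
  obtain w where w: "w \<in> mor G' G" "f \<star> w = q'" "q \<star> w = f'"
    using ex[OF q'(1,2) q'(3)[symmetric]] q(4) q'(4) by (auto simp: mor_def)
  obtain v where v: "v \<in> mor G G'" "f' \<star> v = q" "q' \<star> v = f"
    using ex'[OF q(2,1) q(3)] q(4) q'(4) by (auto simp: mor_def)
  have "w \<star> v = Ident C G"
  proof -
    have "f \<star> (w \<star> v) = f" "q \<star> (w \<star> v) = q"
      using assoc[OF q(2) w(1) v(1)] assoc[OF q(1) w(1) v(1)] w v by simp_all
    moreover have "f \<star> Ident C G = f" "q \<star> Ident C G = q" using q by simp_all
    ultimately show ?thesis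
      using ex[OF q(2,1) q(3)] comp_mor[OF w(1) v(1)] id_mor[OF q(4)] unfolding mor_def by blast
  qed
  moreover have "v \<star> w = Ident C G'"
  proof -
    have "f' \<star> (v \<star> w) = f'" "q' \<star> (v \<star> w) = q'"
      using assoc[OF q'(2) v(1) w(1)] assoc[OF q'(1) v(1) w(1)] w v by simp_all
    moreover have "f' \<star> Ident C G' = f'" "q' \<star> Ident C G' = q'" using q' by simp_all
    ultimately show ?thesis
      using ex'[OF q'(1,2) q'(3)[symmetric]] comp_mor[OF v(1) w(1)] id_mor[OF q'(4)] unfolding mor_def by blast
  qed
  ultimately have inv: "inverses G' w G v" using w v by (simp add: inverses_def)
  note j = comp_mor[OF w(1) SesD(1)[OF s2]]
  have "Ses C A' (w \<star> j') G f B"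
    using id_right[OF j] id_left[OF q'(1)] w(2)
    by (intro Ses_transport[OF s2 inverses_id[OF m'(4)] inv inverses_id[OF m(5)] j q(2)]) simp_all
  then show thesis using s1 that by blast
qed

section \<open>Cones of graded isomorphisms\<close>

definition bounded_gr :: "(int \<Rightarrow> 'a) \<Rightarrow> bool" where
  "bounded_gr G \<longleftrightarrow> supported_on C G {0..} \<and> (\<exists>b. supported_on C G {..b})"

text \<open>The witnesses of acyclicity as explicit data, since complexes will be cut at the object
  \<open>J 1\<close>.\<close>

definition cycles :: "(int \<Rightarrow> 'a) \<Rightarrow> (int \<Rightarrow> 'b) \<Rightarrow> (int \<Rightarrow> 'a) \<Rightarrow> (int \<Rightarrow> 'b) \<Rightarrow> (int \<Rightarrow> 'b) \<Rightarrow> bool" where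
  "cycles G d J p i \<longleftrightarrow> (\<forall>n. Ses C (J n) (i n) (G n) (p n) (J (n - 1)) \<and> d n = i (n - 1) \<star> p n)"

lemma cyclesD:
  assumes "cycles G d J p i"
  shows "Ses C (J n) (i n) (G n) (p n) (J (n - 1))" "d n = i (n - 1) \<star> p n"
    "d n \<in> mor (G n) (G (n - 1))" "d (n - 1) \<star> d n = zer (G n) (G (n - 2))"
proof -
  show s: "Ses C (J n) (i n) (G n) (p n) (J (n - 1))" and d: "d n = i (n - 1) \<star> p n" for n
    using assms by (auto simp: cycles_def)
  show "d n \<in> mor (G n) (G (n - 1))"
    unfolding d using comp_mor[OF SesD(1)[OF s] SesD(2)[OF s]] .
  have 2: "n - 1 - 1 = n - 2" by simp
  have i2: "i (n - 2) \<in> mor (J (n - 2)) (G (n - 2))" by (rule SesD(1)[OF s])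
  have p1: "p (n - 1) \<in> mor (G (n - 1)) (J (n - 2))" using SesD(2)[OF s[of "n - 1"]] by (simp only: 2)
  have pi: "p (n - 1) \<star> i (n - 1) = zer (J (n - 1)) (J (n - 2))" using SesD(3)[OF s[of "n - 1"]] by (simp only: 2)
  note i1 = SesD(1)[OF s[of "n - 1"]] and p = SesD(2)[OF s[of n]]
  have "d (n - 1) \<star> d n = (i (n - 2) \<star> p (n - 1)) \<star> (i (n - 1) \<star> p n)" by (simp only: d 2)
  also have "\<dots> = i (n - 2) \<star> (p (n - 1) \<star> i (n - 1) \<star> p n)"
    by (simp only: assoc[OF i2 p1 comp_mor[OF i1 p]] assoc[OF p1 i1 p])
  also have "\<dots> = i (n - 2) \<star> zer (G n) (J (n - 2))"
    by (simp only: pi zer_comp[OF SesD(4)[OF s] p])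
  also have "\<dots> = zer (G n) (G (n - 2))" by (rule comp_zer[OF SesD(5)[OF s] i2])
  finally show "d (n - 1) \<star> d n = zer (G n) (G (n - 2))" .
qed

text \<open>Splicing short exact sequences already yields a differential of square zero and the
  admissibility conditions, so only boundedness has to be carried along.\<close>

lemma acyclic_iff: "acyclic_complex C G d \<longleftrightarrow> bounded_gr G \<and> (\<exists>J p i. cycles G d J p i)"
proof
  assume "acyclic_complex C G d"
  then show "bounded_gr G \<and> (\<exists>J p i. cycles G d J p i)"
    unfolding acyclic_complex_def chain_complex_def bounded_gr_def cycles_def by blast
next
  assume a: "bounded_gr G \<and> (\<exists>J p i. cycles G d J p i)"
  then obtain J p i where c: "cycles G d J p i" by blast
  show "acyclic_complex C G d"
    unfolding acyclic_complex_def chain_complex_def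
  proof (intro conjI allI)
    show "supported_on C G {0..}" "\<exists>b. supported_on C G {..b}" using a by (auto simp: bounded_gr_def)
    show "G n \<in> Obj C" for n using SesD(5)[OF cyclesD(1)[OF c]] .
    show "d n \<in> Hom C (G n) (G (n - 1))" for n using morD(1)[OF cyclesD(3)[OF c]] .
    show "d (n - 1) \<star> d n = zer (G n) (G (n - 2))" for n by (rule cyclesD(4)[OF c])
    show "\<exists>J p i. \<forall>n. adm_epi C (G n) (p n) (J (n - 1)) \<and> adm_mono C (J n) (i n) (G n) \<and>
        d n = i (n - 1) \<star> p n \<and> Ses C (J n) (i n) (G n) (p n) (J (n - 1))"
      using cyclesD(1,2)[OF c] by (intro exI[of _ J] exI[of _ p] exI[of _ i]) (auto intro: adm_monoI adm_epiI)
  qed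
qed

lemma acyclicD:
  assumes "acyclic_complex C G d"
  shows "G n \<in> Obj C" "d n \<in> mor (G n) (G (n - 1))" "d (n - 1) \<star> d n = zer (G n) (G (n - 2))"
    "bounded_gr G"
  using assms by (auto simp: acyclic_complex_def chain_complex_def bounded_gr_def mor_def)

section \<open>Operations on acyclic complexes\<close>

lemma supported_iso:
  assumes "supported_on C G S" "\<And>n. iso (G' n) (G n)"
  shows "supported_on C G' S"
  using assms zero_object_iso by (auto simp: supported_on_def)

lemma bounded_gr_iso: "bounded_gr G \<Longrightarrow> (\<And>n. iso (G' n) (G n)) \<Longrightarrow> bounded_gr G'"
  unfolding bounded_gr_def using supported_iso by blast

lemma bounded_gr_prd: "bounded_gr G \<Longrightarrow> bounded_gr G' \<Longrightarrow> bounded_gr (\<lambda>n. G n \<boxplus> G' n)"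
proof -
  assume a: "bounded_gr G" "bounded_gr G'"
  then obtain b b' where b: "supported_on C G {..b}" "supported_on C G' {..b'}"
    by (auto simp: bounded_gr_def)
  have "supported_on C (\<lambda>n. G n \<boxplus> G' n) {..max b b'}"
    using b by (auto simp: supported_on_def intro!: zero_object_prd)
  moreover have "supported_on C (\<lambda>n. G n \<boxplus> G' n) {0..}"
    using a by (auto simp: supported_on_def bounded_gr_def intro!: zero_object_prd)
  ultimately show ?thesis unfolding bounded_gr_def by blast
qed

lemma bounded_gr_shift:
  assumes "bounded_gr G" "supported_on C G {c..}"
  shows "bounded_gr (\<lambda>n. G (n + c))"
proof -
  obtain b where "supported_on C G {..b}" using assms by (auto simp: bounded_gr_def)
  then have "supported_on C (\<lambda>n. G (n + c)) {..b - c}" by (auto simp: supported_on_def)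
  moreover have "supported_on C (\<lambda>n. G (n + c)) {0..}" using assms(2) by (auto simp: supported_on_def)
  ultimately show ?thesis unfolding bounded_gr_def by blast
qed

lemma acyclic_shift:
  assumes "acyclic_complex C G d" "supported_on C G {c..}"
  shows "acyclic_complex C (\<lambda>n. G (n + c)) (\<lambda>n. d (n + c))"
proof -
  obtain J p i where c: "cycles G d J p i" using assms(1) by (auto simp: acyclic_iff)
  have 1: "n - 1 + c = n + c - 1" for n by simp
  have "cycles (\<lambda>n. G (n + c)) (\<lambda>n. d (n + c)) (\<lambda>n. J (n + c)) (\<lambda>n. p (n + c)) (\<lambda>n. i (n + c))"
    unfolding cycles_def 1 using cyclesD(1,2)[OF c] by blast
  then show ?thesis using bounded_gr_shift[OF _ assms(2)] assms(1) by (auto simp: acyclic_iff)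
qed

text \<open>The cycle objects stay the same; only their embeddings and projections are composed with
  the isomorphisms.\<close>

lemma acyclic_transport:
  assumes a: "acyclic_complex C G d" and inv: "\<And>n. inverses (G n) (\<theta> n) (G' n) (\<theta>' n)"
    and d': "\<And>n. d' n \<in> mor (G' n) (G' (n - 1))" and c: "\<And>n. \<theta> (n - 1) \<star> d n = d' n \<star> \<theta> n"
  shows "acyclic_complex C G' d'"
proof -
  obtain J p i where cy: "cycles G d J p i" using a by (auto simp: acyclic_iff)
  note s = cyclesD(1)[OF cy]
  have m: "\<theta> n \<in> mor (G n) (G' n)" "\<theta>' n \<in> mor (G' n) (G n)" for n
    using inv[of n] by (auto simp: inverses_def)
  have "cycles G' d' J (\<lambda>n. p n \<star> \<theta>' n) (\<lambda>n. \<theta> n \<star> i n)"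
    unfolding cycles_def
  proof (intro allI conjI)
    fix n
    note p = SesD(2)[OF s[of n]] and i = SesD(1)[OF s[of n]] and i1 = SesD(1)[OF s[of "n - 1"]]
    note ti = comp_mor[OF m(1) i] and pt = comp_mor[OF p m(2)]
    show "Ses C (J n) (\<theta> n \<star> i n) (G' n) (p n \<star> \<theta>' n) (J (n - 1))"
      using id_right[OF ti] id_left[OF p] cancel_inv_right[OF inverses_sym[OF inv[of n]] p]
      by (intro Ses_transport[OF s inverses_id[OF SesD(4)[OF s[of n]]] inv
            inverses_id[OF SesD(6)[OF s[of n]]] ti pt]) simp_all
    have "d' n = d' n \<star> \<theta> n \<star> \<theta>' n"
      using cancel_inv_right[OF inv[of n] d'] by simp
    also have "\<dots> = \<theta> (n - 1) \<star> (i (n - 1) \<star> p n) \<star> \<theta>' n"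
      by (simp only: c[symmetric] cyclesD(2)[OF cy, of n])
    also have "\<dots> = \<theta> (n - 1) \<star> i (n - 1) \<star> (p n \<star> \<theta>' n)"
      unfolding assoc[OF m(1) i1 p, symmetric] assoc[OF comp_mor[OF m(1) i1] p m(2)] ..
    finally show "d' n = \<theta> (n - 1) \<star> i (n - 1) \<star> (p n \<star> \<theta>' n)" .
  qed
  moreover have "bounded_gr G'"
    using bounded_gr_iso[OF acyclicD(4)[OF a], of G'] inverses_sym[OF inv] unfolding iso_def by blast
  ultimately show ?thesis by (auto simp: acyclic_iff)
qed

lemma acyclic_dsum:
  assumes "acyclic_complex C G d" "acyclic_complex C G' d'"
  shows "acyclic_complex C (\<lambda>n. G n \<boxplus> G' n) (\<lambda>n. dsum (G n) (G' n) (G (n - 1)) (G' (n - 1)) (d n) (d' n))"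
proof -
  obtain J p i where c: "cycles G d J p i" using assms by (auto simp: acyclic_iff)
  obtain J' p' i' where c': "cycles G' d' J' p' i'" using assms by (auto simp: acyclic_iff)
  note s = cyclesD(1)[OF c] and s' = cyclesD(1)[OF c']
  have "cycles (\<lambda>n. G n \<boxplus> G' n) (\<lambda>n. dsum (G n) (G' n) (G (n - 1)) (G' (n - 1)) (d n) (d' n)) (\<lambda>n. J n \<boxplus> J' n)
     (\<lambda>n. dsum (G n) (G' n) (J (n - 1)) (J' (n - 1)) (p n) (p' n)) (\<lambda>n. dsum (J n) (J' n) (G n) (G' n) (i n) (i' n))"
    unfolding cycles_def cyclesD(2)[OF c] cyclesD(2)[OF c']
    using Ses_dsum[OF s s'] dsum_dsum[OF SesD(2)[OF s] SesD(2)[OF s'] SesD(1)[OF s] SesD(1)[OF s']]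
    by simp
  then show ?thesis using assms bounded_gr_prd by (auto simp: acyclic_iff)
qed

text \<open>
  The isomorphism \<open>\<phi>\<close> from \<open>(G', e)\<close> to \<open>(G, d)\<close> anticommutes with the differentials, so that no
  signs occur in the differential of the cone.  Only \<open>d\<close> is required to square to zero, not to be
  exact: the definition has to apply to brutal truncations.
\<close>

definition cone_data :: "(int \<Rightarrow> 'a) \<Rightarrow> (int \<Rightarrow> 'b) \<Rightarrow> (int \<Rightarrow> 'a) \<Rightarrow> (int \<Rightarrow> 'b) \<Rightarrow> (int \<Rightarrow> 'b) \<Rightarrow> (int \<Rightarrow> 'b) \<Rightarrow> bool" where
  "cone_data G d G' e \<phi> \<psi> \<longleftrightarrow> (\<forall>n. d n \<in> mor (G n) (G (n - 1)) \<and> d (n - 1) \<star> d n = zer (G n) (G (n - 2)) \<and>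
     e n \<in> mor (G' n) (G' (n - 1)) \<and> inverses (G' n) (\<phi> n) (G n) (\<psi> n) \<and>
     d n \<star> \<phi> n \<oplus>\<^sub>m \<phi> (n - 1) \<star> e n = zer (G' n) (G (n - 1)))"

definition cone_gr :: "(int \<Rightarrow> 'a) \<Rightarrow> (int \<Rightarrow> 'a) \<Rightarrow> int \<Rightarrow> 'a" where
  "cone_gr G G' n = G n \<boxplus> G' (n - 1)"

text \<open>Rows \<open>(d, \<phi>)\<close> and \<open>(0, e)\<close>. The summand \<open>G'\<close>
  enters with its degrees raised by one, hence the index \<open>n - 1\<close> at
  \<open>\<phi>\<close> and \<open>e\<close>.\<close>

definition cone_d :: "(int \<Rightarrow> 'a) \<Rightarrow> (int \<Rightarrow> 'b) \<Rightarrow> (int \<Rightarrow> 'a) \<Rightarrow> (int \<Rightarrow> 'b) \<Rightarrow> (int \<Rightarrow> 'b) \<Rightarrow> int \<Rightarrow> 'b" where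
  "cone_d G d G' e \<phi> n =
     mat (G n) (G' (n - 1)) (G (n - 1)) (G' (n - 2)) (d n) (\<phi> (n - 1)) (zer (G n) (G' (n - 2))) (e (n - 1))"

lemma cone_dataD:
  assumes "cone_data G d G' e \<phi> \<psi>"
  shows "d n \<in> mor (G n) (G (n - 1))" "d (n - 1) \<star> d n = zer (G n) (G (n - 2))"
    "e n \<in> mor (G' n) (G' (n - 1))" "inverses (G' n) (\<phi> n) (G n) (\<psi> n)"
    "d n \<star> \<phi> n \<oplus>\<^sub>m \<phi> (n - 1) \<star> e n = zer (G' n) (G (n - 1))"
    "G n \<in> Obj C" "G' n \<in> Obj C" "\<phi> n \<in> mor (G' n) (G n)" "\<psi> n \<in> mor (G n) (G' n)"
    "e (n - 1) \<in> mor (G' (n - 1)) (G' (n - 2))" "d (n - 1) \<in> mor (G (n - 1)) (G (n - 2))"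
proof -
  show "d n \<in> mor (G n) (G (n - 1))" "d (n - 1) \<star> d n = zer (G n) (G (n - 2))"
    "e n \<in> mor (G' n) (G' (n - 1))" "inverses (G' n) (\<phi> n) (G n) (\<psi> n)"
    "d n \<star> \<phi> n \<oplus>\<^sub>m \<phi> (n - 1) \<star> e n = zer (G' n) (G (n - 1))" for n
    using assms by (auto simp: cone_data_def)
  from this(3)[of "n - 1"] this(1)[of "n - 1"]
  show "e (n - 1) \<in> mor (G' (n - 1)) (G' (n - 2))" "d (n - 1) \<in> mor (G (n - 1)) (G (n - 2))"
    by simp_all
  show m: "\<phi> n \<in> mor (G' n) (G n)" "\<psi> n \<in> mor (G n) (G' n)"
    using \<open>inverses (G' n) (\<phi> n) (G n) (\<psi> n)\<close> by (auto simp: inverses_def)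
  show "G n \<in> Obj C" "G' n \<in> Obj C" using m by (simp_all add: mor_def)
qed

lemma cone_d_mor:
  assumes "cone_data G d G' e \<phi> \<psi>"
  shows "cone_d G d G' e \<phi> n \<in> mor (cone_gr G G' n) (cone_gr G G' (n - 1))"
proof -
  note c = cone_dataD[OF assms]
  have "n - 1 - 1 = n - 2" by simp
  then show ?thesis
    unfolding cone_d_def cone_gr_def
    using mat_mor[OF c(1)[of n] c(8)[of "n - 1"] zer_mor[OF c(6)[of n] c(7)[of "n - 2"]] c(10)[of n]] by simp
qed

lemma cone_inl:
  "cone_data G d G' e \<phi> \<psi> \<Longrightarrow> cone_d G d G' e \<phi> n \<star> inl (G n) (G' (n - 1)) = inl (G (n - 1)) (G' (n - 2)) \<star> d n"
  and cone_pr2: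
  "cone_data G d G' e \<phi> \<psi> \<Longrightarrow> pr2 (G (n - 1)) (G' (n - 2)) \<star> cone_d G d G' e \<phi> n = e (n - 1) \<star> pr2 (G n) (G' (n - 1))"
  unfolding cone_d_def
  by (rule mat_zer_lower[OF cone_dataD(1) cone_dataD(8) cone_dataD(10)]; assumption)+

lemma cone_cycles:
  assumes "cone_data G d G' e \<phi> \<psi>"
  shows "\<exists>p i. cycles (cone_gr G G') (cone_d G d G' e \<phi>) G p i"
proof -
  note c = cone_dataD[OF assms]
  \<comment> \<open>The kernel of the differential of the cone is the graph of \<open>h = - \<psi> d\<close>, hence a copy of \<open>G\<close>.\<close>
  define h where "h n = neg (G n) (G' (n - 1)) (\<psi> (n - 1) \<star> d n)" for n
  define i where "i n = col (G n) (G' (n - 1)) (Ident C (G n)) (h n)" for n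
  define p where "p n = row (G n) (G' (n - 1)) (d n) (\<phi> (n - 1))" for n
  have psd: "\<psi> (n - 1) \<star> d n \<in> mor (G n) (G' (n - 1))" for n
    using comp_mor[OF c(9) c(1)] .
  have h: "h n \<in> mor (G n) (G' (n - 1))" for n unfolding h_def using psd by simp
  have i: "i n \<in> mor (G n) (G n \<boxplus> G' (n - 1))" for n unfolding i_def using c h by simp
  have p: "p n \<in> mor (G n \<boxplus> G' (n - 1)) (G (n - 1))" for n unfolding p_def using c by simp
  have ph: "\<phi> (n - 1) \<star> h n = neg (G n) (G (n - 1)) (d n)" for n
    unfolding h_def neg_comp_right[OF c(8) psd]
    using cancel_inv_left[OF inverses_sym[OF c(4)] c(1)] by simp
  have "Ses C (G n) (i n) (G n \<boxplus> G' (n - 1)) (p n) (G (n - 1))" for n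
  proof -
    \<comment> \<open>\<open>b x\<close> is a shear, and the shear by the negative of
      \<open>x\<close> inverts it. For \<open>x = h n\<close> it carries the split sequence of the
      two summands to the desired one, the quotient \<open>G' (n - 1)\<close> being identified with
      \<open>G (n - 1)\<close> by \<open>\<phi>\<close>.\<close>
    define b where "b x = mat (G n) (G' (n - 1)) (G n) (G' (n - 1)) (Ident C (G n)) (zer (G' (n - 1)) (G n)) x
      (Ident C (G' (n - 1)))" for x
    note z = zer_mor[OF c(7) c(6), of "n - 1" n]
    have bb: "b x \<star> b y = Ident C (G n \<boxplus> G' (n - 1))"
      if x: "x \<in> mor (G n) (G' (n - 1))" and y: "y \<in> mor (G n) (G' (n - 1))"
        and xy: "x \<oplus>\<^sub>m y = zer (G n) (G' (n - 1))" for x y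
      unfolding b_def mat_mat[OF id_mor[OF c(6)] z y id_mor[OF c(7)] id_mor[OF c(6)] z x id_mor[OF c(7)]]
      using x y xy c
      by (simp add: mat_id plus_zer[OF id_mor] zer_plus[OF id_mor] comp_zer[OF c(7) x] zer_comp[OF c(6) y]
        id_left[OF z] id_right[OF z] id_left[OF id_mor[OF c(6)[of n]]]
        id_left[OF id_mor[OF c(7)[of "n - 1"]]] id_left[OF y] id_right[OF x]
        zer_comp[OF c(7) zer_mor] comp_zer[OF c(7) z] zer_comp[OF c(6) y])
    have inv: "inverses (G n \<boxplus> G' (n - 1)) (b (h n)) (G n \<boxplus> G' (n - 1)) (b (neg (G n) (G' (n - 1)) (h n)))"
      unfolding inverses_def using bb[OF h neg_mor[OF h] plus_neg[OF h]] bb[OF neg_mor[OF h] h neg_plus[OF h]]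
        h[of n] c z by (simp add: b_def)
    have 1: "b (h n) \<star> inl (G n) (G' (n - 1)) = i n \<star> Ident C (G n)"
      unfolding b_def id_right[OF i] unfolding i_def using h[of n] c z by simp
    have "p n \<star> b (h n) = row (G n) (G' (n - 1)) (zer (G n) (G (n - 1))) (\<phi> (n - 1))"
      unfolding b_def p_def row_mat[OF id_mor[OF c(6)] z h id_mor[OF c(7)] c(1) c(8)] ph
      using c by (simp add: plus_neg[OF c(1)] id_right[OF c(1)] id_right[OF c(8)] comp_zer[OF c(7) c(1)]
        zer_plus[OF c(8)])
    also have "\<dots> = \<phi> (n - 1) \<star> pr2 (G n) (G' (n - 1))"
      unfolding row_zer_id[OF c(6)[of n] c(7)[of "n - 1"], symmetric]
        comp_row[OF zer_mor[OF c(6,7)] id_mor[OF c(7)] c(8)]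
      using c by (simp add: id_right[OF c(8)] comp_zer[OF c(6) c(8)])
    finally have 2: "\<phi> (n - 1) \<star> pr2 (G n) (G' (n - 1)) = p n \<star> b (h n)" ..
    show ?thesis
      by (rule Ses_transport[OF Ses_inl_pr2[OF c(6,7)] inverses_id[OF c(6)] inv c(4) i p 1 2])
  qed
  moreover have "cone_d G d G' e \<phi> n = i (n - 1) \<star> p n" for n
  proof (rule ext_into[OF c(6)[of "n - 1"] c(7)[of "n - 2"]])
    have 2: "n - 1 - 1 = n - 2" by simp
    note pm = p[of n]
    have h1: "h (n - 1) \<in> mor (G (n - 1)) (G' (n - 2))" using h[of "n - 1"] unfolding 2 .
    have im: "i (n - 1) \<in> mor (G (n - 1)) (G (n - 1) \<boxplus> G' (n - 2))" using i[of "n - 1"] unfolding 2 .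
    note I = id_mor[OF c(6)[of "n - 1"]]
    show "cone_d G d G' e \<phi> n \<in> mor (G n \<boxplus> G' (n - 1)) (G (n - 1) \<boxplus> G' (n - 2))"
      using cone_d_mor[OF assms, of n] unfolding cone_gr_def 2 .
    show "i (n - 1) \<star> p n \<in> mor (G n \<boxplus> G' (n - 1)) (G (n - 1) \<boxplus> G' (n - 2))"
      using comp_mor[OF im pm] .
    note o = c(6)[of "n - 1"] c(7)[of "n - 2"]
    have q: "pr1 (G (n - 1)) (G' (n - 2)) \<star> i (n - 1) = Ident C (G (n - 1))"
      "pr2 (G (n - 1)) (G' (n - 2)) \<star> i (n - 1) = h (n - 1)"
      unfolding i_def 2 using I h1 by simp_all
    show "pr1 (G (n - 1)) (G' (n - 2)) \<star> cone_d G d G' e \<phi> n = pr1 (G (n - 1)) (G' (n - 2)) \<star> (i (n - 1) \<star> p n)"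
      unfolding assoc[OF pr1_mor[OF o] im pm, symmetric] q id_left[OF pm]
      unfolding cone_d_def p_def using c c(10)[of n] by simp
    have pd1: "\<psi> (n - 2) \<star> d (n - 1) \<in> mor (G (n - 1)) (G' (n - 2))" using psd[of "n - 1"] unfolding 2 .
    have hh: "h (n - 1) = neg (G (n - 1)) (G' (n - 2)) (\<psi> (n - 2) \<star> d (n - 1))" unfolding h_def 2 ..
    \<comment> \<open>This is - \<open>\<psi>\<close> \<open>d\<close> \<open>d\<close>, and
      \<open>d\<close> has square zero.\<close>
    have hd: "h (n - 1) \<star> d n = zer (G n) (G' (n - 2))"
    proof -
      have "(\<psi> (n - 2) \<star> d (n - 1)) \<star> d n = zer (G n) (G' (n - 2))"
        unfolding assoc[OF c(9) c(11) c(1)] c(2) by (rule comp_zer[OF c(6) c(9)])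
      then show ?thesis
        unfolding hh neg_comp_left[OF pd1 c(1)]
        using neg_mor[OF zer_mor[OF c(6)[of n] c(7)[of "n - 2"]]] plus_neg[OF zer_mor[OF c(6)[of n] c(7)[of "n - 2"]]]
        by simp
    qed
    \<comment> \<open>By anticommutation, - \<open>\<psi>\<close> \<open>d\<close>
      \<open>\<phi>\<close> is \<open>\<psi>\<close> \<open>\<phi>\<close> \<open>e\<close>, which
      is \<open>e\<close>.\<close>
    have hp: "h (n - 1) \<star> \<phi> (n - 1) = e (n - 1)"
    proof -
      have dp: "d (n - 1) \<star> \<phi> (n - 1) \<in> mor (G' (n - 1)) (G (n - 2))" by (rule comp_mor[OF c(11) c(8)])
      have pe: "\<phi> (n - 2) \<star> e (n - 1) \<in> mor (G' (n - 1)) (G (n - 2))" by (rule comp_mor[OF c(8) c(10)])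
      have "d (n - 1) \<star> \<phi> (n - 1) \<oplus>\<^sub>m \<phi> (n - 2) \<star> e (n - 1) = zer (G' (n - 1)) (G (n - 2))"
        using c(5)[of "n - 1"] unfolding 2 .
      from plus_eq_zer[OF dp pe this]
      have *: "neg (G' (n - 1)) (G (n - 2)) (d (n - 1) \<star> \<phi> (n - 1)) = \<phi> (n - 2) \<star> e (n - 1)" ..
      have "h (n - 1) \<star> \<phi> (n - 1) = \<psi> (n - 2) \<star> neg (G' (n - 1)) (G (n - 2)) (d (n - 1) \<star> \<phi> (n - 1))"
        unfolding hh neg_comp_left[OF pd1 c(8)] assoc[OF c(9) c(11) c(8)] neg_comp_right[OF c(9) dp] ..
      then show ?thesis unfolding * cancel_inv_left[OF c(4) c(10)] .
    qed
    show "pr2 (G (n - 1)) (G' (n - 2)) \<star> cone_d G d G' e \<phi> n = pr2 (G (n - 1)) (G' (n - 2)) \<star> (i (n - 1) \<star> p n)"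
      unfolding assoc[OF pr2_mor[OF o] im pm, symmetric] q
      unfolding cone_d_def p_def comp_row[OF c(1) c(8) h1] hd hp using c c(10)[of n] by simp
  qed
  ultimately have "cycles (cone_gr G G') (cone_d G d G' e \<phi>) G p i"
    unfolding cycles_def cone_gr_def by blast
  then show ?thesis by blast
qed

lemma cone_acyclic:
  assumes c: "cone_data G d G' e \<phi> \<psi>" and b: "bounded_gr G"
  shows "acyclic_complex C (cone_gr G G') (cone_d G d G' e \<phi>)"
proof -
  have i: "iso (G' n) (G n)" for n using cone_dataD(4)[OF c] by (auto simp: iso_def)
  have "bounded_gr G'" using bounded_gr_iso[OF b i] .
  moreover from this obtain k where "supported_on C G' {..k}" by (auto simp: bounded_gr_def)
  then have "supported_on C (\<lambda>n. G' (n + - 1)) {..k + 1}" by (auto simp: supported_on_def)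
  ultimately have "bounded_gr (\<lambda>n. G' (n + - 1))"
    by (auto simp: bounded_gr_def supported_on_def)
  from bounded_gr_prd[OF b this] have "bounded_gr (cone_gr G G')" by (simp add: cone_gr_def[abs_def])
  then show ?thesis using cone_cycles[OF c] by (auto simp: acyclic_iff)
qed

text \<open>Functoriality of the cone, to be applied to the maps between truncations.\<close>

lemma cone_map:
  assumes c: "cone_data G d G' e \<phi> \<psi>" and c2: "cone_data H f H' g \<phi>2 \<psi>2"
    and u: "\<And>n. u n \<in> mor (G n) (H n)" and v: "\<And>n. v n \<in> mor (G' n) (H' n)"
    and "\<And>n. u (n - 1) \<star> d n = f n \<star> u n" "\<And>n. v (n - 1) \<star> e n = g n \<star> v n"
    and "\<And>n. u n \<star> \<phi> n = \<phi>2 n \<star> v n"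
  shows "dsum (G (n - 1)) (G' (n - 2)) (H (n - 1)) (H' (n - 2)) (u (n - 1)) (v (n - 2)) \<star> cone_d G d G' e \<phi> n =
    cone_d H f H' g \<phi>2 n \<star> dsum (G n) (G' (n - 1)) (H n) (H' (n - 1)) (u n) (v (n - 1))"
proof -
  note c = cone_dataD[OF c] and c2 = cone_dataD[OF c2]
  have 2: "n - 1 - 1 = n - 2" by simp
  have "v (n - 2) \<star> e (n - 1) = g (n - 1) \<star> v (n - 1)" using assms(6)[of "n - 1"] unfolding 2 .
  then show ?thesis
    unfolding cone_d_def dsum_mat[OF u v c(1) c(8) zer_mor[OF c(6,7)] c(10)]
      mat_dsum[OF u v c2(1) c2(8) zer_mor[OF c2(6,7)] c2(10)]
    using assms(5,7) by (simp add: comp_zer[OF c(6) v] zer_comp[OF c2(7) u])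
qed

section \<open>Brutal truncations\<close>

definition res_gr :: "int set \<Rightarrow> (int \<Rightarrow> 'a) \<Rightarrow> int \<Rightarrow> 'a" where
  "res_gr S G n = (if n \<in> S then G n else Zob)"

definition res_d :: "int set \<Rightarrow> (int \<Rightarrow> 'a) \<Rightarrow> (int \<Rightarrow> 'b) \<Rightarrow> int \<Rightarrow> 'b" where
  "res_d S G d n = (if n \<in> S \<and> n - 1 \<in> S then d n else zer (res_gr S G n) (res_gr S G (n - 1)))"

definition res_map :: "int set \<Rightarrow> (int \<Rightarrow> 'b) \<Rightarrow> int \<Rightarrow> 'b" where
  "res_map S \<phi> n = (if n \<in> S then \<phi> n else zer Zob Zob)"

lemma res_d_mor:
  assumes "\<And>n. d n \<in> mor (G n) (G (n - 1))" shows "res_d S G d n \<in> mor (res_gr S G n) (res_gr S G (n - 1))"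
proof -
  have "G n \<in> Obj C" for n using assms by (rule morD)
  then show ?thesis using assms by (simp add: res_d_def res_gr_def)
qed

text \<open>The conditions survive for every \<open>S\<close>: a composite of truncated maps is
  either the old one or has a zero factor.\<close>

lemma res_cone_data:
  assumes "cone_data G d G' e \<phi> \<psi>"
  shows "cone_data (res_gr S G) (res_d S G d) (res_gr S G') (res_d S G' e) (res_map S \<phi>) (res_map S \<psi>)"
  unfolding cone_data_def
proof (intro allI conjI)
  note c = cone_dataD[OF assms]
  have o: "res_gr S G n \<in> Obj C" "res_gr S G' n \<in> Obj C" for n
    using c(6,7) by (simp_all add: res_gr_def)
  fix n :: int
  have 2: "n - 1 - 1 = n - 2" by simp
  show d: "res_d S G d n \<in> mor (res_gr S G n) (res_gr S G (n - 1))"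
    and e: "res_d S G' e n \<in> mor (res_gr S G' n) (res_gr S G' (n - 1))" for n
    using c(1,3) res_d_mor by blast+
  show inv: "inverses (res_gr S G' n) (res_map S \<phi> n) (res_gr S G n) (res_map S \<psi> n)" for n
    using c(4) zero_object_inverses[OF Zob Zob] by (simp add: res_gr_def res_map_def)
  have phi: "res_map S \<phi> n \<in> mor (res_gr S G' n) (res_gr S G n)" for n
    using inv by (auto simp: inverses_def)
  show "res_d S G d (n - 1) \<star> res_d S G d n = zer (res_gr S G n) (res_gr S G (n - 2))"
  proof (cases "n \<in> S \<and> n - 1 \<in> S \<and> n - 2 \<in> S")
    case True
    then show ?thesis using c(2)[of n] by (simp add: res_d_def res_gr_def)
  next
    case False
    have "res_d S G d n = zer (res_gr S G n) (res_gr S G (n - 1)) \<or>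
      res_d S G d (n - 1) = zer (res_gr S G (n - 1)) (res_gr S G (n - 2))"
      using False unfolding res_d_def 2 by auto
    then show ?thesis
      using zer_comp[OF o(1) d] comp_zer[OF o(1) d[of "n - 1"]] unfolding 2 by metis
  qed
  show "res_d S G d n \<star> res_map S \<phi> n \<oplus>\<^sub>m res_map S \<phi> (n - 1) \<star> res_d S G' e n = zer (res_gr S G' n) (res_gr S G (n - 1))"
  proof (cases "n \<in> S \<and> n - 1 \<in> S")
    case True
    then show ?thesis using c(5)[of n] by (simp add: res_d_def res_gr_def res_map_def)
  next
    case False
    then have "res_d S G d n = zer (res_gr S G n) (res_gr S G (n - 1))"
      "res_d S G' e n = zer (res_gr S G' n) (res_gr S G' (n - 1))" by (auto simp: res_d_def)
    then show ?thesis
      using o by (simp add: zer_comp[OF o(1) phi] comp_zer[OF o(2) phi])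
  qed
qed

text \<open>One formula serves as the inclusion when \<open>S\<close> lies in \<open>S'\<close> and
  as the projection when \<open>S'\<close> lies in \<open>S\<close>.\<close>

definition res_in :: "int set \<Rightarrow> int set \<Rightarrow> (int \<Rightarrow> 'a) \<Rightarrow> int \<Rightarrow> 'b" where
  "res_in S S' G n = (if n \<in> S \<inter> S' then Ident C (G n) else zer (res_gr S G n) (res_gr S' G n))"

lemma res_in_mor: "(\<And>n. G n \<in> Obj C) \<Longrightarrow> res_in S S' G n \<in> mor (res_gr S G n) (res_gr S' G n)"
  by (simp add: res_in_def res_gr_def)

text \<open>The left composite is \<open>d n\<close> when \<open>n\<close> and \<open>n - 1\<close>
  lie in \<open>S\<close> and \<open>n - 1\<close> lies in \<open>S'\<close>; the right one is
  \<open>d n\<close> when \<open>n\<close> lies in both sets and \<open>n - 1\<close> in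
  \<open>S'\<close>. Otherwise they vanish, and \<open>cl\<close> makes the two conditions
  agree.\<close>

lemma res_in_d:
  assumes d: "\<And>n. d n \<in> mor (G n) (G (n - 1))"
    and cl: "\<And>n. n \<in> S \<Longrightarrow> n - 1 \<in> S' \<Longrightarrow> n - 1 \<in> S \<longleftrightarrow> n \<in> S'"
  shows "res_in S S' G (n - 1) \<star> res_d S G d n = res_d S' G d n \<star> res_in S S' G n"
proof -
  have G: "G n \<in> Obj C" for n using d by (rule morD)
  have o: "res_gr S G n \<in> Obj C" "res_gr S' G n \<in> Obj C" for n using G by (simp_all add: res_gr_def)
  have rd: "res_d S G d n \<in> mor (res_gr S G n) (res_gr S G (n - 1))"
    "res_d S' G d n \<in> mor (res_gr S' G n) (res_gr S' G (n - 1))" using res_d_mor d by blast+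
  have ri: "res_in S S' G n \<in> mor (res_gr S G n) (res_gr S' G n)" for n using res_in_mor G by blast
  let ?z = "zer (res_gr S G n) (res_gr S' G (n - 1))"
  have l: "res_in S S' G (n - 1) \<star> res_d S G d n = (if n \<in> S \<and> n - 1 \<in> S \<and> n - 1 \<in> S' then d n else ?z)"
  proof (cases "n \<in> S \<and> n - 1 \<in> S \<and> n - 1 \<in> S'")
    case True
    then show ?thesis using id_left[OF d[of n]] by (simp add: res_d_def res_in_def)
  next
    case False
    then have "res_d S G d n = zer (res_gr S G n) (res_gr S G (n - 1)) \<or>
      res_in S S' G (n - 1) = zer (res_gr S G (n - 1)) (res_gr S' G (n - 1))"
      unfolding res_d_def res_in_def by auto
    then show ?thesis
      using zer_comp[OF o(2) rd(1)] comp_zer[OF o(1) ri] False by metis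
  qed
  have r: "res_d S' G d n \<star> res_in S S' G n = (if n \<in> S \<and> n \<in> S' \<and> n - 1 \<in> S' then d n else ?z)"
  proof (cases "n \<in> S \<and> n \<in> S' \<and> n - 1 \<in> S'")
    case True
    then show ?thesis using id_right[OF d[of n]] by (simp add: res_d_def res_in_def)
  next
    case False
    then have "res_d S' G d n = zer (res_gr S' G n) (res_gr S' G (n - 1)) \<or>
      res_in S S' G n = zer (res_gr S G n) (res_gr S' G n)"
      unfolding res_d_def res_in_def by auto
    then show ?thesis
      using zer_comp[OF o(2) ri] comp_zer[OF o(1) rd(2)] False by metis
  qed
  show ?thesis unfolding l r using cl by auto
qed

lemma res_in_map:
  assumes phi: "\<And>n. \<phi> n \<in> mor (G' n) (G n)"
  shows "res_in S S' G n \<star> res_map S \<phi> n = res_map S' \<phi> n \<star> res_in S S' G' n"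
proof -
  have o: "G n \<in> Obj C" "G' n \<in> Obj C" using phi[of n] by (simp_all add: mor_def)
  note z = zer_mor[OF Zob_Obj Zob_Obj]
  show ?thesis
    using phi[of n] id_left[OF phi[of n]] id_right[OF phi[of n]] o
      comp_zer[OF o(2) z] zer_comp[OF Zob_Obj phi[of n]] comp_zer[OF Zob_Obj phi[of n]]
      comp_zer[OF Zob_Obj z] zer_comp[OF o(1) z]
    by (auto simp: res_in_def res_map_def res_gr_def)
qed

text \<open>In each degree one outer term is \<open>Zob\<close> and the other equals the middle
  term.\<close>

lemma res_Ses:
  assumes G: "\<And>n. G n \<in> Obj C" and S: "S \<inter> S'' = {}" "S' = S \<union> S''"
  shows "Ses C (res_gr S G n) (res_in S S' G n) (res_gr S' G n) (res_in S' S'' G n) (res_gr S'' G n)"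
proof -
  have "n \<in> S \<and> n \<notin> S'' \<or> n \<in> S'' \<and> n \<notin> S \<or> n \<notin> S \<and> n \<notin> S''" using S by auto
  then show ?thesis
    using Ses_id_zer[OF Zob G] Ses_zer_id[OF Zob G] Ses_id_zer[OF Zob Zob_Obj] S
    by (auto simp: res_gr_def res_in_def Ident_Zob)
qed

lemma res_UNIV [simp]: "res_gr UNIV G = G" "res_d UNIV G d = d" "res_map UNIV \<phi> = \<phi>"
  by (auto simp: fun_eq_iff res_gr_def res_d_def res_map_def)

lemma bounded_res_gr: "bounded_gr G \<Longrightarrow> bounded_gr (res_gr S G)"
  using Zob by (auto simp: bounded_gr_def supported_on_def res_gr_def)

section \<open>Binary complexes built from two cones\<close>

definition bcone where
  "bcone G d d' G' e e' \<phi> \<phi>' = \<lparr>gr = cone_gr G G', dtop = cone_d G d G' e \<phi>, dbot = cone_d G d' G' e' \<phi>'\<rparr>"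

lemma bcone_acyclic:
  "cone_data G d G' e \<phi> \<psi> \<Longrightarrow> cone_data G d' G' e' \<phi>' \<psi>' \<Longrightarrow> bounded_gr G \<Longrightarrow>
    binary_acyclic C (bcone G d d' G' e e' \<phi> \<phi>')"
  by (auto simp: binary_acyclic_def bcone_def cone_acyclic)

lemma Ses_BqI:
  assumes "binary_acyclic C X" "binary_acyclic C Y" "binary_acyclic C Z"
    and s: "\<And>n. Ses C (gr X n) (i n) (gr Y n) (p n) (gr Z n)"
    and "\<And>n. i (n - 1) \<star> dtop X n = dtop Y n \<star> i n" "\<And>n. i (n - 1) \<star> dbot X n = dbot Y n \<star> i n"
    and "\<And>n. p (n - 1) \<star> dtop Y n = dtop Z n \<star> p n" "\<And>n. p (n - 1) \<star> dbot Y n = dbot Z n \<star> p n"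
  shows "Ses (Bq C) X i Y p Z"
  using assms morD(1)[OF SesD(1)[OF s]] morD(1)[OF SesD(2)[OF s]]
  by (auto simp: Bq_def binary_chain_maps_def)

text \<open>\<open>shiftb (- 1)\<close> raises all degrees by one, \<open>shiftb 1\<close> lowers
  them.\<close>

definition shiftb :: "int \<Rightarrow> ('a, 'b) bicomplex \<Rightarrow> ('a, 'b) bicomplex" where
  "shiftb c X = \<lparr>gr = \<lambda>n. gr X (n + c), dtop = \<lambda>n. dtop X (n + c), dbot = \<lambda>n. dbot X (n + c)\<rparr>"

lemma shiftb_acyclic: "binary_acyclic C X \<Longrightarrow> supported_on C (gr X) {c..} \<Longrightarrow> binary_acyclic C (shiftb c X)"
  by (simp add: binary_acyclic_def shiftb_def acyclic_shift)

lemma cone_Ses: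
  assumes c: "cone_data G d G' e \<phi> \<psi>" and c': "cone_data G d' G' e' \<phi>' \<psi>'"
    and X: "binary_acyclic C \<lparr>gr = G, dtop = d, dbot = d'\<rparr>"
    and Y: "binary_acyclic C \<lparr>gr = G', dtop = e, dbot = e'\<rparr>"
  shows "Ses (Bq C) \<lparr>gr = G, dtop = d, dbot = d'\<rparr> (\<lambda>n. inl (G n) (G' (n - 1)))
    (bcone G d d' G' e e' \<phi> \<phi>') (\<lambda>n. pr2 (G n) (G' (n - 1))) (shiftb (- 1) \<lparr>gr = G', dtop = e, dbot = e'\<rparr>)"
proof (rule Ses_BqI)
  have b: "bounded_gr G" using X by (auto simp: binary_acyclic_def dest: acyclicD(4))
  show "binary_acyclic C (bcone G d d' G' e e' \<phi> \<phi>')" by (rule bcone_acyclic[OF c c' b])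
  have "bounded_gr G'" using Y by (auto simp: binary_acyclic_def dest: acyclicD(4))
  then show "binary_acyclic C (shiftb (- 1) \<lparr>gr = G', dtop = e, dbot = e'\<rparr>)"
    by (intro shiftb_acyclic[OF Y]) (auto simp: bounded_gr_def supported_on_def)
  fix n :: int
  show "Ses C (gr \<lparr>gr = G, dtop = d, dbot = d'\<rparr> n) (inl (G n) (G' (n - 1))) (gr (bcone G d d' G' e e' \<phi> \<phi>') n)
      (pr2 (G n) (G' (n - 1))) (gr (shiftb (- 1) \<lparr>gr = G', dtop = e, dbot = e'\<rparr>) n)"
    using Ses_inl_pr2[OF cone_dataD(6)[OF c, of n] cone_dataD(7)[OF c, of "n - 1"]]
    by (simp add: bcone_def cone_gr_def shiftb_def)
qed (use X in \<open>simp_all add: bcone_def shiftb_def cone_inl[OF c] cone_inl[OF c'] cone_pr2[OF c] cone_pr2[OF c']\<close>)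

text \<open>The last condition on \<open>S\<close> says that no differential leads from
  \<open>S\<close> to \<open>S''\<close>, so the part over \<open>S\<close> is a subcomplex. It
  speaks of degrees only and therefore serves top and bottom at once.\<close>

lemma res_cone_Ses:
  assumes c: "cone_data G d G' e \<phi> \<psi>" and c': "cone_data G d' G' e' \<phi>' \<psi>'" and b: "bounded_gr G"
    and S: "S \<inter> S'' = {}" "S' = S \<union> S''" "\<And>n. n \<in> S \<Longrightarrow> n - 1 \<notin> S''"
  shows "\<exists>i p. Ses (Bq C)
    (bcone (res_gr S G) (res_d S G d) (res_d S G d') (res_gr S G') (res_d S G' e) (res_d S G' e') (res_map S \<phi>) (res_map S \<phi>')) i
    (bcone (res_gr S' G) (res_d S' G d) (res_d S' G d') (res_gr S' G') (res_d S' G' e) (res_d S' G' e') (res_map S' \<phi>) (res_map S' \<phi>')) p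
    (bcone (res_gr S'' G) (res_d S'' G d) (res_d S'' G d') (res_gr S'' G') (res_d S'' G' e) (res_d S'' G' e') (res_map S'' \<phi>) (res_map S'' \<phi>'))"
proof -
  define i where "i T T' n = dsum (res_gr T G n) (res_gr T G' (n - 1)) (res_gr T' G n) (res_gr T' G' (n - 1))
    (res_in T T' G n) (res_in T T' G' (n - 1))" for T T' and n :: int
  have chain: "i T T' (n - 1) \<star> cone_d (res_gr T G) (res_d T G d) (res_gr T G') (res_d T G' e) (res_map T \<phi>) n
    = cone_d (res_gr T' G) (res_d T' G d) (res_gr T' G') (res_d T' G' e) (res_map T' \<phi>) n \<star> i T T' n"
    if c: "cone_data G d G' e \<phi> \<psi>" and "\<And>n. n \<in> T \<Longrightarrow> n - 1 \<in> T' \<Longrightarrow> n - 1 \<in> T \<longleftrightarrow> n \<in> T'"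
    for T T' n d e \<phi> \<psi>
  proof -
    note cc = cone_dataD[OF c]
    have 2: "n - 1 - 1 = n - 2" by simp
    show ?thesis
      unfolding i_def 2
    proof (rule cone_map[OF res_cone_data[OF c] res_cone_data[OF c] res_in_mor[OF cc(6)] res_in_mor[OF cc(7)]])
      fix n
      show "res_in T T' G (n - 1) \<star> res_d T G d n = res_d T' G d n \<star> res_in T T' G n"
        by (rule res_in_d[of d G T T' n]) (rule cc(1), rule that(2))
      show "res_in T T' G' (n - 1) \<star> res_d T G' e n = res_d T' G' e n \<star> res_in T T' G' n"
        by (rule res_in_d[of e G' T T' n]) (rule cc(3), rule that(2))
      show "res_in T T' G n \<star> res_map T \<phi> n = res_map T' \<phi> n \<star> res_in T T' G' n"
        by (rule res_in_map[of \<phi> G' G T T' n]) (rule cc(8))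
    qed
  qed
  note cc = cone_dataD[OF c]
  have ses: "Ses C (res_gr S G n \<boxplus> res_gr S G' (n - 1)) (i S S' n) (res_gr S' G n \<boxplus> res_gr S' G' (n - 1))
      (i S' S'' n) (res_gr S'' G n \<boxplus> res_gr S'' G' (n - 1))" for n
    unfolding i_def by (rule Ses_dsum[OF res_Ses[OF cc(6) S(1,2)] res_Ses[OF cc(7) S(1,2)]])
  \<comment> \<open>The condition \<open>cl\<close> of \<open>res_in_d\<close> for the inclusion
    (\<open>A\<close>) and for the projection (\<open>B\<close>).\<close>
  have A: "n - 1 \<in> S \<longleftrightarrow> n \<in> S'" if "n \<in> S" "n - 1 \<in> S'" for n using that S by auto
  have B: "n - 1 \<in> S' \<longleftrightarrow> n \<in> S''" if "n \<in> S'" "n - 1 \<in> S''" for n using that S by auto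
  have "Ses (Bq C)
    (bcone (res_gr S G) (res_d S G d) (res_d S G d') (res_gr S G') (res_d S G' e) (res_d S G' e') (res_map S \<phi>) (res_map S \<phi>')) (i S S')
    (bcone (res_gr S' G) (res_d S' G d) (res_d S' G d') (res_gr S' G') (res_d S' G' e) (res_d S' G' e') (res_map S' \<phi>) (res_map S' \<phi>')) (i S' S'')
    (bcone (res_gr S'' G) (res_d S'' G d) (res_d S'' G d') (res_gr S'' G') (res_d S'' G' e) (res_d S'' G' e') (res_map S'' \<phi>) (res_map S'' \<phi>'))"
  proof (rule Ses_BqI[OF bcone_acyclic bcone_acyclic bcone_acyclic])
    note r = res_cone_data[OF c] res_cone_data[OF c'] bounded_res_gr[OF b]
    show "cone_data (res_gr S G) (res_d S G d) (res_gr S G') (res_d S G' e) (res_map S \<phi>) (res_map S \<psi>)"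
      "cone_data (res_gr S G) (res_d S G d') (res_gr S G') (res_d S G' e') (res_map S \<phi>') (res_map S \<psi>')"
      "bounded_gr (res_gr S G)" by (rule r)+
    show "cone_data (res_gr S' G) (res_d S' G d) (res_gr S' G') (res_d S' G' e) (res_map S' \<phi>) (res_map S' \<psi>)"
      "cone_data (res_gr S' G) (res_d S' G d') (res_gr S' G') (res_d S' G' e') (res_map S' \<phi>') (res_map S' \<psi>')"
      "bounded_gr (res_gr S' G)" by (rule r)+
    show "cone_data (res_gr S'' G) (res_d S'' G d) (res_gr S'' G') (res_d S'' G' e) (res_map S'' \<phi>) (res_map S'' \<psi>)"
      "cone_data (res_gr S'' G) (res_d S'' G d') (res_gr S'' G') (res_d S'' G' e') (res_map S'' \<phi>') (res_map S'' \<psi>')"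
      "bounded_gr (res_gr S'' G)" by (rule r)+
  qed (simp_all add: bcone_def cone_gr_def chain[OF c A] chain[OF c' A] chain[OF c B] chain[OF c' B] ses)
  then show ?thesis by blast
qed

lemma inverses_neg:
  assumes "inverses A f B g" shows "inverses A (neg A B f) B (neg B A g)"
proof -
  have m: "f \<in> mor A B" "g \<in> mor B A" "g \<star> f = Ident C A" "f \<star> g = Ident C B"
    using assms by (auto simp: inverses_def)
  have o: "A \<in> Obj C" "B \<in> Obj C" using m by (simp_all add: mor_def)
  show ?thesis
    unfolding inverses_def neg_comp_left[OF m(1) neg_mor[OF m(2)]] neg_comp_left[OF m(2) neg_mor[OF m(1)]]
      neg_comp_right[OF m(1,2)] neg_comp_right[OF m(2,1)] m(3,4)
    using m o by (simp add: neg_neg[OF id_mor])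
qed

text \<open>The sign (-1)^n turns a chain map into a family that anticommutes with the
  differentials, as \<open>cone_data\<close> demands.\<close>

definition alt :: "int \<Rightarrow> 'a \<Rightarrow> 'a \<Rightarrow> 'b \<Rightarrow> 'b" where
  "alt n A B f = (if even n then f else neg A B f)"

lemma alt_cone_data:
  assumes a: "acyclic_complex C G d" and a': "acyclic_complex C G' e"
    and inv: "\<And>n. inverses (G' n) (\<theta> n) (G n) (\<theta>' n)"
    and c: "\<And>n. \<theta> (n - 1) \<star> e n = d n \<star> \<theta> n"
  shows "cone_data G d G' e (\<lambda>n. alt n (G' n) (G n) (\<theta> n)) (\<lambda>n. alt n (G n) (G' n) (\<theta>' n))"
  unfolding cone_data_def
proof (intro allI conjI)
  fix n
  have th: "\<theta> n \<in> mor (G' n) (G n)" for n using inv[of n] by (auto simp: inverses_def)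
  show "d n \<in> mor (G n) (G (n - 1))" "d (n - 1) \<star> d n = zer (G n) (G (n - 2))"
    "e n \<in> mor (G' n) (G' (n - 1))" using acyclicD[OF a] acyclicD[OF a'] by auto
  note d = this
  show "inverses (G' n) (alt n (G' n) (G n) (\<theta> n)) (G n) (alt n (G n) (G' n) (\<theta>' n))"
    using inv inverses_neg by (simp add: alt_def)
  have dt: "d n \<star> \<theta> n \<in> mor (G' n) (G (n - 1))" using comp_mor[OF d(1) th] .
  show "d n \<star> alt n (G' n) (G n) (\<theta> n) \<oplus>\<^sub>m alt (n - 1) (G' (n - 1)) (G (n - 1)) (\<theta> (n - 1)) \<star> e n
      = zer (G' n) (G (n - 1))"
    using plus_neg[OF dt] neg_plus[OF dt]
    by (auto simp: alt_def c neg_comp_left[OF th d(3)] neg_comp_right[OF d(1) th])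
qed

lemma bicomplex_eta: "\<lparr>gr = gr X, dtop = dtop X, dbot = dbot X\<rparr> = (X :: ('a, 'b) bicomplex)"
  by (cases X) simp

lemma res_d_single: "res_d {m} G d = (\<lambda>n. zer (res_gr {m} G n) (res_gr {m} G (n - 1)))"
  by (auto simp: fun_eq_iff res_d_def)

lemma res_map_single: "\<phi> m = \<psi> m \<Longrightarrow> res_map {m} \<phi> = res_map {m} \<psi>"
  by (auto simp: fun_eq_iff res_map_def)

end

section \<open>Classes of binary complexes closed under two out of three\<close>

text \<open>Abstracts the property that the class of a complex lies in the image of the map. The
  image is a subgroup, which gives two out of three in short exact sequences; no other fact about
  Grothendieck groups enters before the final theorem.\<close>

locale generated_class = exact_category C
  for C :: "('o, 'm, 'z) excat_scheme" (structure) +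
  fixes gen :: "('o, 'm) bicomplex \<Rightarrow> bool"
  assumes gen_diag: "binary_acyclic C X \<Longrightarrow> dtop X = dbot X \<Longrightarrow> gen X"
    and gen_base: "binary_acyclic C X \<Longrightarrow> supported_on C (gr X) {0..4} \<Longrightarrow> gen X"
    and gen_mid: "Ses (Bq C) X i Y p Z \<Longrightarrow> gen X \<Longrightarrow> gen Z \<Longrightarrow> gen Y"
    and gen_sub: "Ses (Bq C) X i Y p Z \<Longrightarrow> gen Y \<Longrightarrow> gen Z \<Longrightarrow> gen X"
    and gen_quot: "Ses (Bq C) X i Y p Z \<Longrightarrow> gen X \<Longrightarrow> gen Y \<Longrightarrow> gen Z"
begin

text \<open>Adding one degree to a truncation extends it by a single piece, so
  \<open>gen_mid\<close> applies repeatedly. The parts below degree 0 and above the top degree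
  consist of zero objects.\<close>

lemma cone_gen:
  fixes G \<phi> \<phi>'
  assumes c: "cone_data G d G' e \<phi> \<psi>" and c': "cone_data G d' G' e' \<phi>' \<psi>'" and b: "bounded_gr G"
    and piece: "\<And>m. gen (bcone (res_gr {m} G) (res_d {m} G d) (res_d {m} G d') (res_gr {m} G')
      (res_d {m} G' e) (res_d {m} G' e') (res_map {m} \<phi>) (res_map {m} \<phi>'))"
  shows "gen (bcone G d d' G' e e' \<phi> \<phi>')"
proof -
  define R where "R S = bcone (res_gr S G) (res_d S G d) (res_d S G d') (res_gr S G')
      (res_d S G' e) (res_d S G' e') (res_map S \<phi>) (res_map S \<phi>')" for S
  have step: "gen (R (S \<union> S''))"
    if "gen (R S)" "gen (R S'')" "S \<inter> S'' = {}" "\<And>n. n \<in> S \<Longrightarrow> n - 1 \<notin> S''" for S S''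
    using res_cone_Ses[OF c c' b that(3) refl that(4)] gen_mid that(1,2) unfolding R_def by blast
  have zero: "gen (R S)" if "\<And>n. n \<in> S \<Longrightarrow> zero_object C (G n)" for S
  proof (rule gen_base)
    show "binary_acyclic C (R S)"
      unfolding R_def by (rule bcone_acyclic[OF res_cone_data[OF c] res_cone_data[OF c'] bounded_res_gr[OF b]])
    have "n \<in> S \<Longrightarrow> zero_object C (G' n)" for n
      by (rule zero_object_inverses'[OF that cone_dataD(4)[OF c]])
    then have "zero_object C (gr (R S) n)" for n
      using that Zob by (auto simp: R_def bcone_def cone_gr_def res_gr_def intro!: zero_object_prd)
    then show "supported_on C (gr (R S)) {0..4}" by (simp add: supported_on_def)
  qed
  have ind: "gen (R {..<int m})" for m
  proof (induction m)
    case 0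
    then show ?case using b by (intro zero) (auto simp: bounded_gr_def supported_on_def)
  next
    case (Suc m)
    have "gen (R ({..<int m} \<union> {int m}))"
      by (rule step[OF Suc]) (auto simp: piece R_def)
    moreover have "{..<int m} \<union> {int m} = {..<int (Suc m)}" by auto
    ultimately show ?case by simp
  qed
  obtain k where k: "supported_on C G {..k}" using b by (auto simp: bounded_gr_def)
  \<comment> \<open>The least nonnegative degree above \<open>k\<close>; from there on
    \<open>G\<close> is zero.\<close>
  define m where "m = nat (k + 1)"
  have "gen (R ({..<int m} \<union> {int m..}))"
    using k by (intro step[OF ind] zero) (auto simp: supported_on_def m_def split: if_splits)
  moreover have "{..<int m} \<union> {int m..} = UNIV" by auto
  ultimately show ?thesis by (simp add: R_def)
qed

text \<open>The cone on \<open>\<theta>\<close> for the tops and \<open>\<eta>\<close> for the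
  bottoms contains \<open>Y\<close> with quotient the shift of \<open>X\<close>. Each of its pieces
  lies in degrees \<open>m\<close> and \<open>m + 1\<close>, and is diagonal if
  \<open>\<theta> m = \<eta> m\<close>. The two alternatives in \<open>piece\<close> break a circle:
  the first alone proves invariance under shifts, and this makes the second available.\<close>

lemma alt_cone_Ses:
  assumes X: "binary_acyclic C X" and Y: "binary_acyclic C Y"
    and \<theta>: "\<And>n. inverses (gr X n) (\<theta> n) (gr Y n) (\<theta>' n)"
    and \<eta>: "\<And>n. inverses (gr X n) (\<eta> n) (gr Y n) (\<eta>' n)"
    and ct: "\<And>n. \<theta> (n - 1) \<star> dtop X n = dtop Y n \<star> \<theta> n"
    and cb: "\<And>n. \<eta> (n - 1) \<star> dbot X n = dbot Y n \<star> \<eta> n"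
    and piece: "\<And>m. \<theta> m = \<eta> m \<or> (\<forall>Z. binary_acyclic C Z \<longrightarrow> m \<ge> 0 \<longrightarrow> supported_on C (gr Z) {m..m + 4} \<longrightarrow> gen Z)"
  shows "gen Y \<longleftrightarrow> gen (shiftb (- 1) X)"
proof -
  let ?\<phi> = "\<lambda>n. alt n (gr X n) (gr Y n) (\<theta> n)" and ?\<phi>' = "\<lambda>n. alt n (gr X n) (gr Y n) (\<eta> n)"
  have aX: "acyclic_complex C (gr X) (dtop X)" "acyclic_complex C (gr X) (dbot X)"
    and aY: "acyclic_complex C (gr Y) (dtop Y)" "acyclic_complex C (gr Y) (dbot Y)"
    using X Y by (auto simp: binary_acyclic_def)
  note c = alt_cone_data[OF aY(1) aX(1) \<theta> ct] and c' = alt_cone_data[OF aY(2) aX(2) \<eta> cb]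
  note b = acyclicD(4)[OF aY(1)]
  let ?M = "bcone (gr Y) (dtop Y) (dbot Y) (gr X) (dtop X) (dbot X) ?\<phi> ?\<phi>'"
  have "gen ?M"
  proof (rule cone_gen[OF c c' b])
    fix m
    let ?R = "bcone (res_gr {m} (gr Y)) (res_d {m} (gr Y) (dtop Y)) (res_d {m} (gr Y) (dbot Y))
         (res_gr {m} (gr X)) (res_d {m} (gr X) (dtop X)) (res_d {m} (gr X) (dbot X)) (res_map {m} ?\<phi>) (res_map {m} ?\<phi>')"
    have R: "binary_acyclic C ?R"
      by (rule bcone_acyclic[OF res_cone_data[OF c] res_cone_data[OF c'] bounded_res_gr[OF b]])
    have zX: "zero_object C (gr X n)" "zero_object C (gr Y n)" if "n < 0" for n
      using acyclicD(4)[OF aX(1)] b that by (auto simp: bounded_gr_def supported_on_def)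
    \<comment> \<open>Up to zero summands the piece is \<open>gr Y m\<close> in degree
      \<open>m\<close> and \<open>gr X m\<close> in degree \<open>m + 1\<close>. For negative
      \<open>m\<close> both are zero objects.\<close>
    have z: "zero_object C (gr ?R n)" if "\<not> (0 \<le> m \<and> m \<le> n \<and> n \<le> m + 4)" for n
      using that zX Zob by (auto simp: bcone_def cone_gr_def res_gr_def intro!: zero_object_prd)
    show "gen ?R"
    proof (cases "\<theta> m = \<eta> m")
      case True
      then have "res_map {m} ?\<phi> = res_map {m} ?\<phi>'" by (intro res_map_single) simp
      then show ?thesis by (intro gen_diag[OF R]) (simp add: bcone_def res_d_single)
    next
      case False
      then have p: "gen Z" if "binary_acyclic C Z" "m \<ge> 0" "supported_on C (gr Z) {m..m + 4}" for Z
        using piece[of m] that by blast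
      show ?thesis
      proof (cases "m \<ge> 0")
        case True
        then show ?thesis using z by (intro p[OF R]) (auto simp: supported_on_def)
      next
        case False
        then show ?thesis using z by (intro gen_base[OF R]) (auto simp: supported_on_def)
      qed
    qed
  qed
  moreover have "Ses (Bq C) Y (\<lambda>n. inl (gr Y n) (gr X (n - 1))) ?M (\<lambda>n. pr2 (gr Y n) (gr X (n - 1))) (shiftb (- 1) X)"
    using cone_Ses[OF c c'] X Y unfolding bicomplex_eta by blast
  ultimately show ?thesis using gen_sub gen_quot by blast
qed

text \<open>With identities for both \<open>\<theta>\<close> and \<open>\<eta>\<close>, every piece
  of the cone is diagonal.\<close>

lemma gen_shift:
  assumes X: "binary_acyclic C X"
  shows "gen (shiftb (- 1) X) \<longleftrightarrow> gen X"
proof -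
  have o: "gr X n \<in> Obj C" "dtop X n \<in> mor (gr X n) (gr X (n - 1))" "dbot X n \<in> mor (gr X n) (gr X (n - 1))" for n
    using X acyclicD by (auto simp: binary_acyclic_def)
  have "gen X \<longleftrightarrow> gen (shiftb (- 1) X)"
    using X X inverses_id[OF o(1)] inverses_id[OF o(1)]
    by (rule alt_cone_Ses) (simp_all add: id_left[OF o(2)] id_left[OF o(3)] id_right[OF o(2)] id_right[OF o(3)])
  then show ?thesis ..
qed

lemma gen_unshift:
  assumes X: "binary_acyclic C X" and s: "supported_on C (gr X) {1..}"
  shows "gen (shiftb 1 X) \<longleftrightarrow> gen X"
proof -
  have "shiftb (- 1) (shiftb 1 X) = X" by (simp add: shiftb_def)
  then show ?thesis using gen_shift[OF shiftb_acyclic[OF X s]] by simp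
qed

text \<open>Supplies the second alternative of \<open>piece\<close> in \<open>alt_cone_Ses\<close>,
  for maps that differ.\<close>

lemma gen_window:
  "binary_acyclic C X \<Longrightarrow> supported_on C (gr X) {int k..int k + 4} \<Longrightarrow> gen X"
proof (induction k arbitrary: X)
  case 0
  then show ?case using gen_base by simp
next
  case (Suc k)
  have s: "supported_on C (gr X) {1..}" using Suc.prems(2) by (auto simp: supported_on_def)
  have "gen (shiftb 1 X)"
    using Suc.prems(2) by (intro Suc.IH shiftb_acyclic[OF Suc.prems(1) s]) (auto simp: supported_on_def shiftb_def)
  then show ?case using gen_unshift[OF Suc.prems(1) s] by simp
qed

text \<open>
  The maps \<open>\<theta>\<close> and \<open>\<eta>\<close> are unrelated, so this is much stronger than invariance under isomorphisms of
  binary complexes.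
\<close>

lemma gen_iso:
  assumes X: "binary_acyclic C X" and Y: "binary_acyclic C Y"
    and \<theta>: "\<And>n. inverses (gr X n) (\<theta> n) (gr Y n) (\<theta>' n)"
    and \<eta>: "\<And>n. inverses (gr X n) (\<eta> n) (gr Y n) (\<eta>' n)"
    and ct: "\<And>n. \<theta> (n - 1) \<star> dtop X n = dtop Y n \<star> \<theta> n"
    and cb: "\<And>n. \<eta> (n - 1) \<star> dbot X n = dbot Y n \<star> \<eta> n"
  shows "gen X \<longleftrightarrow> gen Y"
proof -
  have "gen Z" if "binary_acyclic C Z" "m \<ge> 0" "supported_on C (gr Z) {m..m + 4}" for Z m
    using gen_window[OF that(1), of "nat m"] that by simp
  then have "gen Y \<longleftrightarrow> gen (shiftb (- 1) X)"
    using alt_cone_Ses[OF X Y \<theta> \<eta> ct cb] by blast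
  then show ?thesis using gen_shift[OF X] by blast
qed

section \<open>Single acyclic complexes up to isomorphism\<close>

definition ac :: "(int \<Rightarrow> 'o) \<times> (int \<Rightarrow> 'm) \<Rightarrow> bool" where
  "ac A \<longleftrightarrow> acyclic_complex C (fst A) (snd A)"

definition ciso :: "(int \<Rightarrow> 'o) \<times> (int \<Rightarrow> 'm) \<Rightarrow> (int \<Rightarrow> 'o) \<times> (int \<Rightarrow> 'm) \<Rightarrow> bool" where
  "ciso A B \<longleftrightarrow> ac A \<and> ac B \<and> (\<exists>\<theta> \<theta>'. \<forall>n. inverses (fst A n) (\<theta> n) (fst B n) (\<theta>' n) \<and>
     \<theta> (n - 1) \<star> snd A n = snd B n \<star> \<theta> n)"

text \<open>The differentials are ignored: this is what two complexes need in order to become top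
  and bottom of one binary complex, see \<open>twist\<close>.\<close>

definition giso :: "(int \<Rightarrow> 'o) \<times> (int \<Rightarrow> 'm) \<Rightarrow> (int \<Rightarrow> 'o) \<times> (int \<Rightarrow> 'm) \<Rightarrow> bool" where
  "giso A B \<longleftrightarrow> (\<forall>n. iso (fst A n) (fst B n))"

definition csum :: "(int \<Rightarrow> 'o) \<times> (int \<Rightarrow> 'm) \<Rightarrow> (int \<Rightarrow> 'o) \<times> (int \<Rightarrow> 'm) \<Rightarrow> (int \<Rightarrow> 'o) \<times> (int \<Rightarrow> 'm)" where
  "csum A B = (\<lambda>n. fst A n \<boxplus> fst B n,
     \<lambda>n. dsum (fst A n) (fst B n) (fst A (n - 1)) (fst B (n - 1)) (snd A n) (snd B n))"

lemma cisoI: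
  assumes "ac A" "ac B" "\<And>n. inverses (fst A n) (\<theta> n) (fst B n) (\<theta>' n)"
    "\<And>n. \<theta> (n - 1) \<star> snd A n = snd B n \<star> \<theta> n"
  shows "ciso A B"
  unfolding ciso_def using assms by blast

lemma cisoE:
  assumes "ciso A B"
  obtains \<theta> \<theta>' where "ac A" "ac B" "\<And>n. inverses (fst A n) (\<theta> n) (fst B n) (\<theta>' n)"
    "\<And>n. \<theta> (n - 1) \<star> snd A n = snd B n \<star> \<theta> n"
  using assms unfolding ciso_def by blast

lemma acD:
  assumes "ac A"
  shows "fst A n \<in> Obj C" "snd A n \<in> mor (fst A n) (fst A (n - 1))"
  using assms acyclicD unfolding ac_def by blast+

lemma ac_csum: "ac A \<Longrightarrow> ac B \<Longrightarrow> ac (csum A B)"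
  unfolding ac_def csum_def using acyclic_dsum by simp

lemma ciso_refl: "ac A \<Longrightarrow> ciso A A"
  by (rule cisoI[OF _ _ inverses_id])
     (simp_all add: acD id_left[OF acD(2)] id_right[OF acD(2)])

lemma inverses_natural:
  assumes a: "inverses A f B g" and a': "inverses A' f' B' g'"
    and x: "x \<in> mor A A'" and y: "y \<in> mor B B'" and c: "f' \<star> x = y \<star> f"
  shows "g' \<star> y = x \<star> g"
proof -
  have m: "f \<in> mor A B" "g \<in> mor B A" "f' \<in> mor A' B'" "g' \<in> mor B' A'"
    using a a' by (auto simp: inverses_def)
  have "x \<star> g = g' \<star> (f' \<star> (x \<star> g))"
    using cancel_inv_left[OF a' comp_mor[OF x m(2)]] by simp
  also have "\<dots> = g' \<star> (y \<star> f \<star> g)"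
    unfolding c[symmetric] assoc[OF m(3) x m(2)] ..
  also have "\<dots> = g' \<star> y" using cancel_inv_right[OF a y] by simp
  finally show ?thesis ..
qed

lemma ciso_sym: "ciso A B \<Longrightarrow> ciso B A"
proof -
  assume "ciso A B"
  then obtain \<theta> \<theta>' where t: "ac A" "ac B" "\<And>n. inverses (fst A n) (\<theta> n) (fst B n) (\<theta>' n)"
    "\<And>n. \<theta> (n - 1) \<star> snd A n = snd B n \<star> \<theta> n" by (rule cisoE) blast
  show ?thesis
    by (rule cisoI[OF t(2,1) inverses_sym[OF t(3)]
          inverses_natural[OF t(3) t(3) acD(2)[OF t(1)] acD(2)[OF t(2)] t(4)]])
qed

lemma ciso_trans: "ciso A B \<Longrightarrow> ciso B D \<Longrightarrow> ciso A D"
proof -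
  assume "ciso A B" "ciso B D"
  then obtain \<theta> \<theta>' \<eta> \<eta>' where t: "ac A" "ac B" "\<And>n. inverses (fst A n) (\<theta> n) (fst B n) (\<theta>' n)"
    "\<And>n. \<theta> (n - 1) \<star> snd A n = snd B n \<star> \<theta> n"
    and e: "ac D" "\<And>n. inverses (fst B n) (\<eta> n) (fst D n) (\<eta>' n)"
    "\<And>n. \<eta> (n - 1) \<star> snd B n = snd D n \<star> \<eta> n" by (elim cisoE) blast
  have m: "\<theta> n \<in> mor (fst A n) (fst B n)" "\<eta> n \<in> mor (fst B n) (fst D n)" for n
    using t(3)[of n] e(2)[of n] by (auto simp: inverses_def)
  show ?thesis
  proof (rule cisoI[OF t(1) e(1) inverses_comp[OF t(3) e(2)]])
    fix n
    note A = acD(2)[OF t(1), of n] and B = acD(2)[OF t(2), of n] and D = acD(2)[OF e(1), of n]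
    show "\<eta> (n - 1) \<star> \<theta> (n - 1) \<star> snd A n = snd D n \<star> (\<eta> n \<star> \<theta> n)"
      unfolding assoc[OF m(2) m(1) A] t(4) assoc[OF m(2) B m(1), symmetric] e(3) assoc[OF D m(2) m(1)] ..
  qed
qed

lemma ciso_csum: "ciso A A' \<Longrightarrow> ciso B B' \<Longrightarrow> ciso (csum A B) (csum A' B')"
proof -
  assume "ciso A A'" "ciso B B'"
  then obtain \<theta> \<theta>' \<eta> \<eta>' where t: "ac A" "ac A'" "\<And>n. inverses (fst A n) (\<theta> n) (fst A' n) (\<theta>' n)"
    "\<And>n. \<theta> (n - 1) \<star> snd A n = snd A' n \<star> \<theta> n"
    and e: "ac B" "ac B'" "\<And>n. inverses (fst B n) (\<eta> n) (fst B' n) (\<eta>' n)"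
    "\<And>n. \<eta> (n - 1) \<star> snd B n = snd B' n \<star> \<eta> n" by (elim cisoE) blast
  have m: "\<theta> n \<in> mor (fst A n) (fst A' n)" "\<eta> n \<in> mor (fst B n) (fst B' n)" for n
    using t(3)[of n] e(3)[of n] by (auto simp: inverses_def)
  show ?thesis
  proof (rule cisoI[OF ac_csum[OF t(1) e(1)] ac_csum[OF t(2) e(2)]])
    fix n
    show "inverses (fst (csum A B) n) (dsum (fst A n) (fst B n) (fst A' n) (fst B' n) (\<theta> n) (\<eta> n)) (fst (csum A' B') n)
        (dsum (fst A' n) (fst B' n) (fst A n) (fst B n) (\<theta>' n) (\<eta>' n))"
      using inverses_dsum[OF t(3) e(3)] by (simp add: csum_def)
    show "dsum (fst A (n - 1)) (fst B (n - 1)) (fst A' (n - 1)) (fst B' (n - 1)) (\<theta> (n - 1)) (\<eta> (n - 1)) \<star> snd (csum A B) n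
      = snd (csum A' B') n \<star> dsum (fst A n) (fst B n) (fst A' n) (fst B' n) (\<theta> n) (\<eta> n)"
      unfolding csum_def snd_conv dsum_dsum[OF acD(2)[OF t(1)] acD(2)[OF e(1)] m]
        dsum_dsum[OF m acD(2)[OF t(2)] acD(2)[OF e(2)]] t(4) e(4) ..
  qed
qed

lemma ciso_comm: "ac A \<Longrightarrow> ac B \<Longrightarrow> ciso (csum A B) (csum B A)"
proof -
  assume a: "ac A" and b: "ac B"
  show ?thesis
  proof (rule cisoI[OF ac_csum[OF a b] ac_csum[OF b a]])
    fix n
    show "inverses (fst (csum A B) n) (swap (fst A n) (fst B n)) (fst (csum B A) n) (swap (fst B n) (fst A n))"
      using inverses_swap acD(1) a b by (simp add: csum_def)
    show "swap (fst A (n - 1)) (fst B (n - 1)) \<star> snd (csum A B) n = snd (csum B A) n \<star> swap (fst A n) (fst B n)"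
      unfolding csum_def snd_conv by (rule swap_natural[OF acD(2)[OF a] acD(2)[OF b]])
  qed
qed

lemma ciso_assoc: "ac A \<Longrightarrow> ac B \<Longrightarrow> ac D \<Longrightarrow> ciso (csum (csum A B) D) (csum A (csum B D))"
proof -
  assume a: "ac A" and b: "ac B" and d: "ac D"
  show ?thesis
  proof (rule cisoI[OF ac_csum[OF ac_csum[OF a b] d] ac_csum[OF a ac_csum[OF b d]]])
    fix n
    show "inverses (fst (csum (csum A B) D) n) (asc (fst A n) (fst B n) (fst D n)) (fst (csum A (csum B D)) n) (asc' (fst A n) (fst B n) (fst D n))"
      using inverses_asc acD(1) a b d by (simp add: csum_def)
    show "asc (fst A (n - 1)) (fst B (n - 1)) (fst D (n - 1)) \<star> snd (csum (csum A B) D) n = snd (csum A (csum B D)) n \<star> asc (fst A n) (fst B n) (fst D n)"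
      unfolding csum_def snd_conv fst_conv by (rule asc_natural[OF acD(2)[OF a] acD(2)[OF b] acD(2)[OF d]])
  qed
qed

sublocale CX: weak_comm_semigroup "{A. ac A}" ciso csum
  by unfold_locales
     (auto intro: ciso_refl ciso_sym ciso_trans ciso_csum ciso_comm ciso_assoc elim: cisoE)

sublocale OB: weak_comm_semigroup "Obj C" iso prd
proof unfold_locales
  show "iso (A \<boxplus> B) (B \<boxplus> A)" if "A \<in> Obj C" "B \<in> Obj C" for A B
    using inverses_swap that unfolding iso_def by blast
  show "iso ((A \<boxplus> B) \<boxplus> D) (A \<boxplus> (B \<boxplus> D))" if "A \<in> Obj C" "B \<in> Obj C" "D \<in> Obj C" for A B D
    using inverses_asc that unfolding iso_def by blast
qed (use iso_Obj iso_refl iso_sym iso_trans iso_prd in blast)+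

text \<open>By \<open>gen_iso\<close>, whether \<open>X\<close> lies in the class does not depend on its choice.\<close>

definition sim :: "(int \<Rightarrow> 'o) \<times> (int \<Rightarrow> 'm) \<Rightarrow> (int \<Rightarrow> 'o) \<times> (int \<Rightarrow> 'm) \<Rightarrow> bool" where
  "sim A B \<longleftrightarrow> (\<exists>X. binary_acyclic C X \<and> gen X \<and> ciso (gr X, dtop X) A \<and> ciso (gr X, dbot X) B)"

lemma simI:
  "binary_acyclic C X \<Longrightarrow> gen X \<Longrightarrow> ciso (gr X, dtop X) A \<Longrightarrow> ciso (gr X, dbot X) B \<Longrightarrow> sim A B"
  unfolding sim_def by blast

lemma sim_ac: "sim A B \<Longrightarrow> ac A \<and> ac B"
  unfolding sim_def by (auto elim: cisoE)

lemma gen_ciso: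
  assumes "binary_acyclic C X" "binary_acyclic C Y"
    "ciso (gr X, dtop X) (gr Y, dtop Y)" "ciso (gr X, dbot X) (gr Y, dbot Y)"
  shows "gen X \<longleftrightarrow> gen Y"
proof -
  obtain \<theta> \<theta>' where t: "\<And>n. inverses (gr X n) (\<theta> n) (gr Y n) (\<theta>' n)"
    "\<And>n. \<theta> (n - 1) \<star> dtop X n = dtop Y n \<star> \<theta> n"
    using assms(3) by (rule cisoE) auto
  obtain \<eta> \<eta>' where e: "\<And>n. inverses (gr X n) (\<eta> n) (gr Y n) (\<eta>' n)"
    "\<And>n. \<eta> (n - 1) \<star> dbot X n = dbot Y n \<star> \<eta> n"
    using assms(4) by (rule cisoE) auto
  show ?thesis by (rule gen_iso[OF assms(1,2) t(1) e(1) t(2) e(2)])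
qed

lemma sim_gen:
  assumes "sim A B" and X: "binary_acyclic C X" "ciso (gr X, dtop X) A" "ciso (gr X, dbot X) B"
  shows "gen X"
proof -
  obtain Y where Y: "binary_acyclic C Y" "gen Y" "ciso (gr Y, dtop Y) A" "ciso (gr Y, dbot Y) B"
    using assms(1) unfolding sim_def by blast
  show ?thesis
    using gen_ciso[OF X(1) Y(1)] ciso_trans[OF X(2) ciso_sym[OF Y(3)]] ciso_trans[OF X(3) ciso_sym[OF Y(4)]] Y(2)
    by blast
qed

lemma sim_ciso: "sim A B \<Longrightarrow> ciso A A' \<Longrightarrow> ciso B B' \<Longrightarrow> sim A' B'"
  unfolding sim_def using ciso_trans by blast

text \<open>The diagonal complex on \<open>A\<close> is a witness.\<close>

lemma ciso_imp_sim:
  assumes "ciso A B" shows "sim A B"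
proof -
  have a: "ac A" using assms by (rule cisoE)
  then have X: "binary_acyclic C \<lparr>gr = fst A, dtop = snd A, dbot = snd A\<rparr>"
    by (simp add: binary_acyclic_def ac_def)
  show ?thesis using assms ciso_refl[OF a] by (intro simI[OF X gen_diag[OF X]]) simp_all
qed

lemma ac_top: "binary_acyclic C X \<Longrightarrow> ac (gr X, dtop X)"
  and ac_bot: "binary_acyclic C X \<Longrightarrow> ac (gr X, dbot X)"
  by (simp_all add: ac_def binary_acyclic_def)

definition bsum :: "('o, 'm) bicomplex \<Rightarrow> ('o, 'm) bicomplex \<Rightarrow> ('o, 'm) bicomplex" where
  "bsum X Y = \<lparr>gr = fst (csum (gr X, dtop X) (gr Y, dtop Y)), dtop = snd (csum (gr X, dtop X) (gr Y, dtop Y)),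
     dbot = snd (csum (gr X, dbot X) (gr Y, dbot Y))\<rparr>"

lemma bsum_top: "(gr (bsum X Y), dtop (bsum X Y)) = csum (gr X, dtop X) (gr Y, dtop Y)"
  and bsum_bot: "(gr (bsum X Y), dbot (bsum X Y)) = csum (gr X, dbot X) (gr Y, dbot Y)"
  by (simp_all add: bsum_def csum_def)

lemma bsum_Ses:
  assumes X: "binary_acyclic C X" and Y: "binary_acyclic C Y"
  shows "binary_acyclic C (bsum X Y)"
    and "Ses (Bq C) X (\<lambda>n. inl (gr X n) (gr Y n)) (bsum X Y) (\<lambda>n. pr2 (gr X n) (gr Y n)) Y"
proof -
  note a = ac_top[OF X] ac_bot[OF X] ac_top[OF Y] ac_bot[OF Y]
  show s: "binary_acyclic C (bsum X Y)"
    using ac_csum[OF a(1,3)] ac_csum[OF a(2,4)] unfolding bsum_top[symmetric] bsum_bot[symmetric]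
    by (simp add: ac_def binary_acyclic_def)
  show "Ses (Bq C) X (\<lambda>n. inl (gr X n) (gr Y n)) (bsum X Y) (\<lambda>n. pr2 (gr X n) (gr Y n)) Y"
    using acD[OF a(1)] acD[OF a(2)] acD[OF a(3)] acD[OF a(4)]
    by (intro Ses_BqI X Y s) (simp_all add: bsum_def csum_def Ses_inl_pr2 dsum_inl pr2_dsum)
qed

lemma sim_sum:
  assumes "sim A B" "sim A' B'" shows "sim (csum A A') (csum B B')"
proof -
  obtain X where X: "binary_acyclic C X" "gen X" "ciso (gr X, dtop X) A" "ciso (gr X, dbot X) B"
    using assms(1) unfolding sim_def by blast
  obtain Y where Y: "binary_acyclic C Y" "gen Y" "ciso (gr Y, dtop Y) A'" "ciso (gr Y, dbot Y) B'"
    using assms(2) unfolding sim_def by blast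
  note s = bsum_Ses[OF X(1) Y(1)]
  show ?thesis
    by (rule simI[OF s(1) gen_mid[OF s(2) X(2) Y(2)]])
       (auto simp: bsum_top bsum_bot intro: ciso_csum X Y)
qed

text \<open>The differential of \<open>B\<close> is carried to the graded object of \<open>A\<close>
  along \<open>\<theta>\<close>, which need not be a chain map from \<open>A\<close> to
  \<open>B\<close>.\<close>

lemma twist:
  assumes a: "ac A" and b: "ac B" and t: "\<And>n. inverses (fst A n) (\<theta> n) (fst B n) (\<theta>' n)"
  obtains X where "binary_acyclic C X" "gr X = fst A" "dtop X = snd A"
    "\<And>n. \<theta> (n - 1) \<star> dbot X n = snd B n \<star> \<theta> n" "ciso (gr X, dtop X) A" "ciso (gr X, dbot X) B"
proof -
  have m: "\<theta> n \<in> mor (fst A n) (fst B n)" "\<theta>' n \<in> mor (fst B n) (fst A n)" for n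
    using t[of n] by (auto simp: inverses_def)
  define e where "e n = \<theta>' (n - 1) \<star> (snd B n \<star> \<theta> n)" for n
  note bt = comp_mor[OF acD(2)[OF b] m(1)]
  have e: "e n \<in> mor (fst A n) (fst A (n - 1))" for n unfolding e_def by (rule comp_mor[OF m(2) bt])
  have c: "\<theta> (n - 1) \<star> e n = snd B n \<star> \<theta> n" for n
    unfolding e_def by (rule cancel_inv_left[OF inverses_sym[OF t] bt])
  have "acyclic_complex C (fst A) e"
    by (rule acyclic_transport[OF b[unfolded ac_def] inverses_sym[OF t] e
          inverses_natural[OF t t e acD(2)[OF b] c]])
  then have X: "binary_acyclic C \<lparr>gr = fst A, dtop = snd A, dbot = e\<rparr>"
    using a by (simp add: binary_acyclic_def ac_def)
  show thesis
    using cisoI[OF ac_bot[OF X] b, of \<theta> \<theta>'] ciso_refl[OF a] t c by (intro that[OF X]) simp_all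
qed

text \<open>\<open>giso\<close> provides some binary complex with top \<open>A\<close> and bottom
  \<open>B\<close>. Its sum with the diagonal complex on \<open>T\<close> lies in the class, and two
  out of three removes \<open>T\<close>.\<close>

lemma sim_cancel:
  assumes s: "sim (csum A T) (csum B T)" and a: "ac A" "ac B" "ac T" and g: "giso A B"
  shows "sim A B"
proof -
  have "\<forall>n. \<exists>f g. inverses (fst A n) f (fst B n) g" using g by (simp add: giso_def iso_def)
  then obtain \<theta> \<theta>' where t: "\<And>n. inverses (fst A n) (\<theta> n) (fst B n) (\<theta>' n)" by metis
  obtain X where X: "binary_acyclic C X" "ciso (gr X, dtop X) A" "ciso (gr X, dbot X) B"
    by (rule twist[OF a(1,2) t])
  have Y: "binary_acyclic C \<lparr>gr = fst T, dtop = snd T, dbot = snd T\<rparr>" (is "binary_acyclic C ?Y")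
    using a(3) by (simp add: binary_acyclic_def ac_def)
  note s2 = bsum_Ses[OF X(1) Y]
  have "gen (bsum X ?Y)"
    by (rule sim_gen[OF s s2(1)]) (auto simp: bsum_top bsum_bot intro!: ciso_csum X ciso_refl a)
  then have "gen X" by (rule gen_sub[OF s2(2)]) (simp add: gen_diag[OF Y])
  then show ?thesis by (rule simI[OF X(1) _ X(2,3)])
qed

lemma sim_sym:
  assumes "sim A B" shows "sim B A"
proof -
  obtain X where X: "binary_acyclic C X" "gen X" "ciso (gr X, dtop X) A" "ciso (gr X, dbot X) B"
    using assms unfolding sim_def by blast
  have Y: "binary_acyclic C \<lparr>gr = gr X, dtop = dbot X, dbot = dtop X\<rparr>" (is "binary_acyclic C ?Y")
    using X(1) by (simp add: binary_acyclic_def)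
  note s = bsum_Ses[OF X(1) Y]
  \<comment> \<open>Top and bottom of the sum are isomorphic, so that it may be replaced by a diagonal complex.\<close>
  have "gen (bsum X ?Y)"
    using ciso_comm[OF ac_bot[OF X(1)] ac_top[OF X(1)]] ciso_refl[OF ac_csum[OF ac_top[OF X(1)] ac_bot[OF X(1)]]]
    by (intro sim_gen[OF ciso_imp_sim[OF ciso_refl[OF ac_csum[OF ac_top[OF X(1)] ac_bot[OF X(1)]]]] s(1)])
       (simp_all add: bsum_top bsum_bot)
  then have "gen ?Y" by (rule gen_quot[OF s(2) X(2)])
  then show ?thesis using X by (intro simI[OF Y]) simp_all
qed

text \<open>Turns a bound on the support into a relation between complexes that share nothing but
  their graded objects.\<close>

lemma sim_short:
  assumes short: "\<And>X. binary_acyclic C X \<Longrightarrow> supported_on C (gr X) S \<Longrightarrow> gen X"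
    and a: "ac A" "ac B" "giso A B" "supported_on C (fst A) S"
  shows "sim A B"
proof -
  have "\<forall>n. \<exists>f g. inverses (fst A n) f (fst B n) g" using a(3) by (simp add: giso_def iso_def)
  then obtain \<theta> \<theta>' where t: "\<And>n. inverses (fst A n) (\<theta> n) (fst B n) (\<theta>' n)" by metis
  obtain X where X: "binary_acyclic C X" "gr X = fst A" "ciso (gr X, dtop X) A" "ciso (gr X, dbot X) B"
    by (rule twist[OF a(1,2) t])
  show ?thesis by (rule simI[OF X(1) short[OF X(1)] X(3,4)]) (simp add: X(2) a(4))
qed

text \<open>Moving the three bottom differentials to the graded objects of \<open>A'\<close>,
  \<open>A\<close> and \<open>A''\<close> makes \<open>i\<close> and \<open>p\<close> chain maps for
  bottom as well as top. Exactness is stated on the \<open>A\<close> side because the resulting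
  sequence of binary complexes lives there.\<close>

lemma sim_extension:
  assumes a: "ac A'" "ac A" "ac A''" and b: "ac B'" "ac B" "ac B''"
    and sA: "\<And>n. Ses C (fst A' n) (i n) (fst A n) (p n) (fst A'' n)"
    and cA: "\<And>n. i (n - 1) \<star> snd A' n = snd A n \<star> i n" "\<And>n. p (n - 1) \<star> snd A n = snd A'' n \<star> p n"
    and cB: "\<And>n. j (n - 1) \<star> snd B' n = snd B n \<star> j n" "\<And>n. q (n - 1) \<star> snd B n = snd B'' n \<star> q n"
    and jm: "\<And>n. j n \<in> mor (fst B' n) (fst B n)" and qm: "\<And>n. q n \<in> mor (fst B n) (fst B'' n)"
    and t': "\<And>n. inverses (fst A' n) (\<theta>' n) (fst B' n) (\<eta>' n)"
    and t: "\<And>n. inverses (fst A n) (\<theta> n) (fst B n) (\<eta> n)"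
    and t'': "\<And>n. inverses (fst A'' n) (\<theta>'' n) (fst B'' n) (\<eta>'' n)"
    and i: "\<And>n. \<theta> n \<star> i n = j n \<star> \<theta>' n" and p: "\<And>n. \<theta>'' n \<star> p n = q n \<star> \<theta> n"
    and "sim A' B'" "sim A'' B''"
  shows "sim A B"
proof -
  obtain X' where X': "binary_acyclic C X'" "gr X' = fst A'" "dtop X' = snd A'"
    "\<And>n. \<theta>' (n - 1) \<star> dbot X' n = snd B' n \<star> \<theta>' n" "ciso (gr X', dtop X') A'" "ciso (gr X', dbot X') B'"
    by (rule twist[OF a(1) b(1) t']) (rule that, assumption+)
  obtain X where X: "binary_acyclic C X" "gr X = fst A" "dtop X = snd A"
    "\<And>n. \<theta> (n - 1) \<star> dbot X n = snd B n \<star> \<theta> n" "ciso (gr X, dtop X) A" "ciso (gr X, dbot X) B"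
    by (rule twist[OF a(2) b(2) t]) (rule that, assumption+)
  obtain X'' where X'': "binary_acyclic C X''" "gr X'' = fst A''" "dtop X'' = snd A''"
    "\<And>n. \<theta>'' (n - 1) \<star> dbot X'' n = snd B'' n \<star> \<theta>'' n" "ciso (gr X'', dtop X'') A''" "ciso (gr X'', dbot X'') B''"
    by (rule twist[OF a(3) b(3) t'']) (rule that, assumption+)
  have m: "\<theta> n \<in> mor (fst A n) (fst B n)" "\<theta>' n \<in> mor (fst A' n) (fst B' n)" "\<theta>'' n \<in> mor (fst A'' n) (fst B'' n)"
    "\<eta> n \<in> mor (fst B n) (fst A n)" "\<eta>'' n \<in> mor (fst B'' n) (fst A'' n)" for n
    using t[of n] t'[of n] t''[of n] by (auto simp: inverses_def)
  have e: "dbot X' n \<in> mor (fst A' n) (fst A' (n - 1))" "dbot X n \<in> mor (fst A n) (fst A (n - 1))"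
    "dbot X'' n \<in> mor (fst A'' n) (fst A'' (n - 1))" for n
    using acD(2)[OF ac_bot[OF X'(1)]] acD(2)[OF ac_bot[OF X(1)]] acD(2)[OF ac_bot[OF X''(1)]] X'(2) X(2) X''(2)
    by simp_all
  note im = SesD(1)[OF sA] and pm = SesD(2)[OF sA]
  have "Ses (Bq C) X' i X p X''"
  proof (rule Ses_BqI[OF X'(1) X(1) X''(1)])
    fix n
    note [simp] = X'(2,3) X(2,3) X''(2,3)
    show "Ses C (gr X' n) (i n) (gr X n) (p n) (gr X'' n)" using sA by simp
    show "i (n - 1) \<star> dtop X' n = dtop X n \<star> i n" "p (n - 1) \<star> dtop X n = dtop X'' n \<star> p n"
      using cA by simp_all
    \<comment> \<open>The bottom differentials are known only through \<open>\<theta>\<close>, so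
      the equation is checked after composing with \<open>\<theta> (n - 1)\<close>, which is then
      cancelled.\<close>
    have l: "\<theta> (n - 1) \<star> (i (n - 1) \<star> dbot X' n) = \<theta> (n - 1) \<star> (dbot X n \<star> i n)"
    proof -
      have "\<theta> (n - 1) \<star> (i (n - 1) \<star> dbot X' n) = j (n - 1) \<star> (\<theta>' (n - 1) \<star> dbot X' n)"
        by (simp only: assoc[OF m(1) im e(1), symmetric] i assoc[OF jm m(2) e(1)])
      also have "\<dots> = snd B n \<star> (j n \<star> \<theta>' n)"
        by (simp only: X'(4) assoc[OF jm acD(2)[OF b(1)] m(2), symmetric] cB(1) assoc[OF acD(2)[OF b(2)] jm m(2)])
      also have "\<dots> = (snd B n \<star> \<theta> n) \<star> i n"
        by (simp only: i[symmetric] assoc[OF acD(2)[OF b(2)] m(1) im])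
      also have "\<dots> = \<theta> (n - 1) \<star> (dbot X n \<star> i n)"
        by (simp only: X(4)[symmetric] assoc[OF m(1) e(2) im])
      finally show ?thesis .
    qed
    show "i (n - 1) \<star> dbot X' n = dbot X n \<star> i n"
      by (metis l cancel_inv_left[OF t comp_mor[OF im e(1)]] cancel_inv_left[OF t comp_mor[OF e(2) im]])
    have r: "\<theta>'' (n - 1) \<star> (p (n - 1) \<star> dbot X n) = \<theta>'' (n - 1) \<star> (dbot X'' n \<star> p n)"
    proof -
      have "\<theta>'' (n - 1) \<star> (p (n - 1) \<star> dbot X n) = q (n - 1) \<star> (\<theta> (n - 1) \<star> dbot X n)"
        by (simp only: assoc[OF m(3) pm e(2), symmetric] p assoc[OF qm m(1) e(2)])
      also have "\<dots> = snd B'' n \<star> (q n \<star> \<theta> n)"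
        by (simp only: X(4) assoc[OF qm acD(2)[OF b(2)] m(1), symmetric] cB(2) assoc[OF acD(2)[OF b(3)] qm m(1)])
      also have "\<dots> = (snd B'' n \<star> \<theta>'' n) \<star> p n"
        by (simp only: p[symmetric] assoc[OF acD(2)[OF b(3)] m(3) pm])
      also have "\<dots> = \<theta>'' (n - 1) \<star> (dbot X'' n \<star> p n)"
        by (simp only: X''(4)[symmetric] assoc[OF m(3) e(3) pm])
      finally show ?thesis .
    qed
    show "p (n - 1) \<star> dbot X n = dbot X'' n \<star> p n"
      by (metis r cancel_inv_left[OF t'' comp_mor[OF pm e(2)]] cancel_inv_left[OF t'' comp_mor[OF e(3) pm]])
  qed
  moreover have "gen X'" "gen X''"
    using sim_gen[OF \<open>sim A' B'\<close> X'(1,5,6)] sim_gen[OF \<open>sim A'' B''\<close> X''(1,5,6)] by auto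
  ultimately have "gen X" by (rule gen_mid)
  then show ?thesis by (rule simI[OF X(1) _ X(5,6)])
qed

end

context exact_category
begin

section \<open>Shortening\<close>

definition ses_gr :: "int \<Rightarrow> 'a \<Rightarrow> 'a \<Rightarrow> 'a \<Rightarrow> int \<Rightarrow> 'a" where
  "ses_gr k A B D n = (if n = k then D else if n = k + 1 then B else if n = k + 2 then A else Zob)"

definition ses_cx :: "int \<Rightarrow> 'a \<Rightarrow> 'b \<Rightarrow> 'a \<Rightarrow> 'b \<Rightarrow> 'a \<Rightarrow> (int \<Rightarrow> 'a) \<times> (int \<Rightarrow> 'b)" where
  "ses_cx k A i B p D = (ses_gr k A B D, \<lambda>n. if n = k + 1 then p else if n = k + 2 then i
     else zer (ses_gr k A B D n) (ses_gr k A B D (n - 1)))"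

text \<open>The values at \<open>k + 1\<close> and \<open>k + 2\<close> are exported because, for
  \<open>k = 0\<close>, such a complex is itself cut by \<open>upper\<close>.\<close>

lemma ses_cx_cycles:
  assumes s: "Ses C A i B p D"
  obtains J q j where "cycles (fst (ses_cx k A i B p D)) (snd (ses_cx k A i B p D)) J q j"
    "J (k + 1) = A" "j (k + 1) = i" "q (k + 2) = Ident C A"
proof -
  define J where "J n = (if n = k then D else if n = k + 1 then A else Zob)" for n
  define j where "j n = (if n = k then Ident C D else if n = k + 1 then i else zer (J n) (ses_gr k A B D n))" for n
  define q where "q n = (if n = k + 1 then p else if n = k + 2 then Ident C A else zer (ses_gr k A B D n) (J (n - 1)))" for n
  note m = SesD[OF s]
  have "Ses C (J n) (j n) (ses_gr k A B D n) (q n) (J (n - 1)) \<and> snd (ses_cx k A i B p D) n = j (n - 1) \<star> q n" for n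
  proof -
    consider "n = k" | "n = k + 1" | "n = k + 2" | "n \<noteq> k" "n \<noteq> k + 1" "n \<noteq> k + 2" "n = k + 3"
      | "n \<noteq> k" "n \<noteq> k + 1" "n \<noteq> k + 2" "n \<noteq> k + 3" by blast
    then show ?thesis
      by cases (use m s Ses_id_zer[OF Zob m(6)] Ses_zer_id[OF Zob m(4)] Ses_id_zer[OF Zob Zob_Obj] id_left[OF m(2)] id_right[OF m(1)]
        in \<open>simp_all add: J_def j_def q_def ses_gr_def ses_cx_def Ident_Zob\<close>)
  qed
  then have "cycles (fst (ses_cx k A i B p D)) (snd (ses_cx k A i B p D)) J q j"
    by (simp add: cycles_def ses_cx_def)
  then show thesis by (rule that) (simp_all add: J_def j_def q_def)
qed

lemma fst_ses_cx: "fst (ses_cx k A i B p D) = ses_gr k A B D"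
  by (simp add: ses_cx_def)

lemma ses_cx_acyclic:
  assumes "Ses C A i B p D" "k \<ge> 0"
  shows "acyclic_complex C (fst (ses_cx k A i B p D)) (snd (ses_cx k A i B p D))"
proof -
  have "bounded_gr (fst (ses_cx k A i B p D))"
    unfolding bounded_gr_def supported_on_def fst_ses_cx ses_gr_def using Zob assms(2)
    by (auto intro: exI[of _ "k + 2"])
  then show ?thesis using ses_cx_cycles[OF assms(1)] by (metis acyclic_iff)
qed

text \<open>The complex \<open>P\<close> in degrees above 1, with \<open>P 1\<close> replaced by the image \<open>K\<close> of its differential.\<close>

definition upper :: "(int \<Rightarrow> 'a) \<Rightarrow> (int \<Rightarrow> 'b) \<Rightarrow> 'a \<Rightarrow> 'b \<Rightarrow> (int \<Rightarrow> 'a) \<times> (int \<Rightarrow> 'b)" where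
  "upper P d K q = (\<lambda>n. if n \<le> 0 then Zob else if n = 1 then K else P n,
     \<lambda>n. if n \<le> 0 then zer Zob Zob else if n = 1 then zer K Zob else if n = 2 then q else d n)"

lemma upper_acyclic:
  assumes c: "cycles P d J p i" and b: "bounded_gr P"
  shows "acyclic_complex C (fst (upper P d (J 1) (p 2))) (snd (upper P d (J 1) (p 2)))"
proof -
  let ?U = "fst (upper P d (J 1) (p 2))"
  \<comment> \<open>The cycles of \<open>P\<close> from degree 1 on. In degree 1 the whole object
    \<open>J 1\<close> consists of cycles, so its embedding becomes the identity.\<close>
  define J' where "J' n = (if n \<le> 0 then Zob else J n)" for n
  define i' where "i' n = (if n \<le> 0 then zer Zob Zob else if n = 1 then Ident C (J 1) else i n)" for n
  define p' where "p' n = (if n \<le> 1 then zer (?U n) Zob else p n)" for n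
  note s = cyclesD(1)[OF c] and d = cyclesD(2)[OF c]
  have "Ses C (J' n) (i' n) (?U n) (p' n) (J' (n - 1)) \<and> snd (upper P d (J 1) (p 2)) n = i' (n - 1) \<star> p' n" for n
  proof -
    have p2: "p 2 \<in> mor (P 2) (J 1)" using SesD(2)[OF s[of 2]] by simp
    have o: "J 1 \<in> Obj C" by (rule SesD(4)[OF s])
    consider "n \<le> 0" | "n = 1" | "n = 2" | "n \<ge> 3" by linarith
    then show ?thesis
      by cases (use s[of n] d[of n] Ses_id_zer[OF Zob Zob_Obj] Ses_id_zer[OF Zob o] id_left[OF p2] o
        in \<open>simp_all add: J'_def i'_def p'_def upper_def Ident_Zob\<close>)
  qed
  then have "cycles ?U (snd (upper P d (J 1) (p 2))) J' p' i'" by (simp add: cycles_def)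
  moreover obtain k where k: "supported_on C P {..k}" using b by (auto simp: bounded_gr_def)
  have "supported_on C ?U {..max 1 k}"
    using k Zob by (auto simp: supported_on_def upper_def)
  moreover have "supported_on C ?U {0..}" using Zob by (auto simp: supported_on_def upper_def)
  ultimately show ?thesis unfolding acyclic_iff bounded_gr_def by blast
qed

text \<open>Contractible, with \<open>X\<close> in degrees 1 and 0. For \<open>X = P 0\<close> it is
  the quotient of \<open>P\<close> by its upper part, as \<open>P 1\<close> modulo
  \<open>J 1\<close> is \<open>P 0\<close>.\<close>

definition tail :: "'a \<Rightarrow> (int \<Rightarrow> 'a) \<times> (int \<Rightarrow> 'b)" where
  "tail X = ses_cx 0 Zob (zer Zob X) X (Ident C X) X"

definition upper_in :: "(int \<Rightarrow> 'a) \<Rightarrow> 'b \<Rightarrow> int \<Rightarrow> 'b" where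
  "upper_in P i n = (if n \<le> 0 then zer Zob (P n) else if n = 1 then i else Ident C (P n))"

definition to_tail :: "(int \<Rightarrow> 'a) \<Rightarrow> 'b \<Rightarrow> int \<Rightarrow> 'b" where
  "to_tail P d n = (if n = 0 then Ident C (P n) else if n = 1 then d else zer (P n) Zob)"

text \<open>\<open>s1\<close> has \<open>P 0\<close> itself in place of the cycles
  \<open>J 0\<close>, and \<open>z\<close> makes the negative degrees literally \<open>Zob\<close>.
  So the quotient is \<open>tail (P 0)\<close> on the nose, the same for all complexes with the same
  object in degree 0.\<close>

lemma truncation:
  assumes c: "cycles P d J p i" and z: "\<And>n. n < 0 \<Longrightarrow> P n = Zob"
    and s1: "Ses C (J 1) (i 1) (P 1) (d 1) (P 0)"
  shows "Ses C (fst (upper P d (J 1) (p 2)) n) (upper_in P (i 1) n) (P n) (to_tail P (d 1) n) (fst (tail (P 0)) n)"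
    and "upper_in P (i 1) (n - 1) \<star> snd (upper P d (J 1) (p 2)) n = d n \<star> upper_in P (i 1) n"
    and "to_tail P (d 1) (n - 1) \<star> d n = snd (tail (P 0)) n \<star> to_tail P (d 1) n"
proof -
  have PO: "P n \<in> Obj C" for n using SesD(5)[OF cyclesD(1)[OF c]] .
  have d: "d n \<in> mor (P n) (P (n - 1))" for n by (rule cyclesD(3)[OF c])
  have d1: "d 1 \<in> mor (P 1) (P 0)" using d[of 1] by simp
  have d2: "d 2 \<in> mor (P 2) (P 1)" using d[of 2] by simp
  have d3: "d 3 \<in> mor (P 3) (P 2)" using d[of 3] by simp
  have dd: "d 1 \<star> d 2 = zer (P 2) (P 0)" using cyclesD(4)[OF c, of 2] by simp
  have ip: "i 1 \<star> p 2 = d 2" using cyclesD(2)[OF c, of 2] by simp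
  note m1 = SesD[OF s1]
  have dz: "d n = zer (P n) (P (n - 1))" if "n \<le> 0" for n
    using d[of n] z[of "n - 1"] that into_Zob by simp
  consider "n < 0" | "n = 0" | "n = 1" | "n = 2" | "n = 3" | "n > 3" by linarith
  note cs = this
  show "Ses C (fst (upper P d (J 1) (p 2)) n) (upper_in P (i 1) n) (P n) (to_tail P (d 1) n) (fst (tail (P 0)) n)"
    using cs
    by cases (use z[of n] s1 Ses_id_zer[OF Zob Zob_Obj] Ses_zer_id[OF Zob PO] Ses_id_zer[OF Zob PO]
      in \<open>simp_all add: upper_def upper_in_def to_tail_def tail_def fst_ses_cx ses_gr_def Ident_Zob\<close>)
  show "upper_in P (i 1) (n - 1) \<star> snd (upper P d (J 1) (p 2)) n = d n \<star> upper_in P (i 1) n"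
    using cs
    by cases (use z[of n] z[of "n - 1"] PO m1 ip in \<open>simp_all add: upper_def upper_in_def dz
      id_right[OF d] id_left[OF d] id_right[OF d2] id_left[OF d3] comp_zer[OF Zob_Obj d]\<close>)
  show "to_tail P (d 1) (n - 1) \<star> d n = snd (tail (P 0)) n \<star> to_tail P (d 1) n"
    using cs
    by cases (use z[of n] z[of "n - 1"] PO m1 dd in \<open>simp_all add: to_tail_def tail_def ses_cx_def ses_gr_def dz
      id_left[OF d1] zer_comp[OF Zob_Obj d] zer_comp[OF Zob_Obj d2] zer_comp[OF Zob_Obj d3] Ident_Zob\<close>)
qed

end

context generated_class
begin

lemma ac_ses_cx: "Ses C A i B p D \<Longrightarrow> k \<ge> 0 \<Longrightarrow> ac (ses_cx k A i B p D)"
  unfolding ac_def by (rule ses_cx_acyclic)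

text \<open>
  Both sums are extensions of \<open>tail (P 0)\<close> by \<open>csum U V\<close>.  The identification of the graded
  objects \<open>P 1 \<boxplus> J 1\<close> and \<open>J 1 \<boxplus> P 1\<close> in degree 1 swaps the two copies of \<open>J 1\<close> in the subobject.
\<close>

lemma sim_truncation:
  assumes cP: "cycles P d J p i" and bP: "bounded_gr P" and z: "\<And>n. n < 0 \<Longrightarrow> P n = Zob"
    and s1: "Ses C (J 1) (i 1) (P 1) (d 1) (P 0)"
  defines "a \<equiv> ses_cx 0 (J 1) (i 1) (P 1) (d 1) (P 0)"
  defines "U \<equiv> upper P d (J 1) (p 2)" and "V \<equiv> upper (fst a) (snd a) (J 1) (Ident C (J 1))"
  shows "ac U" "ac V" "sim (csum (P, d) V) (csum U a)"
proof -
  obtain J' q j where c': "cycles (fst a) (snd a) J' q j" "J' 1 = J 1" "j 1 = i 1" "q 2 = Ident C (J 1)"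
    unfolding a_def by (rule ses_cx_cycles[OF s1, of 0]) simp
  have a: "ac a" unfolding a_def by (rule ac_ses_cx[OF s1]) simp
  have ba: "bounded_gr (fst a)" using a acyclicD(4) by (auto simp: ac_def)
  show U: "ac U" unfolding U_def ac_def by (rule upper_acyclic[OF cP bP])
  show V: "ac V" unfolding V_def ac_def using upper_acyclic[OF c'(1) ba] c' by simp
  have aP: "fst a n = P n" if "n \<le> 1" for n
    using that z by (auto simp: a_def fst_ses_cx ses_gr_def)
  have a1: "snd a 1 = d 1" by (simp add: a_def ses_cx_def)
  \<comment> \<open>\<open>V\<close> is contractible, with \<open>J 1\<close> in degrees 2 and 1. It
    shares the former with \<open>a\<close> and the latter with \<open>U\<close>, which makes the
    graded objects of the two sums isomorphic.\<close>
  have aV: "fst a n = fst V n" if "n \<ge> 2" for n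
    using that by (auto simp: a_def V_def upper_def)
  have UV: "fst U n = fst V n" if "n \<le> 1" for n using that by (auto simp: U_def V_def upper_def)
  have UP: "fst U n = P n" if "n \<ge> 2" for n using that by (auto simp: U_def upper_def)
  let ?t = "tail (P 0)"
  define u where "u = upper_in P (i 1)"
  define v where "v = to_tail P (d 1)"
  define u' where "u' = upper_in (fst a) (i 1)"
  define v' where "v' = to_tail (fst a) (d 1)"
  note t1 = truncation[OF cP _ s1, folded U_def u_def v_def]
  have t1: "Ses C (fst U n) (u n) (P n) (v n) (fst ?t n)"
    "u (n - 1) \<star> snd U n = d n \<star> u n" "v (n - 1) \<star> d n = snd ?t n \<star> v n" for n
    using z by (auto intro!: t1)
  \<comment> \<open>The same truncation applies to \<open>a\<close>: its upper part is
    \<open>V\<close>, its quotient again \<open>tail (P 0)\<close>.\<close>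
  have "Ses C (J' 1) (j 1) (fst a 1) (snd a 1) (fst a 0)" using s1 c' by (simp add: aP a1)
  note t2 = truncation[OF c'(1) _ this, unfolded c' a1 aP[OF zero_le_one], folded V_def u'_def v'_def]
  have t2: "Ses C (fst V n) (u' n) (fst a n) (v' n) (fst ?t n)"
    "u' (n - 1) \<star> snd V n = snd a n \<star> u' n" "v' (n - 1) \<star> snd a n = snd ?t n \<star> v' n" for n
    using z by (auto intro!: t2 simp: aP)
  have u'u: "u' n = u n" "v' n = v n" if "n \<le> 1" for n
    using that by (simp_all add: u_def u'_def v_def v'_def upper_in_def to_tail_def aP)
  have u'2: "u n = Ident C (P n)" "u' n = Ident C (fst a n)" "v n = zer (P n) Zob" "v' n = zer (fst a n) Zob" if "n \<ge> 2" for n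
    using that by (simp_all add: u_def u'_def v_def v'_def upper_in_def to_tail_def)
  have t2n: "fst ?t n = Zob" if "n \<ge> 2" for n using that by (simp add: tail_def fst_ses_cx ses_gr_def)
  have t: "ac ?t" unfolding tail_def using Ses_zer_id[OF Zob SesD(6)[OF s1]] by (intro ac_ses_cx) simp_all
  \<comment> \<open>A zero complex, padding the quotients so that both extensions consist of
    sums.\<close>
  let ?z = "(\<lambda>_. Zob, \<lambda>_. zer Zob Zob) :: (int \<Rightarrow> 'o) \<times> (int \<Rightarrow> 'm)"
  have "cycles (fst ?z) (snd ?z) (\<lambda>_. Zob) (\<lambda>_. zer Zob Zob) (\<lambda>_. zer Zob Zob)"
    using Ses_id_zer[OF Zob Zob_Obj] by (simp add: cycles_def Ident_Zob)
  then have zz: "ac ?z"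
    unfolding ac_def acyclic_iff using Zob by (auto simp: bounded_gr_def supported_on_def)
  have P: "ac (P, d)" unfolding ac_def acyclic_iff using cP bP by auto
  have o: "P n \<in> Obj C" "fst U n \<in> Obj C" "fst V n \<in> Obj C" "fst a n \<in> Obj C" "fst ?t n \<in> Obj C" for n
    using acD(1)[OF P] acD(1)[OF U] acD(1)[OF V] acD(1)[OF a] acD(1)[OF t] by simp_all
  have dm: "d n \<in> mor (P n) (P (n - 1))" "snd U n \<in> mor (fst U n) (fst U (n - 1))" "snd V n \<in> mor (fst V n) (fst V (n - 1))"
    "snd a n \<in> mor (fst a n) (fst a (n - 1))" "snd ?t n \<in> mor (fst ?t n) (fst ?t (n - 1))" for n
    using acD(2)[OF P] acD(2)[OF U] acD(2)[OF V] acD(2)[OF a] acD(2)[OF t] by simp_all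
  note um = SesD(1)[OF t1(1)] and vm = SesD(2)[OF t1(1)] and u'm = SesD(1)[OF t2(1)] and v'm = SesD(2)[OF t2(1)]
  note zV = zer_mor[OF o(3) Zob_Obj] and zU = zer_mor[OF o(2) Zob_Obj] and zz' = zer_mor[OF Zob_Obj Zob_Obj]
  note idV = id_mor[OF o(3)] and idU = id_mor[OF o(2)]
  \<comment> \<open>Up to degree 1 the objects of \<open>U\<close> and \<open>V\<close>, and those
    of \<open>P\<close> and \<open>a\<close>, coincide, so summands are swapped. From degree 2 on
    those of \<open>P\<close> and \<open>U\<close>, and those of \<open>V\<close> and
    \<open>a\<close>, coincide, and the identity fits.\<close>
  define \<theta> where "\<theta> n = (if n \<le> 1 then swap (P n) (fst U n) else Ident C (P n \<boxplus> fst V n))" for n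
  define \<eta> where "\<eta> n = (if n \<le> 1 then swap (fst U n) (P n) else Ident C (P n \<boxplus> fst V n))" for n
  define \<theta>' where "\<theta>' n = (if n \<le> 1 then swap (fst U n) (fst U n) else Ident C (fst U n \<boxplus> fst V n))" for n
  show "sim (csum (P, d) V) (csum U a)"
  proof (rule sim_extension[OF ac_csum[OF U V] ac_csum[OF P V] ac_csum[OF t zz]
        ac_csum[OF U V] ac_csum[OF U a] ac_csum[OF zz t], where
        i = "\<lambda>n. dsum (fst U n) (fst V n) (P n) (fst V n) (u n) (Ident C (fst V n))" and
        p = "\<lambda>n. dsum (P n) (fst V n) (fst ?t n) Zob (v n) (zer (fst V n) Zob)" and
        j = "\<lambda>n. dsum (fst U n) (fst V n) (fst U n) (fst a n) (Ident C (fst U n)) (u' n)" and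
        q = "\<lambda>n. dsum (fst U n) (fst a n) Zob (fst ?t n) (zer (fst U n) Zob) (v' n)" and
        \<theta> = \<theta> and \<theta>' = \<theta>' and \<theta>'' = "\<lambda>n. swap (fst ?t n) Zob" and
        \<eta> = \<eta> and \<eta>' = \<theta>' and \<eta>'' = "\<lambda>n. swap Zob (fst ?t n)"])
    fix n
    show "Ses C (fst (csum U V) n) (dsum (fst U n) (fst V n) (P n) (fst V n) (u n) (Ident C (fst V n)))
         (fst (csum (P, d) V) n) (dsum (P n) (fst V n) (fst ?t n) Zob (v n) (zer (fst V n) Zob)) (fst (csum ?t ?z) n)"
      unfolding csum_def fst_conv by (rule Ses_dsum[OF t1(1) Ses_id_zer[OF Zob o(3)]])
    show "dsum (fst U (n - 1)) (fst V (n - 1)) (P (n - 1)) (fst V (n - 1)) (u (n - 1)) (Ident C (fst V (n - 1))) \<star> snd (csum U V) n =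
         snd (csum (P, d) V) n \<star> dsum (fst U n) (fst V n) (P n) (fst V n) (u n) (Ident C (fst V n))"
      unfolding csum_def fst_conv snd_conv dsum_dsum[OF dm(2,3) um idV] dsum_dsum[OF um idV dm(1,3)]
      by (simp only: t1(2) id_left[OF dm(3)] id_right[OF dm(3)])
    show "dsum (P (n - 1)) (fst V (n - 1)) (fst ?t (n - 1)) Zob (v (n - 1)) (zer (fst V (n - 1)) Zob) \<star> snd (csum (P, d) V) n =
         snd (csum ?t ?z) n \<star> dsum (P n) (fst V n) (fst ?t n) Zob (v n) (zer (fst V n) Zob)"
      unfolding csum_def fst_conv snd_conv dsum_dsum[OF dm(1,3) vm zV] dsum_dsum[OF vm zV dm(5) zz']
      by (simp only: t1(3) zer_comp[OF Zob_Obj dm(3)] zer_comp[OF Zob_Obj zV])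
    show "dsum (fst U (n - 1)) (fst V (n - 1)) (fst U (n - 1)) (fst a (n - 1)) (Ident C (fst U (n - 1))) (u' (n - 1)) \<star> snd (csum U V) n =
         snd (csum U a) n \<star> dsum (fst U n) (fst V n) (fst U n) (fst a n) (Ident C (fst U n)) (u' n)"
      unfolding csum_def fst_conv snd_conv dsum_dsum[OF dm(2,3) idU u'm] dsum_dsum[OF idU u'm dm(2,4)]
      by (simp only: t2(2) id_left[OF dm(2)] id_right[OF dm(2)])
    show "dsum (fst U (n - 1)) (fst a (n - 1)) Zob (fst ?t (n - 1)) (zer (fst U (n - 1)) Zob) (v' (n - 1)) \<star> snd (csum U a) n =
         snd (csum ?z ?t) n \<star> dsum (fst U n) (fst a n) Zob (fst ?t n) (zer (fst U n) Zob) (v' n)"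
      unfolding csum_def fst_conv snd_conv dsum_dsum[OF dm(2,4) zU v'm] dsum_dsum[OF zU v'm zz' dm(5)]
      by (simp only: t2(3) zer_comp[OF Zob_Obj dm(2)] zer_comp[OF Zob_Obj zU])
    show "dsum (fst U n) (fst V n) (fst U n) (fst a n) (Ident C (fst U n)) (u' n) \<in> mor (fst (csum U V) n) (fst (csum U a) n)"
      unfolding csum_def fst_conv by (rule dsum_mor[OF idU u'm])
    show "dsum (fst U n) (fst a n) Zob (fst ?t n) (zer (fst U n) Zob) (v' n) \<in> mor (fst (csum U a) n) (fst (csum ?z ?t) n)"
      unfolding csum_def fst_conv by (rule dsum_mor[OF zU v'm])
    show "inverses (fst (csum U V) n) (\<theta>' n) (fst (csum U V) n) (\<theta>' n)"
      using inverses_swap[OF o(2,2), of n n] inverses_id[OF prd_Obj[OF o(2,3)], of n n] UV[of n]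
      by (cases "n \<le> 1") (simp_all add: csum_def \<theta>'_def)
    show "inverses (fst (csum (P, d) V) n) (\<theta> n) (fst (csum U a) n) (\<eta> n)"
      using inverses_swap[OF o(1,2), of n n] inverses_id[OF prd_Obj[OF o(1,3)], of n n] UV[of n] UP[of n] aP[of n] aV[of n]
      by (auto simp add: csum_def \<theta>_def \<eta>_def)
    show "inverses (fst (csum ?t ?z) n) (swap (fst ?t n) Zob) (fst (csum ?z ?t) n) (swap Zob (fst ?t n))"
      using inverses_swap[OF o(5) Zob_Obj] by (simp add: csum_def)
    show "\<theta> n \<star> dsum (fst U n) (fst V n) (P n) (fst V n) (u n) (Ident C (fst V n)) =
        dsum (fst U n) (fst V n) (fst U n) (fst a n) (Ident C (fst U n)) (u' n) \<star> \<theta>' n"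
    proof (cases "n \<le> 1")
      case True
      then show ?thesis
        using swap_natural[OF um idU, of n n] by (simp add: \<theta>_def \<theta>'_def UV[symmetric] u'u aP)
    next
      case False
      then have n: "n \<ge> 2" by simp
      then show ?thesis
        using o by (simp add: \<theta>_def \<theta>'_def UP u'2 aV dsum_id)
    qed
    show "swap (fst ?t n) Zob \<star> dsum (P n) (fst V n) (fst ?t n) Zob (v n) (zer (fst V n) Zob) =
        dsum (fst U n) (fst a n) Zob (fst ?t n) (zer (fst U n) Zob) (v' n) \<star> \<theta> n"
    proof (cases "n \<le> 1")
      case True
      then show ?thesis
        using swap_natural[OF vm zU, of n n] by (simp add: \<theta>_def UV[symmetric] u'u aP)
    next
      case False
      then have n: "n \<ge> 2" by simp
      have "zer (Zob \<boxplus> Zob) (Zob \<boxplus> Zob) = swap Zob Zob"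
        using zero_objectD(2)[OF zero_object_prd[OF Zob Zob] swap_mor[OF Zob_Obj Zob_Obj]] ..
      then show ?thesis
        using n o by (simp add: \<theta>_def UP u'2 aV dsum_zer t2n)
    qed
    \<comment> \<open>In general \<open>\<theta>'\<close> is not a chain map. This does no harm,
      since \<open>sim\<close> depends on the two complexes only and not on how their graded objects
      are matched.\<close>
    show "sim (csum U V) (csum U V)" by (intro ciso_imp_sim ciso_refl ac_csum U V)
    show "sim (csum ?t ?z) (csum ?z ?t)" by (intro ciso_imp_sim ciso_comm t zz)
  qed
qed

text \<open>\<open>truncation\<close> wants \<open>Zob\<close> itself in the negative degrees, where
  the objects are only known to be zero objects.\<close>

lemma gen_normalise:
  assumes X: "binary_acyclic C X"
  obtains Y where "binary_acyclic C Y" "gr Y = (\<lambda>n. if n < 0 then Zob else gr X n)" "gen X \<longleftrightarrow> gen Y"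
proof -
  define G where "G n = (if n < 0 then Zob else gr X n)" for n
  define \<theta> where "\<theta> n = (if n < 0 then zer (gr X n) Zob else Ident C (gr X n))" for n
  define \<theta>' where "\<theta>' n = (if n < 0 then zer Zob (gr X n) else Ident C (gr X n))" for n
  have a: "acyclic_complex C (gr X) (dtop X)" "acyclic_complex C (gr X) (dbot X)"
    using X by (auto simp: binary_acyclic_def)
  have z: "zero_object C (gr X n)" if "n < 0" for n
    using acyclicD(4)[OF a(1)] that by (auto simp: bounded_gr_def supported_on_def)
  have inv: "inverses (gr X n) (\<theta> n) (G n) (\<theta>' n)" for n
    using z[of n] zero_object_inverses[OF _ Zob] inverses_id[OF acyclicD(1)[OF a(1)]]
    by (auto simp: \<theta>_def \<theta>'_def G_def)
  have m: "\<theta> n \<in> mor (gr X n) (G n)" "\<theta>' n \<in> mor (G n) (gr X n)" for n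
    using inv[of n] by (auto simp: inverses_def)
  define f where "f d n = \<theta> (n - 1) \<star> d n \<star> \<theta>' n" for d n
  have f: "f d n \<in> mor (G n) (G (n - 1))" "\<theta> (n - 1) \<star> d n = f d n \<star> \<theta> n"
    if d: "acyclic_complex C (gr X) d" for d n
  proof -
    note dm = comp_mor[OF m(1) acyclicD(2)[OF d]]
    show "f d n \<in> mor (G n) (G (n - 1))" unfolding f_def by (rule comp_mor[OF dm m(2)])
    show "\<theta> (n - 1) \<star> d n = f d n \<star> \<theta> n"
      unfolding f_def using cancel_inv_right[OF inverses_sym[OF inv] dm] by simp
  qed
  have Y: "binary_acyclic C \<lparr>gr = G, dtop = f (dtop X), dbot = f (dbot X)\<rparr>" (is "binary_acyclic C ?Y")
    using acyclic_transport[OF a(1) inv f[OF a(1)]] acyclic_transport[OF a(2) inv f[OF a(2)]]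
    by (simp add: binary_acyclic_def)
  have "gen X \<longleftrightarrow> gen ?Y"
    by (rule gen_iso[OF X Y, of \<theta> \<theta>' \<theta> \<theta>']) (use inv f(2)[OF a(1)] f(2)[OF a(2)] in simp_all)
  then show thesis by (intro that[OF Y]) (auto simp: G_def)
qed

text \<open>The object of cycles in degree 0 is only isomorphic to \<open>P 0\<close>.\<close>

lemma first_Ses:
  assumes c: "cycles P d J p i" and z: "zero_object C (P (- 1))"
  shows "Ses C (J 1) (i 1) (P 1) (d 1) (P 0)"
proof -
  note s = cyclesD(1)[OF c]
  have s0: "Ses C (J 0) (i 0) (P 0) (p 0) (J (- 1))" and s1: "Ses C (J 1) (i 1) (P 1) (p 1) (J 0)"
    using s[of 0] s[of 1] by simp_all
  note m0 = SesD[OF s0] and m1 = SesD[OF s1]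
  \<comment> \<open>\<open>i (- 1)\<close> is monic with a zero object as target, so the identity of
    its source vanishes.\<close>
  have J: "zero_object C (J (- 1))"
  proof -
    note im = SesD(1)[OF s[of "- 1"]]
    have "Ident C (J (- 1)) = zer (J (- 1)) (J (- 1))"
    proof (rule Ses_monic[OF s[of "- 1"] id_mor[OF m0(6)] zer_mor[OF m0(6,6)]])
      show "i (- 1) \<star> Ident C (J (- 1)) = i (- 1) \<star> zer (J (- 1)) (J (- 1))"
        using zero_objectD(2)[OF z im] zero_objectD(1)[OF z] m0(6) by (simp add: id_right[OF im] comp_zer[OF m0(6) im])
    qed
    then show ?thesis using m0(6) by (simp add: zero_object_iff)
  qed
  \<comment> \<open>Now \<open>p 0\<close> is zero, so \<open>u\<close> splits the monomorphism
    \<open>i 0\<close>, which is therefore an isomorphism.\<close>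
  have "p 0 \<star> Ident C (P 0) = zer (P 0) (J (- 1))"
    using zero_objectD(2)[OF J m0(2)] id_right[OF m0(2)] by simp
  then obtain u where u: "u \<in> mor (P 0) (J 0)" "i 0 \<star> u = Ident C (P 0)"
    by (rule Ses_lift[OF s0 id_mor[OF m0(5)]])
  have "u \<star> i 0 = Ident C (J 0)"
    using assoc[OF m0(1) u(1) m0(1)] u(2) id_left[OF m0(1)] id_right[OF m0(1)]
    by (intro Ses_monic[OF s0 comp_mor[OF u(1) m0(1)] id_mor[OF m0(4)]]) simp
  then have inv: "inverses (J 0) (i 0) (P 0) u" using u m0 by (simp add: inverses_def)
  have d1: "d 1 = i 0 \<star> p 1" using cyclesD(2)[OF c, of 1] by simp
  have "d 1 \<in> mor (P 1) (P 0)" using cyclesD(3)[OF c, of 1] by simp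
  then show ?thesis
    using id_right[OF m1(1)] id_left[OF m1(1)] id_right[of "d 1" "P 1" "P 0"] d1
    by (intro Ses_transport[OF s1 inverses_id[OF m1(4)] inverses_id[OF m1(5)] inv m1(1)]) simp_all
qed

text \<open>Normal forms turn isomorphisms of graded objects into equations, which
  \<open>OB.add_ac\<close> settles by permuting summands.\<close>

definition cls :: "int \<Rightarrow> (int \<Rightarrow> 'o) \<times> (int \<Rightarrow> 'm) \<Rightarrow> 'o" where
  "cls n A = OB.nf (fst A n)"

lemma iso_add:
  assumes "ac A" "ac B" shows "iso (fst A n \<boxplus> fst B n) (fst (CX.add A B) n)"
proof -
  have "ciso (csum A B) (CX.add A B)" using assms by (intro CX.R_add) auto
  then have "iso (fst (csum A B) n) (fst (CX.add A B) n)" by (rule cisoE) (auto simp: iso_def)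
  then show ?thesis by (simp add: csum_def)
qed

lemma cls_add: "ac A \<Longrightarrow> ac B \<Longrightarrow> cls n (CX.add A B) = OB.add (cls n A) (cls n B)"
  unfolding cls_def using OB.nf_eqI[OF iso_add] OB.nf_opn[OF acD(1) acD(1)] by metis

lemma ac_add: "ac A \<Longrightarrow> ac B \<Longrightarrow> ac (CX.add A B)"
  using CX.add_in by simp

lemma giso_cls:
  assumes "ac A" "ac B" "\<And>n. cls n A = cls n B" shows "giso A B"
  unfolding giso_def
proof
  fix n
  have "iso (fst A n) (cls n A)" "iso (fst B n) (cls n B)"
    unfolding cls_def using OB.R_nf acD(1) assms(1,2) by blast+
  then show "iso (fst A n) (fst B n)" using assms(3)[of n] iso_sym iso_trans by metis
qed

lemma supported_add:
  assumes "ac A" "ac B" "supported_on C (fst A) S" "supported_on C (fst B) S"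
  shows "supported_on C (fst (CX.add A B)) S"
proof (rule supported_iso)
  show "supported_on C (\<lambda>n. fst A n \<boxplus> fst B n) S"
    using assms(3,4) by (auto simp: supported_on_def intro: zero_object_prd)
  show "iso (fst (CX.add A B) n) (fst A n \<boxplus> fst B n)" for n
    by (rule iso_sym[OF iso_add[OF assms(1,2)]])
qed

lemma ciso_add: "ac A \<Longrightarrow> ac B \<Longrightarrow> ciso (csum A B) (CX.add A B)"
  by (intro CX.R_add) auto

lemma sim_add: "sim A B \<Longrightarrow> sim A' B' \<Longrightarrow> sim (CX.add A A') (CX.add B B')"
  using sim_ciso[OF sim_sum ciso_add ciso_add] sim_ac by blast

lemma sim_add_cancel:
  assumes "sim (CX.add A T) (CX.add B T)" "ac A" "ac B" "ac T" "giso A B"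
  shows "sim A B"
  using sim_cancel[OF sim_ciso[OF assms(1) ciso_sym[OF ciso_add] ciso_sym[OF ciso_add]]] assms by blast

text \<open>The bound 3 leaves room for the auxiliary complexes \<open>\<gamma>\<close>,
  \<open>\<delta>\<close>, \<open>c2\<close> and \<open>c2'\<close>, which reach up to degree
  3.\<close>

lemma gen_step:
  assumes IH: "\<And>X. binary_acyclic C X \<Longrightarrow> supported_on C (gr X) {0..b} \<Longrightarrow> gen X" and b: "3 \<le> b"
    and X0: "binary_acyclic C X0" "supported_on C (gr X0) {0..b + 1}"
  shows "gen X0"
proof -
  obtain X where X: "binary_acyclic C X" "gr X = (\<lambda>n. if n < 0 then Zob else gr X0 n)" "gen X0 \<longleftrightarrow> gen X"
    by (rule gen_normalise[OF X0(1)])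
  define P where "P = gr X"
  define d where "d = dtop X"
  define e where "e = dbot X"
  have z: "P n = Zob" if "n < 0" for n using that by (simp add: P_def X(2))
  have sP: "supported_on C P {0..b + 1}" using X0(2) Zob by (auto simp: P_def X(2) supported_on_def)
  have acP: "ac (P, d)" "ac (P, e)" using ac_top[OF X(1)] ac_bot[OF X(1)] by (simp_all add: P_def d_def e_def)
  then obtain J p i K q j where c: "cycles P d J p i" and c': "cycles P e K q j" and bP: "bounded_gr P"
    unfolding ac_def acyclic_iff by auto
  have PO: "P n \<in> Obj C" for n using acD(1)[OF acP(1)] by simp
  have z1: "zero_object C (P (- 1))" using z[of "- 1"] Zob by simp
  note s = first_Ses[OF c z1] and s' = first_Ses[OF c' z1]
  \<comment> \<open>\<open>A\<close> and \<open>B\<close> are the images called J and K in the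
    overview; its V and b appear below as \<open>U'\<close> and \<open>a'\<close>.\<close>
  define A where "A = J 1"
  define B where "B = K 1"
  have AO: "A \<in> Obj C" "B \<in> Obj C" using SesD(4)[OF s] SesD(4)[OF s'] by (simp_all add: A_def B_def)
  obtain G x y x' y' where g: "Ses C A x G y (P 1)" "Ses C B x' G y' (P 1)"
    by (rule Ses_common_pullback[OF s s', folded A_def B_def])
  have GO: "G \<in> Obj C" by (rule SesD(5)[OF g(1)])
  define a where "a = ses_cx 0 A (i 1) (P 1) (d 1) (P 0)"
  define a' where "a' = ses_cx 0 B (j 1) (P 1) (e 1) (P 0)"
  define U where "U = upper P d A (p 2)"
  define U' where "U' = upper P e B (q 2)"
  \<comment> \<open>The contractible complex on \<open>A\<close> in degrees 2 and 1 that
    \<open>sim_truncation\<close> adds to \<open>P\<close>; \<open>c1'\<close> is its counterpart on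
    \<open>B\<close>.\<close>
  define c1 where "c1 = upper (fst a) (snd a) A (Ident C A)"
  define c1' where "c1' = upper (fst a') (snd a') B (Ident C B)"
  have "ac U" "ac c1" and t: "sim (csum (P, d) c1) (csum U a)"
    unfolding U_def c1_def a_def A_def by (rule sim_truncation[OF c bP z s]; simp)+
  moreover have "ac U'" "ac c1'" and t': "sim (csum (P, e) c1') (csum U' a')"
    unfolding U'_def c1'_def a'_def B_def by (rule sim_truncation[OF c' bP z s']; simp)+
  moreover have "ac a" "ac a'"
    unfolding a_def a'_def A_def B_def using s s' by (intro ac_ses_cx; simp)+
  moreover define \<gamma> where "\<gamma> = ses_cx 1 A x G y (P 1)"
  moreover define \<delta> where "\<delta> = ses_cx 1 B x' G y' (P 1)"
  moreover have "ac \<gamma>" "ac \<delta>" unfolding \<gamma>_def \<delta>_def using g by (intro ac_ses_cx; simp)+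
  \<comment> \<open>Contractible, with \<open>A\<close> in degrees 3 and 2. With \<open>c2\<close>
    on one side and \<open>c1\<close> on the other, an \<open>A\<close> in degree 1 is traded for an
    \<open>A\<close> in degree 3.\<close>
  moreover define c2 where "c2 = ses_cx 2 Zob (zer Zob A) A (Ident C A) A"
  moreover define c2' where "c2' = ses_cx 2 Zob (zer Zob B) B (Ident C B) B"
  moreover have "ac c2" "ac c2'" unfolding c2_def c2'_def using Ses_zer_id[OF Zob] AO by (intro ac_ses_cx; simp)+
  ultimately have acs: "ac U" "ac U'" "ac c1" "ac c1'" "ac a" "ac a'" "ac \<gamma>" "ac \<delta>" "ac c2" "ac c2'"
    by blast+
  note acs = acs acP
  note grs = U_def U'_def c1_def c1'_def a_def a'_def \<gamma>_def \<delta>_def c2_def c2'_def upper_def fst_ses_cx ses_gr_def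
  note nfs = OB.nf_in[OF AO(1)] OB.nf_in[OF AO(2)] OB.nf_in[OF GO] OB.nf_in[OF PO] OB.nf_in[OF Zob_Obj]
  have T: "sim (CX.add (P, d) c1) (CX.add U a)" "sim (CX.add (P, e) c1') (CX.add U' a')"
    using sim_ciso[OF t ciso_add ciso_add] sim_ciso[OF t' ciso_add ciso_add] acs by blast+
  \<comment> \<open>A complex that is zero in degree 0 can be shifted down by one, into the range of
    the induction hypothesis.\<close>
  have short: "gen Y" if Y: "binary_acyclic C Y" "supported_on C (gr Y) {1..b + 1}" for Y
  proof -
    have s1: "supported_on C (gr Y) {1..}" using Y(2) by (auto simp: supported_on_def)
    have "gen (shiftb 1 Y)"
      using Y(2) by (intro IH shiftb_acyclic[OF Y(1) s1]) (auto simp: supported_on_def shiftb_def)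
    then show ?thesis using gen_unshift[OF Y(1) s1] by simp
  qed
  \<comment> \<open>Each side has \<open>A\<close>, \<open>B\<close>, \<open>P 1\<close> in degree
    1, \<open>P 2\<close>, \<open>G\<close>, \<open>A\<close>, \<open>B\<close> in degree 2,
    \<open>P 3\<close>, \<open>A\<close>, \<open>B\<close> in degree 3, and only \<open>P n\<close>
    above.\<close>
  have W: "sim (CX.add U (CX.add \<delta> (CX.add c2 c1'))) (CX.add U' (CX.add \<gamma> (CX.add c2' c1)))" (is "sim ?L ?R")
  proof (rule sim_short[OF short])
    show l: "ac ?L" and r: "ac ?R" by (intro ac_add acs)+
    have "cls n ?L = cls n ?R" for n
    proof -
      consider "n \<le> 0" | "n = 1" | "n = 2" | "n = 3" | "n \<ge> 4" by linarith
      then show ?thesis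
        by cases (simp_all add: cls_add ac_add acs, simp_all add: cls_def grs nfs OB.add_ac)
    qed
    then show "giso ?L ?R" by (rule giso_cls[OF l r])
    show "supported_on C (fst ?L) {1..b + 1}"
      by (intro supported_add ac_add acs) (use b Zob sP in \<open>auto simp: grs supported_on_def\<close>)
  qed
  \<comment> \<open>Each side has \<open>P 0\<close> in degree 0, twice \<open>P 1\<close> in degree
    1, \<open>G\<close>, \<open>A\<close>, \<open>B\<close> in degree 2, and \<open>A\<close>,
    \<open>B\<close> in degree 3.\<close>
  have Z: "sim (CX.add a (CX.add \<gamma> c2')) (CX.add a' (CX.add \<delta> c2))" (is "sim ?L ?R")
  proof (rule sim_short[OF IH])
    show l: "ac ?L" and r: "ac ?R" by (intro ac_add acs)+
    have "cls n ?L = cls n ?R" for n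
    proof -
      consider "n < 0" | "n = 0" | "n = 1" | "n = 2" | "n = 3" | "n \<ge> 4" by linarith
      then show ?thesis
        by cases (simp_all add: cls_add ac_add acs, simp_all add: cls_def grs nfs OB.add_ac)
    qed
    then show "giso ?L ?R" by (rule giso_cls[OF l r])
    show "supported_on C (fst ?L) {0..b}"
      by (intro supported_add ac_add acs) (use b Zob in \<open>auto simp: grs supported_on_def\<close>)
  qed
  \<comment> \<open>The four relations are added, the second truncation reversed. All summands
    except the two complexes on \<open>P\<close> then occur on both sides, and together they form
    \<open>T\<close>.\<close>
  have "sim (CX.add (CX.add (P, d) c1) (CX.add (CX.add U' a')
        (CX.add (CX.add U (CX.add \<delta> (CX.add c2 c1'))) (CX.add a (CX.add \<gamma> c2')))))
      (CX.add (CX.add U a) (CX.add (CX.add (P, e) c1')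
        (CX.add (CX.add U' (CX.add \<gamma> (CX.add c2' c1))) (CX.add a' (CX.add \<delta> c2)))))"
    by (rule sim_add[OF T(1) sim_add[OF sim_sym[OF T(2)] sim_add[OF W Z]]])
  moreover define T where "T = CX.add c1 (CX.add (CX.add U' a')
        (CX.add (CX.add U (CX.add \<delta> (CX.add c2 c1'))) (CX.add a (CX.add \<gamma> c2'))))"
  have "CX.add (CX.add (P, d) c1) (CX.add (CX.add U' a')
        (CX.add (CX.add U (CX.add \<delta> (CX.add c2 c1'))) (CX.add a (CX.add \<gamma> c2')))) = CX.add (P, d) T"
    unfolding T_def by (rule CX.add_assoc) (use acs ac_add in simp_all)
  moreover have "CX.add (CX.add U a) (CX.add (CX.add (P, e) c1')
        (CX.add (CX.add U' (CX.add \<gamma> (CX.add c2' c1))) (CX.add a' (CX.add \<delta> c2)))) = CX.add (P, e) T"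
    unfolding T_def using acs by (simp add: CX.add_ac ac_add)
  moreover have acT: "ac T" unfolding T_def by (intro ac_add acs)
  moreover have "giso (P, d) (P, e)" using PO iso_refl by (simp add: giso_def)
  ultimately have "sim (P, d) (P, e)" using sim_add_cancel[OF _ acP acT] by simp
  then have "gen X"
    by (rule sim_gen[OF _ X(1)]) (use ciso_refl[OF acP(1)] ciso_refl[OF acP(2)] in \<open>simp_all add: P_def d_def e_def\<close>)
  then show ?thesis using X(3) by simp
qed

lemma gen_bounded: "binary_acyclic C X \<Longrightarrow> supported_on C (gr X) {0..int k + 4} \<Longrightarrow> gen X"
proof (induction k arbitrary: X)
  case 0
  then show ?case using gen_base by simp
next
  case (Suc k)
  have "int (Suc k) + 4 = (int k + 4) + 1" by simp
  then show ?case
    using Suc.prems by (intro gen_step[of "int k + 4" X, OF Suc.IH]) simp_all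
qed

lemma gen_all:
  assumes X: "binary_acyclic C X" shows "gen X"
proof -
  have "bounded_gr (gr X)" using X acyclicD(4) by (auto simp: binary_acyclic_def)
  then obtain b where b: "supported_on C (gr X) {0..}" "supported_on C (gr X) {..b}"
    by (auto simp: bounded_gr_def)
  have "supported_on C (gr X) {0..int (nat b) + 4}"
    unfolding supported_on_def
  proof (intro allI impI)
    fix n assume "n \<notin> {0..int (nat b) + 4}"
    then have "n \<notin> {0..} \<or> n \<notin> {..b}" by auto
    then show "zero_object C (gr X n)" using b unfolding supported_on_def by blast
  qed
  then show ?thesis by (rule gen_bounded[OF X])
qed

end

text \<open>The target is generated by classes of single complexes, so it suffices that each of them
  lies in the image, which is what \<open>gen_all\<close> yields for this property.\<close>

theorem theorem1p3:
  fixes N :: "('o, 'm) excat"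
  assumes "exact_category N"
  shows "K0_Omega_incl (Bq N) \<in> epi (K0_Omega (Bq_on {0..4} N)) (K0_Omega (Bq N))"
proof -
  interpret exact_category N by fact
  let ?E = "Bq N" and ?E' = "Bq_on {0..4} N"
  let ?F = "free_Abelian_group (Obj ?E)"
  let ?\<phi> = "K0_Omega_incl ?E"
  \<comment> \<open>The projection from the free group to the target, through both quotients at
    once.\<close>
  define q where "q x = diagonal_subgroup ?E #>\<^bsub>K0 ?E\<^esub> (ses_relations ?E #>\<^bsub>?F\<^esub> x)" for x
  interpret S: normal "ses_relations ?E" ?F by (rule ses_relations_normal) (rule Ses_Obj_Bq)
  interpret D: normal "diagonal_subgroup ?E" "K0 ?E" by (rule diagonal_subgroup_normal) (rule Ses_Obj_Bq)
  interpret D': normal "diagonal_subgroup ?E'" "K0 ?E'" by (rule diagonal_subgroup_normal) (rule Ses_Obj_Bq_on)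
  have G: "group (K0_Omega ?E)" unfolding K0_Omega_def by (rule D.factorgroup_is_group)
  have G': "group (K0_Omega ?E')" unfolding K0_Omega_def by (rule D'.factorgroup_is_group)
  interpret \<phi>: group_hom "K0_Omega ?E'" "K0_Omega ?E" ?\<phi>
    by (intro group_hom.intro group_hom_axioms.intro G G' K0_Omega_incl_hom)
  have "q \<in> hom ?F (K0_Omega ?E)"
    using hom_compose[OF S.r_coset_hom_Mod D.r_coset_hom_Mod[unfolded K0_def[of ?E]]]
    unfolding q_def K0_Omega_def K0_def[of ?E] comp_def .
  then interpret q: group_hom ?F "K0_Omega ?E" q
    by (intro group_hom.intro group_hom_axioms.intro G group_free_Abelian_group)
  define I where "I = ?\<phi> ` carrier (K0_Omega ?E')"
  interpret I: subgroup I "K0_Omega ?E" unfolding I_def by (rule \<phi>.img_is_subgroup)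
  have q_class: "q (frag_of X) = K0_Omega_class ?E X" for X
    by (simp add: q_def K0_Omega_class_def K0_class_def)
  have Obj: "X \<in> Obj ?E \<longleftrightarrow> binary_acyclic N X" for X by (simp add: Bq_def)
  have Obj': "X \<in> Obj ?E' \<longleftrightarrow> binary_acyclic N X \<and> supported_on N (gr X) {0..4}" for X
    by (simp add: Bq_def Bq_on_def full_subcategory_def)
  have ses: "q (frag_of Y) = q (frag_of X) \<otimes>\<^bsub>K0_Omega ?E\<^esub> q (frag_of Z)"
    "q (frag_of X) \<in> carrier (K0_Omega ?E)" "q (frag_of Y) \<in> carrier (K0_Omega ?E)" "q (frag_of Z) \<in> carrier (K0_Omega ?E)"
    if s: "Ses ?E X i Y p Z" for X i Y p Z
  proof -
    have c: "frag_of X \<in> carrier ?F" "frag_of Y \<in> carrier ?F" "frag_of Z \<in> carrier ?F"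
      using Ses_Obj_Bq[OF s] by simp_all
    then show "q (frag_of X) \<in> carrier (K0_Omega ?E)" "q (frag_of Y) \<in> carrier (K0_Omega ?E)" "q (frag_of Z) \<in> carrier (K0_Omega ?E)"
      using q.hom_closed by blast+
    \<comment> \<open>The defining relation of the sequence, which \<open>q\<close> sends to the
      unit.\<close>
    let ?r = "frag_of Y - frag_of X - frag_of Z"
    have r: "?r \<in> ses_relations ?E" unfolding ses_relations_def using s by (intro generate.incl) blast
    have rc: "?r \<in> carrier ?F" using S.subset r by blast
    have XZ: "frag_of X + frag_of Z \<in> carrier ?F" using S.m_closed[OF c(1,3)] by simp
    have "ses_relations ?E #>\<^bsub>?F\<^esub> ?r = ses_relations ?E #>\<^bsub>?F\<^esub> \<one>\<^bsub>?F\<^esub>"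
      using S.coset_join2[OF rc S.subgroup_axioms r] S.coset_join2[OF S.one_closed S.subgroup_axioms subgroup.one_closed[OF S.subgroup_axioms]] by simp
    then have "q ?r = q \<one>\<^bsub>?F\<^esub>" by (simp only: q_def)
    then have r1: "q ?r = \<one>\<^bsub>K0_Omega ?E\<^esub>" by (simp only: q.hom_one)
    have "q (frag_of Y) = q (?r \<otimes>\<^bsub>?F\<^esub> (frag_of X + frag_of Z))" by simp
    also have "\<dots> = q (frag_of X + frag_of Z)"
      unfolding q.hom_mult[OF rc XZ] r1 using q.hom_closed[OF XZ] by simp
    also have "\<dots> = q (frag_of X) \<otimes>\<^bsub>K0_Omega ?E\<^esub> q (frag_of Z)"
      using q.hom_mult[OF c(1,3)] by simp
    finally show "q (frag_of Y) = q (frag_of X) \<otimes>\<^bsub>K0_Omega ?E\<^esub> q (frag_of Z)" .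
  qed
  \<comment> \<open>Diagonal complexes go to the unit, those supported on \<open>{0..4}\<close> are
    in the image by construction, and two out of three holds because \<open>I\<close> is a
    subgroup.\<close>
  interpret gen: generated_class N "\<lambda>X. q (frag_of X) \<in> I"
  proof unfold_locales
    fix X assume X: "binary_acyclic N X" "dtop X = dbot X"
    have "K0_class ?E X \<in> diagonal_subgroup ?E"
      unfolding diagonal_subgroup_def using X Obj by (intro generate.incl) blast
    then have "q (frag_of X) = \<one>\<^bsub>K0_Omega ?E\<^esub>"
      unfolding q_class K0_Omega_class_def
      using D.coset_join2[OF D.mem_carrier D.subgroup_axioms] by (simp add: K0_Omega_def FactGroup_def)
    then show "q (frag_of X) \<in> I" by simp
  next
    fix X assume X: "binary_acyclic N X" "supported_on N (gr X) {0..4}"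
    then have X': "X \<in> Obj ?E'" by (simp add: Obj')
    have "K0_Omega_class ?E' X \<in> carrier (K0_Omega ?E')"
      unfolding K0_Omega_class_def K0_Omega_def
      by (rule hom_in_carrier[OF D'.r_coset_hom_Mod K0_class_in[OF Ses_Obj_Bq_on X']])
    then show "q (frag_of X) \<in> I"
      unfolding q_class I_def using K0_Omega_incl_class[OF X'] by force
  next
    fix X i Y p Z assume s: "Ses ?E X i Y p Z"
    note s = ses[OF s]
    show "q (frag_of Y) \<in> I" if "q (frag_of X) \<in> I" "q (frag_of Z) \<in> I"
      unfolding s(1) using that by (rule I.m_closed)
    show "q (frag_of X) \<in> I" if Y: "q (frag_of Y) \<in> I" and Z: "q (frag_of Z) \<in> I"
      using I.m_closed[OF Y I.m_inv_closed[OF Z]] s by (simp add: \<phi>.H.m_assoc)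
    show "q (frag_of Z) \<in> I" if X: "q (frag_of X) \<in> I" and Y: "q (frag_of Y) \<in> I"
      using I.m_closed[OF I.m_inv_closed[OF X] Y] s by (simp add: \<phi>.H.m_assoc[symmetric])
  qed
  \<comment> \<open>Membership in the carrier is part of the induction so that \<open>q\<close> may
    be applied to differences as a homomorphism.\<close>
  have all: "x \<in> carrier ?F \<and> q x \<in> I" if "x \<in> carrier ?F" for x
  proof -
    have "Poly_Mapping.keys x \<subseteq> Obj ?E" using that by simp
    then show ?thesis
    proof (induction x rule: frag_induction)
      case zero
      have "q \<one>\<^bsub>?F\<^esub> = \<one>\<^bsub>K0_Omega ?E\<^esub>" by (rule q.hom_one)
      then show ?case by simp
    next
      case (one X)
      then show ?case using gen.gen_all by (simp add: Obj)
    next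
      case (diff a b)
      then have a: "a \<in> carrier ?F" "q a \<in> I" and b: "b \<in> carrier ?F" "q b \<in> I" by blast+
      have "a \<otimes>\<^bsub>?F\<^esub> inv\<^bsub>?F\<^esub> b = a - b" using b by simp
      then show ?case
        using S.m_closed[OF a(1) S.inv_closed[OF b(1)]] q.hom_mult[OF a(1) S.inv_closed[OF b(1)]]
          q.hom_inv[OF b(1)] I.m_closed[OF a(2) I.m_inv_closed[OF b(2)]] by metis
    qed
  qed
  have "carrier (K0_Omega ?E) \<subseteq> I"
  proof
    fix y assume "y \<in> carrier (K0_Omega ?E)"
    then obtain c where c: "c \<in> carrier (K0 ?E)" "y = diagonal_subgroup ?E #>\<^bsub>K0 ?E\<^esub> c"
      unfolding K0_Omega_def carrier_FactGroup by blast
    from c(1) obtain x where "x \<in> carrier ?F" "c = ses_relations ?E #>\<^bsub>?F\<^esub> x"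
      unfolding K0_def carrier_FactGroup by blast
    then show "y \<in> I" using all[of x] c(2) by (simp add: q_def)
  qed
  then show ?thesis
    using \<phi>.homh I.subset unfolding epi_def I_def by blast
qed

end
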